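(* In the setting fixed in the context (smooth data, box constraints), suppose the structural condition (A) holds with constants $\tau,\sigma>0$, the density $\rho$ satisfies condition (D), and $0<\mu<\bar\mu_2$, where $$\bar\mu_2=\min\left\{\frac{\tau}{\alpha},\ \frac{\lambda\sigma\underline\rho_2}{L_{c,1}},\ \frac{\lambda_1\check\rho_2\sigma^2}{\tau L_{c,2}/\alpha+\lambda_1\bar\rho_2L_{g,2}},\ \frac{\lambda_2\check\rho_2\sigma^2}{\tau L_{c,2}/\alpha+\lambda_2\bar\rho_2L_{h,2}}\right\},\qquad\lambda=\min\{\lambda_1,\lambda_2\}.$$ Consider $(\mathrm{P})$: $\min_{x\in X}\max_{y\in Y}f(x,y)$ and $(\mathrm{P}_\mu)$: $\min_{x\in X}\max_{y\in Y}f^R(x,y,\mu)$. Then the following statements hold. (i) If $(x^*,y^* )$ is a weak second order stationary point of $(\mathrm{P}_\mu)$, then $g_{\hat i}(x^*_i)\notin(0,\alpha\mu)$ for all $i\in[n]$, $\hat i\in\{i,n+i\}$, and $h_{\hat j}(y^*_j)\notin(0,\alpha\mu)$ for all $j\in[m]$, $\hat j\in\{j,m+j\}$. (ii) $(x^*,y^* )$ is a saddle point of $(\mathrm{P})$ if and only if it is a saddle point of $(\mathrm{P}_\mu)$. (iii) $(x^*,y^* )$ is an $\alpha\mu$-strong local saddle point of $(\mathrm{P})$ if it is a local saddle point of $(\mathrm{P}_\mu)$. (iv) When the functions $g_i$, $h_j$ are convex for all $i\in[2n]$ and $j\in[2m]$, $(x^*,y^* )$ is an $\alpha\mu$-strong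 local saddle point of $(\mathrm{P})$ if it is a weak second order stationary point of $(\mathrm{P}_\mu)$.
   Context: Notation. $[k]=\{1,\dots,k\}$; $e_i$ is the $i$-th standard unit vector; $\mathbf{B}(z,\delta)$ is the closed ball with center $z$ and radius $\delta$; $(t_+)^0=1$ if $t>0$ and $(t_+)^0=0$ if $t\le0$; $\mathcal{N}_\Omega(x)$ is the normal cone of a closed convex set $\Omega$ at $x$; $\partial$ is the Clarke subdifferential and, for a function with locally Lipschitz gradient, $\partial^2$ is Clarke's generalized Hessian; $\partial^2_{xx}c(\bar x,\bar y)$ is the generalized Hessian of $c(\cdot,\bar y)$ at $\bar x$, $\partial^2_{yy}c(\bar x,\bar y)$ that of $c(\bar x,\cdot)$ at $\bar y$; $[\partial^2_{xx}c]_{ii}$ is the set of $(i,i)$ entries of matrices in $\partial^2_{xx}c$. Data. $c:\mathbb{R}^n\times\mathbb{R}^m\to\mathbb{R}$ is convex in $x$ for each $y$ and concave in $y$ for each $x$, Lipschitz continuous, and Lipschitz continuously differentiable (Lipschitz gradient); $g_1,\dots,g_{2n},h_1,\dots,h_{2m}:\mathbb{R}\to\mathbb{R}$ are Lipschitz continuously differentiable; $\lambda_1,\lambda_2>0$; $X=\{x\in\mathbb{R}^n:\underline{\mathbf u}\le x\le\overline{\mathbf u}\}$, $Y=\{y\in\mathbb{R}^m:\underline{\mathbf v}\le y\le\overline{\mathbf v}\}$ with $\underline{\mathbf u}<\overline{\mathbf u}$, $\underline{\mathbf v}<\overline{\mathbf v}$ (componentwise); $X_i=[\underline{\mathbf u}_i,\overline{\mathbf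 u}_i]$, $Y_j=[\underline{\mathbf v}_j,\overline{\mathbf v}_j]$. The objective is $$f(x,y)=c(x,y)+\lambda_1\sum_{i=1}^n\big((g_i(x_i)_+)^0+(g_{n+i}(x_i)_+)^0\big)-\lambda_2\sum_{j=1}^m\big((h_j(y_j)_+)^0+(h_{m+j}(y_j)_+)^0\big).$$ Structural condition (A) with constants $\tau,\sigma>0$: (i) for any $x\in X$, $i\in[n]$ and $(\hat i,\check i)\in\{(i,n+i),(n+i,i)\}$, if $g_{\hat i}(x_i)\in(0,\tau)$ then $x_i\in\mathrm{int}(X_i)$, $g_{\check i}(x_i)\notin[0,\tau]$ and $|g_{\hat i}'(x_i)|\ge\sigma$; (ii) for any $y\in Y$, $j\in[m]$ and $(\hat j,\check j)\in\{(j,m+j),(m+j,j)\}$, if $h_{\hat j}(y_j)\in(0,\tau)$ then $y_j\in\mathrm{int}(Y_j)$, $h_{\check j}(y_j)\notin[0,\tau]$ and $|h_{\hat j}'(y_j)|\ge\sigma$. Relaxation. $\rho:\mathbb{R}\to[0,+\infty)$ is a piecewise continuous density function (integral $1$) with $\rho(s)=0$ for $s\notin[0,\alpha]$, $\alpha>0$; $r(t,\mu)=\int_{-\infty}^{t/\mu}\rho(s)\,ds$, with $\partial_t r(t,\mu)$ the Clarke subdifferential of $r(\cdot,\mu)$ at $t$ (the convex hull of the limits of $\rho(s/\mu)/\mu$ as $s\to t$). For $\mu>0$, $$f^R(x,y,\mu)=c(x,y)+\lambda_1\sum_{i=1}^n\big(r(g_i(x_i),\mu)+r(g_{n+i}(x_i),\mu)\big)-\lambda_2\sum_{j=1}^m\big(r(h_j(y_j),\mu)+r(h_{m+j}(y_j),\mu)\big).$$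 Condition (D): $\rho$ is Lipschitz continuous on $(0,+\infty)$ and there exist $\underline\rho_2>0$, $\check\rho_2>0$ such that for every $s\in(0,\alpha)$, either $\rho(s)\ge\underline\rho_2$ or $\sup\{a:a\in\partial\rho(s)\}\le-\check\rho_2$. Constants. $L_{c,1}>0$ satisfies $\|\nabla_x c(x,y)\|_\infty\le L_{c,1}$, $\|\nabla_y c(x,y)\|_\infty\le L_{c,1}$ for all $(x,y)\in X\times Y$. $L_{c,2}$ bounds $|H_{ii}|$ and $|M_{jj}|$ for all $H\in\partial^2_{xx}c(x,y)$, $M\in\partial^2_{yy}c(x,y)$, $(x,y)\in X\times Y$, $i\in[n]$, $j\in[m]$. $L_{g,2}$ bounds $|\xi|$ for all $\xi\in\partial^2g_{\tilde i}(x_i)$, $x_i\in X_i$, $i\in[n]$, $\tilde i\in\{i,n+i\}$; $L_{h,2}$ bounds $|\eta|$ for all $\eta\in\partial^2h_{\tilde j}(y_j)$, $y_j\in Y_j$, $j\in[m]$, $\tilde j\in\{j,m+j\}$. $\bar\rho_2>0$ satisfies $\rho(s)\le\bar\rho_2$ for $s\in(0,\alpha)$. In $\bar\mu_2$, a fraction with zero denominator is read as $+\infty$. First- and second-order sets. With $\partial_t r(g_i(x_i),\mu)$ meaning $\partial_t r(t,\mu)$ at $t=g_i(x_i)$, etc., $$\tilde\partial_x f^R(x,y,\mu)=\nabla_x c(x,y)+\lambda_1\sum_{i=1}^n\big(\partial_t r(g_i(x_i),\mu)g_i'(x_i)+\partial_t r(g_{n+i}(x_i),\mu)g_{n+i}'(x_i)\big)e_i,$$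 $$\tilde\partial_y f^R(x,y,\mu)=\nabla_y c(x,y)-\lambda_2\sum_{j=1}^m\big(\partial_t r(h_j(y_j),\mu)h_j'(y_j)+\partial_t r(h_{m+j}(y_j),\mu)h_{m+j}'(y_j)\big)e_j.$$ For $w=g_i$ or $w=h_j$ and $t$ with $w(t)>0$, $$\tilde\partial^2_{tt}r(w(t),\mu)=\frac{\partial\rho(w(t)/\mu)}{\mu^2}(w'(t))^2+\frac{\rho(w(t)/\mu)}{\mu}\,\partial^2w(t).$$ $\mathcal{A}^+_\tau(x)=\{i\in[n]:0<g_i(x_i)<\tau\text{ or }0<g_{n+i}(x_i)<\tau\}$, $\mathcal{B}^+_\tau(y)=\{j\in[m]:0<h_j(y_j)<\tau\text{ or }0<h_{m+j}(y_j)<\tau\}$. Weak second order stationary point of $(\mathrm{P}_\mu)$: a point $(x^*,y^* )\in X\times Y$ with $0\in\tilde\partial_x f^R(x^*,y^*,\mu)+\mathcal{N}_X(x^* )$ and $0\in-\tilde\partial_y f^R(x^*,y^*,\mu)+\mathcal{N}_Y(y^* )$ such that — for every $i\in\mathcal{A}^+_\tau(x^* )$ there is a unique $\hat i\in\{i,n+i\}$ with $0<g_{\hat i}(x_i^* )<\tau$, and there is $\omega_i\in[\partial^2_{xx}c(x^*,y^* )]_{ii}+\lambda_1\tilde\partial^2_{tt}r(g_{\hat i}(t),\mu)|_{t=x_i^*}$ with $\omega_i\ge0$; — for every $j\in\mathcal{B}^+_\tau(y^* )$ there is a unique $\hat j\in\{j,m+j\}$ with $0<h_{\hat j}(y_j^*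 )<\tau$, and there is $\varpi_j\in-[\partial^2_{yy}c(x^*,y^* )]_{jj}+\lambda_2\tilde\partial^2_{tt}r(h_{\hat j}(t),\mu)|_{t=y_j^*}$ with $\varpi_j\ge0$. Saddle points. $(x^*,y^* )\in X\times Y$ is a saddle point of $\min_{x\in X}\max_{y\in Y}F(x,y)$ if $F(x^*,y)\le F(x^*,y^* )\le F(x,y^* )$ for all $(x,y)\in X\times Y$; a local saddle point if there is a $\delta>0$ such that this holds for all $x\in X\cap\mathbf{B}(x^*,\delta)$, $y\in Y\cap\mathbf{B}(y^*,\delta)$. For $\nu>0$, a $\nu$-strong local saddle point of $(\mathrm{P})$ is a local saddle point $(x^*,y^* )$ of $(\mathrm{P})$ with $g_i(x^*_i),g_{n+i}(x^*_i)\notin(0,\nu)$ for all $i\in[n]$ and $h_j(y^*_j),h_{m+j}(y^*_j)\notin(0,\nu)$ for all $j\in[m]$. *)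

theory Defs
  imports "HOL-Analysis.Analysis" "HOL-Library.Set_Algebras"
begin

section \<open>Gradients and Clarke's generalized derivatives\<close>

definition gradient :: "('a::euclidean_space \<Rightarrow> real) \<Rightarrow> 'a \<Rightarrow> 'a" where
  "gradient F z = (THE D. GDERIV F z :> D)"

text \<open>Here ``Lipschitz'' is meant globally, on the whole space.\<close>

definition lipschitz_continuous :: "('a::metric_space \<Rightarrow> 'b::metric_space) \<Rightarrow> bool" where
  "lipschitz_continuous F \<longleftrightarrow> (\<exists>L. L-lipschitz_on UNIV F)"

definition lipschitz_cont_diff :: "('a::euclidean_space \<Rightarrow> real) \<Rightarrow> bool" where
  "lipschitz_cont_diff F \<longleftrightarrow> (\<forall>z. \<exists>D. GDERIV F z :> D) \<and> lipschitz_continuous (gradient F)"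

text \<open>Clarke subdifferential of a function that is Lipschitz near the point: the convex hull of the
  limits of gradients along sequences of points of differentiability.\<close>

definition clarke_subdiff :: "('a::euclidean_space \<Rightarrow> real) \<Rightarrow> 'a \<Rightarrow> 'a set" where
  "clarke_subdiff F z = convex hull
     {\<xi>. \<exists>Z D. Z \<longlonglongrightarrow> z \<and> D \<longlonglongrightarrow> \<xi> \<and> (\<forall>k. GDERIV F (Z k) :> D k)}"

text \<open>Clarke's generalized Hessian of a function with locally Lipschitz gradient, i.e. the
  generalized Jacobian of the gradient: the convex hull of the limits of Hessian matrices.\<close>

definition gen_hessian :: "(real^'n \<Rightarrow> real) \<Rightarrow> real^'n \<Rightarrow> (real^'n^'n) set" where
  "gen_hessian F z = convex hull
     {H. \<exists>Z J. Z \<longlonglongrightarrow> z \<and> J \<longlonglongrightarrow> H \<and>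
        (\<forall>k. (gradient F has_derivative (\<lambda>v. J k *v v)) (at (Z k)))}"

text \<open>The one-variable case of the generalized Hessian, with a one-by-one matrix read as a real
  number.\<close>

definition gen_second_deriv :: "(real \<Rightarrow> real) \<Rightarrow> real \<Rightarrow> real set" where
  "gen_second_deriv w t = clarke_subdiff (deriv w) t"

definition normal_cone :: "'a::real_inner set \<Rightarrow> 'a \<Rightarrow> 'a set" where
  "normal_cone \<Omega> x = {v. x \<in> \<Omega> \<and> (\<forall>z\<in>\<Omega>. v \<bullet> (z - x) \<le> 0)}"

section \<open>The objective and its relaxation\<close>

text \<open>The index set \<open>{1..2n}\<close> is modelled by \<open>'n + 'n\<close>: \<^term>\<open>Inl i\<close> is the index \<open>i\<close> and
  \<^term>\<open>Inr i\<close> is the index \<open>n + i\<close>.\<close>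

definition pos_pow0 :: "real \<Rightarrow> real" where
  "pos_pow0 t = (if t > 0 then 1 else 0)"

definition objective ::
  "(real^'n \<Rightarrow> real^'m \<Rightarrow> real) \<Rightarrow> ('n + 'n \<Rightarrow> real \<Rightarrow> real) \<Rightarrow> ('m + 'm \<Rightarrow> real \<Rightarrow> real) \<Rightarrow>
   real \<Rightarrow> real \<Rightarrow> real^'n \<Rightarrow> real^'m \<Rightarrow> real" where
  "objective c g h lam1 lam2 x y = c x y
     + lam1 * (\<Sum>i\<in>UNIV. pos_pow0 (g (Inl i) (x $ i)) + pos_pow0 (g (Inr i) (x $ i)))
     - lam2 * (\<Sum>j\<in>UNIV. pos_pow0 (h (Inl j) (y $ j)) + pos_pow0 (h (Inr j) (y $ j)))"

definition piecewise_continuous :: "(real \<Rightarrow> real) \<Rightarrow> bool" where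
  "piecewise_continuous \<rho> \<longleftrightarrow> (\<exists>S. finite S \<and> (\<forall>s. s \<notin> S \<longrightarrow> isCont \<rho> s) \<and>
     (\<forall>s\<in>S. (\<exists>l. (\<rho> \<longlongrightarrow> l) (at_left s)) \<and> (\<exists>l. (\<rho> \<longlongrightarrow> l) (at_right s))))"

definition density_on :: "real \<Rightarrow> (real \<Rightarrow> real) \<Rightarrow> bool" where
  "density_on \<alpha> \<rho> \<longleftrightarrow> piecewise_continuous \<rho> \<and> (\<forall>s. \<rho> s \<ge> 0) \<and> (\<rho> has_integral 1) UNIV \<and>
     (\<forall>s. s \<notin> {0..\<alpha>} \<longrightarrow> \<rho> s = 0)"

definition relax :: "(real \<Rightarrow> real) \<Rightarrow> real \<Rightarrow> real \<Rightarrow> real" where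
  "relax \<rho> t \<mu> = integral {..t / \<mu>} \<rho>"

definition relaxed_objective ::
  "(real^'n \<Rightarrow> real^'m \<Rightarrow> real) \<Rightarrow> ('n + 'n \<Rightarrow> real \<Rightarrow> real) \<Rightarrow> ('m + 'm \<Rightarrow> real \<Rightarrow> real) \<Rightarrow>
   real \<Rightarrow> real \<Rightarrow> (real \<Rightarrow> real) \<Rightarrow> real \<Rightarrow> real^'n \<Rightarrow> real^'m \<Rightarrow> real" where
  "relaxed_objective c g h lam1 lam2 \<rho> \<mu> x y = c x y
     + lam1 * (\<Sum>i\<in>UNIV. relax \<rho> (g (Inl i) (x $ i)) \<mu> + relax \<rho> (g (Inr i) (x $ i)) \<mu>)
     - lam2 * (\<Sum>j\<in>UNIV. relax \<rho> (h (Inl j) (y $ j)) \<mu> + relax \<rho> (h (Inr j) (y $ j)) \<mu>)"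

section \<open>Structural condition and condition on the density\<close>

text \<open>One half of the structural condition, for the functions \<open>w\<close> on the box
  \<^term>\<open>cbox l u\<close>.\<close>

definition structural_condition ::
  "real \<Rightarrow> real \<Rightarrow> real^'n \<Rightarrow> real^'n \<Rightarrow> ('n + 'n \<Rightarrow> real \<Rightarrow> real) \<Rightarrow> bool" where
  "structural_condition \<tau> \<sigma> l u w \<longleftrightarrow>
     (\<forall>x\<in>cbox l u. \<forall>i. \<forall>(k, k') \<in> {(Inl i, Inr i), (Inr i, Inl i)}.
        w k (x $ i) \<in> {0<..<\<tau>} \<longrightarrow>
          x $ i \<in> interior {l $ i .. u $ i} \<and> w k' (x $ i) \<notin> {0..\<tau>} \<and>
          \<bar>deriv (w k) (x $ i)\<bar> \<ge> \<sigma>)"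

text \<open>The supremum is taken in the extended reals, where it is defined for every set.\<close>

definition density_condition :: "real \<Rightarrow> (real \<Rightarrow> real) \<Rightarrow> real \<Rightarrow> real \<Rightarrow> bool" where
  "density_condition \<alpha> \<rho> \<rho>_low \<rho>_check \<longleftrightarrow>
     (\<exists>L. L-lipschitz_on {0<..} \<rho>) \<and> \<rho>_low > 0 \<and> \<rho>_check > 0 \<and>
     (\<forall>s\<in>{0<..<\<alpha>}. \<rho> s \<ge> \<rho>_low \<or> (SUP a\<in>clarke_subdiff \<rho> s. ereal a) \<le> ereal (- \<rho>_check))"

section \<open>Weak second order stationary points\<close>

definition rel_subdiff_x ::
  "(real^'n \<Rightarrow> real^'m \<Rightarrow> real) \<Rightarrow> ('n + 'n \<Rightarrow> real \<Rightarrow> real) \<Rightarrow> real \<Rightarrow> (real \<Rightarrow> real) \<Rightarrow> real \<Rightarrow>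
   real^'n \<Rightarrow> real^'m \<Rightarrow> (real^'n) set" where
  "rel_subdiff_x c g lam1 \<rho> \<mu> x y =
     {gradient (\<lambda>x'. c x' y) x
        + lam1 *\<^sub>R (\<Sum>i\<in>UNIV. (a (Inl i) * deriv (g (Inl i)) (x $ i)
                        + a (Inr i) * deriv (g (Inr i)) (x $ i)) *\<^sub>R axis i 1)
      | a. \<forall>i. \<forall>k\<in>{Inl i, Inr i}. a k \<in> clarke_subdiff (\<lambda>t. relax \<rho> t \<mu>) (g k (x $ i))}"

definition rel_subdiff_y ::
  "(real^'n \<Rightarrow> real^'m \<Rightarrow> real) \<Rightarrow> ('m + 'm \<Rightarrow> real \<Rightarrow> real) \<Rightarrow> real \<Rightarrow> (real \<Rightarrow> real) \<Rightarrow> real \<Rightarrow>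
   real^'n \<Rightarrow> real^'m \<Rightarrow> (real^'m) set" where
  "rel_subdiff_y c h lam2 \<rho> \<mu> x y =
     {gradient (\<lambda>y'. c x y') y
        - lam2 *\<^sub>R (\<Sum>j\<in>UNIV. (b (Inl j) * deriv (h (Inl j)) (y $ j)
                        + b (Inr j) * deriv (h (Inr j)) (y $ j)) *\<^sub>R axis j 1)
      | b. \<forall>j. \<forall>k\<in>{Inl j, Inr j}. b k \<in> clarke_subdiff (\<lambda>t. relax \<rho> t \<mu>) (h k (y $ j))}"

text \<open>The set \<open>\<partial>\<^sup>2\<^sub>t\<^sub>t r(w(t), \<mu>)\<close> with tilde, meaningful for \<open>w t > 0\<close>.\<close>

definition rel_second_deriv :: "(real \<Rightarrow> real) \<Rightarrow> real \<Rightarrow> (real \<Rightarrow> real) \<Rightarrow> real \<Rightarrow> real set" where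
  "rel_second_deriv \<rho> \<mu> w t =
     {a / \<mu>\<^sup>2 * (deriv w t)\<^sup>2 + \<rho> (w t / \<mu>) / \<mu> * \<xi>
      | a \<xi>. a \<in> clarke_subdiff \<rho> (w t / \<mu>) \<and> \<xi> \<in> gen_second_deriv w t}"

definition active_pos :: "real \<Rightarrow> ('n + 'n \<Rightarrow> real \<Rightarrow> real) \<Rightarrow> real^'n \<Rightarrow> 'n set" where
  "active_pos \<tau> w x = {i. w (Inl i) (x $ i) \<in> {0<..<\<tau>} \<or> w (Inr i) (x $ i) \<in> {0<..<\<tau>}}"

definition weak_second_order_stationary ::
  "(real^'n) set \<Rightarrow> (real^'m) set \<Rightarrow> (real^'n \<Rightarrow> real^'m \<Rightarrow> real) \<Rightarrow>
   ('n + 'n \<Rightarrow> real \<Rightarrow> real) \<Rightarrow> ('m + 'm \<Rightarrow> real \<Rightarrow> real) \<Rightarrow> real \<Rightarrow> real \<Rightarrow> (real \<Rightarrow> real) \<Rightarrow>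
   real \<Rightarrow> real \<Rightarrow> real^'n \<Rightarrow> real^'m \<Rightarrow> bool" where
  "weak_second_order_stationary X Y c g h lam1 lam2 \<rho> \<tau> \<mu> x y \<longleftrightarrow>
     x \<in> X \<and> y \<in> Y \<and>
     0 \<in> rel_subdiff_x c g lam1 \<rho> \<mu> x y + normal_cone X x \<and>
     0 \<in> uminus ` rel_subdiff_y c h lam2 \<rho> \<mu> x y + normal_cone Y y \<and>
     (\<forall>i\<in>active_pos \<tau> g x.
        (\<exists>!k. k \<in> {Inl i, Inr i} \<and> g k (x $ i) \<in> {0<..<\<tau>}) \<and>
        (\<forall>k\<in>{Inl i, Inr i}. g k (x $ i) \<in> {0<..<\<tau>} \<longrightarrow>
           (\<exists>\<omega>\<in>(\<lambda>H. H $ i $ i) ` gen_hessian (\<lambda>x'. c x' y) x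
                 + (*) lam1 ` rel_second_deriv \<rho> \<mu> (g k) (x $ i). \<omega> \<ge> 0))) \<and>
     (\<forall>j\<in>active_pos \<tau> h y.
        (\<exists>!k. k \<in> {Inl j, Inr j} \<and> h k (y $ j) \<in> {0<..<\<tau>}) \<and>
        (\<forall>k\<in>{Inl j, Inr j}. h k (y $ j) \<in> {0<..<\<tau>} \<longrightarrow>
           (\<exists>\<omega>\<in>(\<lambda>M. - (M $ j $ j)) ` gen_hessian (\<lambda>y'. c x y') y
                 + (*) lam2 ` rel_second_deriv \<rho> \<mu> (h k) (y $ j). \<omega> \<ge> 0)))"

section \<open>Saddle points\<close>

definition saddle_point ::
  "'a set \<Rightarrow> 'b set \<Rightarrow> ('a \<Rightarrow> 'b \<Rightarrow> real) \<Rightarrow> 'a \<Rightarrow> 'b \<Rightarrow> bool" where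
  "saddle_point X Y F xs ys \<longleftrightarrow> xs \<in> X \<and> ys \<in> Y \<and>
     (\<forall>x\<in>X. \<forall>y\<in>Y. F xs y \<le> F xs ys \<and> F xs ys \<le> F x ys)"

definition local_saddle_point ::
  "'a::metric_space set \<Rightarrow> 'b::metric_space set \<Rightarrow> ('a \<Rightarrow> 'b \<Rightarrow> real) \<Rightarrow> 'a \<Rightarrow> 'b \<Rightarrow> bool" where
  "local_saddle_point X Y F xs ys \<longleftrightarrow> xs \<in> X \<and> ys \<in> Y \<and>
     (\<exists>\<delta>>0. \<forall>x\<in>X \<inter> cball xs \<delta>. \<forall>y\<in>Y \<inter> cball ys \<delta>. F xs y \<le> F xs ys \<and> F xs ys \<le> F x ys)"

definition strong_local_saddle_point ::
  "real \<Rightarrow> (real^'n) set \<Rightarrow> (real^'m) set \<Rightarrow> (real^'n \<Rightarrow> real^'m \<Rightarrow> real) \<Rightarrow>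
   ('n + 'n \<Rightarrow> real \<Rightarrow> real) \<Rightarrow> ('m + 'm \<Rightarrow> real \<Rightarrow> real) \<Rightarrow> real \<Rightarrow> real \<Rightarrow>
   real^'n \<Rightarrow> real^'m \<Rightarrow> bool" where
  "strong_local_saddle_point \<nu> X Y c g h lam1 lam2 xs ys \<longleftrightarrow>
     local_saddle_point X Y (objective c g h lam1 lam2) xs ys \<and>
     (\<forall>i. g (Inl i) (xs $ i) \<notin> {0<..<\<nu>} \<and> g (Inr i) (xs $ i) \<notin> {0<..<\<nu>}) \<and>
     (\<forall>j. h (Inl j) (ys $ j) \<notin> {0<..<\<nu>} \<and> h (Inr j) (ys $ j) \<notin> {0<..<\<nu>})"

section \<open>The threshold for the relaxation parameter\<close>

text \<open>In \<^typ>\<open>ereal\<close>, a positive number divided by \<open>0\<close> is \<open>\<infinity>\<close>, which is the intended reading of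
  the last two fractions (their numerators are positive) when a denominator vanishes.\<close>

definition mu_bar2 ::
  "real \<Rightarrow> real \<Rightarrow> real \<Rightarrow> real \<Rightarrow> real \<Rightarrow> real \<Rightarrow> real \<Rightarrow> real \<Rightarrow> real \<Rightarrow> real \<Rightarrow> real \<Rightarrow> real \<Rightarrow> ereal" where
  "mu_bar2 lam1 lam2 \<tau> \<sigma> \<alpha> \<rho>_low \<rho>_check \<rho>_bar Lc1 Lc2 Lg2 Lh2 =
     Min {ereal (\<tau> / \<alpha>),
          ereal (min lam1 lam2 * \<sigma> * \<rho>_low) / ereal Lc1,
          ereal (lam1 * \<rho>_check * \<sigma>\<^sup>2) / ereal (\<tau> * Lc2 / \<alpha> + lam1 * \<rho>_bar * Lg2),
          ereal (lam2 * \<rho>_check * \<sigma>\<^sup>2) / ereal (\<tau> * Lc2 / \<alpha> + lam2 * \<rho>_bar * Lh2)}"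

end

theory Submission
  imports Defs
begin

text \<open>
  Fix \<open>y\<close>. Up to a constant, the objective is a smooth convex function \<open>\<phi>\<close> of \<open>x\<close> plus \<open>lam\<close> times a
  sum of unit steps of functions of single coordinates, and for fixed \<open>x\<close> the negated objective
  is a function of \<open>y\<close> of the same kind. The constants do not affect comparisons, so a saddle point is
  a pair of minimisers, and everything reduces to one minimisation problem over a box, treated in the
  locale \<open>penalised_box\<close>.

  A step and its relaxation agree outside the gap \<open>(0, \<alpha> \<mu>)\<close>, and the relaxation is never above the
  step. Hence a minimiser of the relaxed function with no value in the gap also minimises the original
  one. The point is therefore that minimisers and stationary points avoid the gap. Suppose
  \<open>w\<^sub>k(x\<^sub>i) / \<mu> = s\<close> with \<open>0 < s < \<alpha>\<close>. By the structural condition \<open>x\<^sub>i\<close> is interior and the other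
  function attached to this coordinate is locally inert, so the problem in the direction of \<open>x\<^sub>i\<close> is
  smooth, with derivative \<open>\<partial>\<^sub>i\<phi> + lam \<rho>(s) w' / \<mu>\<close>. Where \<open>\<rho>(s)\<close> is bounded below, the second term
  dominates the first, as \<open>\<mu>\<close> is small (\<open>dense_not_stationary\<close>). Otherwise \<open>\<rho>\<close> decreases at a
  definite rate, and the term \<open>lam \<rho>' w'\<^sup>2 / \<mu>\<^sup>2\<close> makes the curvature negative
  (\<open>curvature_negative\<close>). This contradicts the second order condition directly
  (\<open>no_gap_of_stationary\<close>), and contradicts minimality because a function whose derivative vanishes at
  a point and has negative slope there cannot have a local minimum at it (\<open>no_gap_of_local_min\<close>).

  That last argument needs the hypotheses on generalized second derivatives, which speak of limits of
  derivatives at points of differentiability, to bound difference quotients. A bound on such limits says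
  nothing unless points of differentiability are plentiful, so Rademacher's theorem is proved. It gives
  \<open>derivatives_above_slope\<close>: if a Lipschitz map has difference quotients above \<open>k\<close> at arbitrarily small
  scales, then nearby derivatives exceed every \<open>k' < k\<close>. In particular the generalized derivatives are not
  empty, and the constants bounding them are nonnegative.

  In the convex case a stationary point off the gap is a local minimiser of the original function: nearby,
  either some step switches on and costs \<open>lam\<close>, more than \<open>\<phi>\<close> can gain, or no step switches on, and
  convexity makes the first order condition sufficient (\<open>local_min_of_stationary_convex\<close>).
\<close>

section \<open>Oscillation of difference quotients\<close>

definition diff_quot :: "('a::real_vector \<Rightarrow> real) \<Rightarrow> 'a \<Rightarrow> 'a \<Rightarrow> real \<Rightarrow> real" where
  "diff_quot f u x t = (f (x + t *\<^sub>R u) - f x) / t"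

text \<open>The points at which the lower derivative in direction \<open>u\<close> is below \<open>p\<close> and the upper one above \<open>q\<close>,
  up to equality. A Lipschitz function has a derivative in direction \<open>u\<close> at every point outside all such sets with
  \<open>p < q\<close> rational.\<close>

definition oscillation_set :: "('a::real_vector \<Rightarrow> real) \<Rightarrow> 'a \<Rightarrow> real \<Rightarrow> real \<Rightarrow> 'a set" where
  "oscillation_set f u p q =
     {x. (\<exists>\<^sub>F t in at 0. diff_quot f u x t < p) \<and> (\<exists>\<^sub>F t in at 0. q < diff_quot f u x t)}"

lemma frequently_at_0_real_iff:
  fixes P :: "real \<Rightarrow> bool"
  shows "(\<exists>\<^sub>F t in at 0. P t) \<longleftrightarrow> (\<forall>n. \<exists>t. t \<noteq> 0 \<and> \<bar>t\<bar> < inverse (real (Suc n)) \<and> P t)"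
proof
  assume fr: "\<exists>\<^sub>F t in at 0. P t"
  show "\<forall>n. \<exists>t. t \<noteq> 0 \<and> \<bar>t\<bar> < inverse (real (Suc n)) \<and> P t"
  proof
    fix n
    have "0 < inverse (real (Suc n))" by simp
    with fr have "\<exists>t\<in>UNIV. t \<noteq> 0 \<and> dist t 0 < inverse (real (Suc n)) \<and> P t"
      unfolding frequently_at by blast
    then show "\<exists>t. t \<noteq> 0 \<and> \<bar>t\<bar> < inverse (real (Suc n)) \<and> P t"
      by (auto simp: dist_real_def)
  qed
next
  assume R: "\<forall>n. \<exists>t. t \<noteq> 0 \<and> \<bar>t\<bar> < inverse (real (Suc n)) \<and> P t"
  show "\<exists>\<^sub>F t in at 0. P t"
    unfolding frequently_at
  proof (intro allI impI)
    fix d :: real assume "d > 0"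
    then obtain n where "inverse (real (Suc n)) < d" using reals_Archimedean by blast
    with R obtain t where "t \<noteq> 0" "\<bar>t\<bar> < d" "P t" by (meson order.strict_trans)
    then show "\<exists>x\<in>UNIV. x \<noteq> 0 \<and> dist x 0 < d \<and> P x" by (auto simp: dist_real_def)
  qed
qed

lemma frequently_at_0_realD:
  fixes P :: "real \<Rightarrow> bool"
  assumes "\<exists>\<^sub>F t in at 0. P t" "0 < d"
  obtains t where "t \<noteq> 0" "\<bar>t\<bar> < d" "P t"
  using assms unfolding frequently_at by (auto simp: dist_real_def)

text \<open>For a continuous function the set is a countable intersection of open sets: the condition at a
  fixed increment is open, and arbitrarily many increments may be united.\<close>

lemma borel_frequently_diff_quot:
  fixes f :: "'a::euclidean_space \<Rightarrow> real"
  assumes "continuous_on UNIV f" and U: "open U"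
  shows "{x. \<exists>\<^sub>F t in at 0. diff_quot f u x t \<in> U} \<in> sets borel"
proof -
  let ?O = "\<lambda>n. \<Union>t\<in>{t. t \<noteq> 0 \<and> \<bar>t\<bar> < inverse (real (Suc n))}. {x. diff_quot f u x t \<in> U}"
  have eq: "{x. \<exists>\<^sub>F t in at 0. diff_quot f u x t \<in> U} = (\<Inter>n. ?O n)"
    unfolding frequently_at_0_real_iff by auto
  have "open (?O n)" for n
  proof (intro open_UN ballI)
    fix t assume "t \<in> {t. t \<noteq> 0 \<and> \<bar>t\<bar> < inverse (real (Suc n))}"
    then have "t \<noteq> 0" by simp
    have "continuous_on UNIV (\<lambda>x. f (x + t *\<^sub>R u))"
      by (rule continuous_on_compose2[OF assms(1)]) (auto intro!: continuous_intros)
    then have "continuous_on UNIV (\<lambda>x. diff_quot f u x t)"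
      unfolding diff_quot_def using \<open>t \<noteq> 0\<close> assms(1) by (intro continuous_intros) auto
    then have "open ((\<lambda>x. diff_quot f u x t) -` U)"
      by (rule open_vimage[OF U])
    then show "open {x. diff_quot f u x t \<in> U}" by (simp add: vimage_def)
  qed
  then have "?O n \<in> sets borel" for n by (rule borel_open)
  then show ?thesis unfolding eq by (intro sets.countable_INT) auto
qed

lemma borel_oscillation_set:
  fixes f :: "'a::euclidean_space \<Rightarrow> real"
  assumes "continuous_on UNIV f"
  shows "oscillation_set f u p q \<in> sets borel"
proof -
  have "oscillation_set f u p q = {x. \<exists>\<^sub>F t in at 0. diff_quot f u x t \<in> {..<p}} \<inter>
      {x. \<exists>\<^sub>F t in at 0. diff_quot f u x t \<in> {q<..}}"
    by (auto simp: oscillation_set_def)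
  then show ?thesis
    by (simp only:) (intro sets.Int borel_frequently_diff_quot[OF assms] open_lessThan open_greaterThan)
qed

text \<open>Near each point of \<open>S\<close> there are short intervals which \<open>F\<close> stretches by a factor less than \<open>p\<close>. Vitali's
  theorem selects disjoint ones inside a slightly larger open set that cover almost all of \<open>S\<close>, and what
  is left over has a null image since \<open>F\<close> is Lipschitz.\<close>

lemma emeasure_image_le:
  fixes F :: "real \<Rightarrow> real"
  assumes mono: "strict_mono F" and lip: "K-lipschitz_on UNIV F"
    and S: "S \<in> sets lebesgue" and FS: "F ` S \<in> sets lebesgue" and p: "p > 0"
    and cov: "\<And>x. x \<in> S \<Longrightarrow> \<exists>\<^sub>F t in at 0. diff_quot F 1 x t < p"
  shows "emeasure lebesgue (F ` S) \<le> ennreal p * emeasure lebesgue S"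
proof (rule ennreal_le_epsilon)
  fix e :: real assume "e > 0"
  then have "e / p > 0" using p by simp
  then obtain T where T: "open T" "S \<subseteq> T" "T - S \<in> lmeasurable" "emeasure lebesgue (T - S) < ennreal (e / p)"
    using sets_lebesgue_outer_open[OF S] by metis
  let ?J = "{(a, r). 0 < r \<and> cball a r \<subseteq> T \<and> F (a + r) - F (a - r) \<le> 2 * r * p}"
  have fine: "\<exists>i. i \<in> ?J \<and> x \<in> cball (fst i) (snd i) \<and> snd i < d" if x: "x \<in> S" and d: "0 < d" for x d
  proof -
    obtain b where b: "b > 0" "ball x b \<subseteq> T" using T x openE by blast
    have "0 < min b d" using b d by simp
    then obtain t where t: "t \<noteq> 0" "\<bar>t\<bar> < min b d" "diff_quot F 1 x t < p"
      using frequently_at_0_realD[OF cov[OF x]] by metis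
    let ?a = "x + t / 2" and ?r = "\<bar>t\<bar> / 2"
    have "cball ?a ?r \<subseteq> ball x b"
    proof
      fix y assume "y \<in> cball ?a ?r"
      then show "y \<in> ball x b" using t(2) by (auto simp: dist_real_def abs_if split: if_splits)
    qed
    moreover have "F (?a + ?r) - F (?a - ?r) \<le> 2 * ?r * p"
    proof (cases "t > 0")
      case True
      then have "?a + ?r = x + t" "?a - ?r = x" by simp_all
      moreover have "F (x + t) - F x \<le> t * p" using True t(3) by (simp add: diff_quot_def field_simps)
      ultimately show ?thesis using True by (simp add: add.commute)
    next
      case False
      then have "t < 0" using t(1) by simp
      then have "F (x + t) - F x > p * t" using t(3) by (simp add: diff_quot_def field_simps)
      moreover have "?a + ?r = x" "?a - ?r = x + t" using \<open>t < 0\<close> by simp_all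
      ultimately show ?thesis using \<open>t < 0\<close> by (simp add: mult.commute add.commute)
    qed
    ultimately have "(?a, ?r) \<in> ?J" using t b by auto
    moreover have "x \<in> cball ?a ?r" by (simp add: dist_real_def)
    moreover have "?r < d" using t(2) by auto
    ultimately show ?thesis by (intro exI[of _ "(?a, ?r)"]) auto
  qed
  have posr: "0 < snd i" if "i \<in> ?J" for i using that by (cases i) simp
  obtain C where C: "countable C" "C \<subseteq> ?J"
    and dis: "pairwise (\<lambda>i j. disjnt (cball (fst i) (snd i)) (cball (fst j) (snd j))) C"
    and neg: "negligible (S - (\<Union>i\<in>C. cball (fst i) (snd i)))"
    by (rule Vitali_covering_theorem_cballs[of ?J snd S fst, OF posr fine])
  let ?B = "\<lambda>i. cball (fst i) (snd i)"
  have contF: "continuous_on A F" for A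
    using lip lipschitz_on_continuous_on lipschitz_on_subset by blast
  have inj: "inj F" using mono by (rule strict_mono_imp_inj_on)
  have Fmeas: "F ` ?B i \<in> sets lebesgue" for i
    using compact_continuous_image[OF contF compact_cball] by (simp add: borel_compact)
  have FB: "emeasure lebesgue (F ` ?B i) \<le> ennreal p * emeasure lebesgue (?B i)" if "i \<in> C" for i
  proof -
    obtain a r where i: "i = (a, r)" by (cases i)
    have "(a, r) \<in> ?J" using that C(2) i by blast
    then have ar: "0 < r" "F (a + r) - F (a - r) \<le> 2 * r * p" by simp_all
    have "F ` ?B i \<subseteq> {F (a - r)..F (a + r)}"
    proof
      fix y assume "y \<in> F ` ?B i"
      then obtain z where z: "y = F z" "a - r \<le> z" "z \<le> a + r"
        by (auto simp: i dist_real_def abs_le_iff)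
      then show "y \<in> {F (a - r)..F (a + r)}" using strict_mono_mono[OF mono] by (auto dest: monoD)
    qed
    then have "emeasure lebesgue (F ` ?B i) \<le> emeasure lebesgue {F (a - r)..F (a + r)}"
      by (intro emeasure_mono) auto
    also have "\<dots> = ennreal (F (a + r) - F (a - r))"
      using strict_monoD[OF mono, of "a - r" "a + r"] ar by simp
    also have "\<dots> \<le> ennreal (p * (2 * r))" using ar by (intro ennreal_leI) (simp add: mult_ac)
    also have "\<dots> = ennreal p * emeasure lebesgue {a - r..a + r}" 
      using ar p by (simp add: ennreal_mult)
    finally show ?thesis by (simp add: i cball_eq_atLeastAtMost)
  qed
  have disF: "disjoint_family_on (\<lambda>i. F ` ?B i) C" and disB: "disjoint_family_on ?B C"
  proof -
    show "disjoint_family_on ?B C"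
      using dis unfolding disjoint_family_on_def pairwise_def disjnt_def by blast
    then show "disjoint_family_on (\<lambda>i. F ` ?B i) C"
      unfolding disjoint_family_on_def by (metis image_Int[OF inj] image_empty)
  qed
  have nF: "negligible (F ` (S - (\<Union>i\<in>C. ?B i)))"
  proof (rule negligible_locally_Lipschitz_image[OF _ neg])
    fix x
    show "\<exists>T B. open T \<and> x \<in> T \<and> (\<forall>y\<in>(S - (\<Union>i\<in>C. ?B i)) \<inter> T. norm (F y - F x) \<le> B * norm (y - x))"
      using lip by (intro exI[of _ UNIV] exI[of _ K]) (auto simp: lipschitz_on_def dist_norm)
  qed auto
  let ?U = "\<Union>i\<in>C. F ` ?B i"
  have Umeas: "?U \<in> sets lebesgue" using Fmeas C(1) by (intro sets.countable_UN') auto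
  have "emeasure lebesgue (F ` S) \<le> emeasure lebesgue (?U \<union> F ` (S - (\<Union>i\<in>C. ?B i)))"
  proof (rule emeasure_mono)
    show "F ` S \<subseteq> ?U \<union> F ` (S - (\<Union>i\<in>C. ?B i))" by blast
    show "?U \<union> F ` (S - (\<Union>i\<in>C. ?B i)) \<in> sets lebesgue"
      using nF by (intro sets.Un Umeas) (auto simp: negligible_iff_null_sets)
  qed
  also have "\<dots> = emeasure lebesgue ?U"
    using nF Umeas by (intro emeasure_Un_null_set) (auto simp: negligible_iff_null_sets)
  also have "\<dots> = (\<integral>\<^sup>+i. emeasure lebesgue (F ` ?B i) \<partial>count_space C)"
    using Fmeas by (intro emeasure_UN_countable C(1) disF) auto
  also have "\<dots> \<le> (\<integral>\<^sup>+i. ennreal p * emeasure lebesgue (?B i) \<partial>count_space C)"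
    using FB by (intro nn_integral_mono) auto
  also have "\<dots> = ennreal p * (\<integral>\<^sup>+i. emeasure lebesgue (?B i) \<partial>count_space C)"
    by (intro nn_integral_cmult) auto
  also have "(\<integral>\<^sup>+i. emeasure lebesgue (?B i) \<partial>count_space C) = emeasure lebesgue (\<Union>i\<in>C. ?B i)"
    by (intro emeasure_UN_countable[symmetric] C(1) disB) auto
  also have "ennreal p * \<dots> \<le> ennreal p * emeasure lebesgue T"
  proof (intro mult_left_mono emeasure_mono)
    show "(\<Union>i\<in>C. ?B i) \<subseteq> T" using C(2) by fastforce
  qed (use T(1) in auto)
  also have "emeasure lebesgue T = emeasure lebesgue S + emeasure lebesgue (T - S)"
    using plus_emeasure[of S lebesgue "T - S"] S T by (auto simp: Un_absorb1)
  also have "ennreal p * \<dots> \<le> ennreal p * (emeasure lebesgue S + ennreal (e / p))"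
    using T(4) by (intro mult_left_mono add_left_mono) auto
  also have "\<dots> = ennreal p * emeasure lebesgue S + ennreal e"
    using p \<open>e > 0\<close> by (simp add: distrib_left ennreal_mult[symmetric])
  finally show "emeasure lebesgue (F ` S) \<le> ennreal p * emeasure lebesgue S + ennreal e" .
qed

text \<open>After adding a multiple of the identity, \<open>f\<close> becomes a bi-Lipschitz bijection \<open>F\<close>, and \<open>p\<close>, \<open>q\<close> are shifted
  to positive numbers. On the oscillation set
  \<open>F\<close> shrinks measure to at most \<open>p\<close> times (lower slopes), while its inverse shrinks the measure of the image
  to at most \<open>1 / q\<close> times (upper slopes are inverted). Together \<open>\<bar>S\<bar> \<le> (p / q) \<bar>S\<bar>\<close>, so bounded pieces \<open>S\<close> are
  null.\<close>

lemma negligible_oscillation_set_real: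
  fixes f :: "real \<Rightarrow> real"
  assumes lip: "L-lipschitz_on UNIV f" and pq: "p < q"
  shows "negligible (oscillation_set f 1 p q)"
proof -
  \<comment> \<open>With this multiple of the identity all slopes of \<open>F\<close> lie in the interval from \<open>1\<close> to \<open>2 L + 1\<close>.\<close>
  define K where "K = L + 1"
  define F where "F x = f x + K * x" for x
  have L0: "L \<ge> 0" using lip lipschitz_on_nonneg by blast
  have dF: "diff_quot F 1 x t = diff_quot f 1 x t + K" if "t \<noteq> 0" for x t
    using that by (simp add: diff_quot_def F_def field_simps)
  have bf: "\<bar>f y - f x\<bar> \<le> L * \<bar>y - x\<bar>" for x y
    using lip by (auto simp: lipschitz_on_def dist_real_def)
  have low: "y - x \<le> F y - F x" and up: "F y - F x \<le> (2 * L + 1) * (y - x)" if "x \<le> y" for x y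
    using bf[of y x] that by (auto simp: F_def K_def algebra_simps abs_le_iff)
  have mono: "strict_mono F"
    by (rule strict_monoI) (smt (verit) low)
  have lipF: "(2 * L + 1)-lipschitz_on UNIV F"
  proof (rule lipschitz_onI)
    fix x y :: real
    show "dist (F x) (F y) \<le> (2 * L + 1) * dist x y"
    proof (cases "x \<le> y")
      case True
      then show ?thesis using low[of x y] up[of x y] by (simp add: dist_real_def abs_if algebra_simps)
    next
      case False
      then show ?thesis using low[of y x] up[of y x] by (simp add: dist_real_def abs_if algebra_simps)
    qed
  qed (use L0 in simp)
  have contF: "continuous_on A F" for A
    using lipF lipschitz_on_continuous_on lipschitz_on_subset by blast
  have bij: "bij F"
  proof (rule bijI)
    show "inj F" using mono by (rule strict_mono_imp_inj_on)
    show "surj F"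
      unfolding surj_def
    proof
      fix y
      have "F (- \<bar>y - F 0\<bar>) \<le> y" "y \<le> F (\<bar>y - F 0\<bar>)"
        using low[of "- \<bar>y - F 0\<bar>" 0] low[of 0 "\<bar>y - F 0\<bar>"] by auto
      then show "\<exists>x. y = F x"
        using IVT'[of F "- \<bar>y - F 0\<bar>" y "\<bar>y - F 0\<bar>"] contF by fastforce
    qed
  qed
  define G where "G = inv F"
  have GF [simp]: "G (F x) = x" and FG [simp]: "F (G y) = y" for x y
    using bij by (auto simp: G_def bij_is_inj bij_is_surj surj_f_inv_f)
  have monoG: "strict_mono G"
    by (rule strict_monoI) (metis FG mono strict_mono_less)
  have lipG: "1-lipschitz_on UNIV G"
  proof (rule lipschitz_onI)
    fix x y :: real
    show "dist (G x) (G y) \<le> 1 * dist x y"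
      using low[of "G x" "G y"] low[of "G y" "G x"] by (auto simp: dist_real_def abs_if)
  qed simp
  have contG: "continuous_on A G" for A
    using lipG lipschitz_on_continuous_on lipschitz_on_subset by blast
  have evt: "\<forall>\<^sub>F t in at (0::real). t \<noteq> 0" by (simp add: eventually_at_filter)
  define S where "S = oscillation_set f 1 p q"
  have frF: "\<exists>\<^sub>F t in at 0. diff_quot F 1 x t < p + K" "\<exists>\<^sub>F t in at 0. q + K < diff_quot F 1 x t"
    if "x \<in> S" for x
  proof -
    have fr: "\<exists>\<^sub>F t in at 0. diff_quot f 1 x t < p" "\<exists>\<^sub>F t in at 0. q < diff_quot f 1 x t"
      using that by (auto simp: S_def oscillation_set_def)
    show "\<exists>\<^sub>F t in at 0. diff_quot F 1 x t < p + K"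
      using frequently_eventually_frequently[OF fr(1) evt] by (rule frequently_elim1) (simp add: dF)
    show "\<exists>\<^sub>F t in at 0. q + K < diff_quot F 1 x t"
      using frequently_eventually_frequently[OF fr(2) evt] by (rule frequently_elim1) (simp add: dF)
  qed
  have "negligible (S \<inter> cbox a b)" for a b
  proof (cases "S = {}")
    case False
    then obtain x where "x \<in> S" by auto
    from frequently_eventually_frequently[OF frF(1)[OF this] evt] obtain t where
      t: "t \<noteq> 0" "diff_quot F 1 x t < p + K" by (auto dest: frequently_ex)
    have "1 \<le> diff_quot F 1 x t"
      using low[of x "x + t"] low[of "x + t" x] t(1)
      by (cases "t > 0") (auto simp: diff_quot_def field_simps)
    then have pK: "p + K > 0" using t by simp
    then have qK: "q + K > 0" using pq by simp
    let ?S = "S \<inter> cbox a b"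
    have contf: "continuous_on UNIV f" using lip lipschitz_on_continuous_on by blast
    have Sb: "?S \<in> sets borel" unfolding S_def
      using borel_oscillation_set[OF contf] by auto
    have FSeq: "F ` ?S = G -` ?S" by (force simp: image_iff)
    have "G \<in> borel_measurable borel" using contG by (rule borel_measurable_continuous_onI)
    then have FSb: "F ` ?S \<in> sets borel" unfolding FSeq using Sb
      by (metis measurable_sets_borel)
    have 1: "emeasure lebesgue (F ` ?S) \<le> ennreal (p + K) * emeasure lebesgue ?S"
      by (rule emeasure_image_le[OF mono lipF _ _ pK]) (use Sb FSb frF in auto)
    have "emeasure lebesgue (G ` (F ` ?S)) \<le> ennreal (1 / (q + K)) * emeasure lebesgue (F ` ?S)"
    proof (rule emeasure_image_le[OF monoG lipG])
      fix y assume "y \<in> F ` ?S"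
      then obtain x where x: "y = F x" "x \<in> S" by auto
      show "\<exists>\<^sub>F t in at 0. diff_quot G 1 y t < 1 / (q + K)"
        unfolding frequently_at
      proof (intro allI impI)
        fix d :: real assume "d > 0"
        then have "d / (2 * L + 1) > 0" using L0 by simp
        then obtain t where t: "t \<noteq> 0" "\<bar>t\<bar> < d / (2 * L + 1)" "q + K < diff_quot F 1 x t"
          using frequently_at_0_realD[OF frF(2)[OF x(2)]] by metis
        let ?s = "F (x + t) - F x"
        have "dist (F (x + t)) (F x) \<le> (2 * L + 1) * dist (x + t) x"
          using lipF by (auto simp: lipschitz_on_def)
        then have "\<bar>?s\<bar> \<le> (2 * L + 1) * \<bar>t\<bar>" by (simp add: dist_real_def)
        also have "\<dots> < d" using t(2) L0 by (simp add: field_simps)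
        finally have "\<bar>?s\<bar> < d" .
        moreover have "?s / t > q + K" using t(3) by (simp add: diff_quot_def)
        then have "?s \<noteq> 0" and "t / ?s < 1 / (q + K)"
          using qK t(1) less_imp_inverse_less[of "q + K" "?s / t"] by (auto simp: inverse_eq_divide)
        moreover have "diff_quot G 1 y ?s = t / ?s" by (simp add: diff_quot_def x(1))
        ultimately show "\<exists>s\<in>UNIV. s \<noteq> 0 \<and> dist s 0 < d \<and> diff_quot G 1 y s < 1 / (q + K)"
          by (intro bexI[of _ ?s]) (auto simp: dist_real_def)
      qed
    qed (use Sb FSb qK in \<open>auto simp: image_comp comp_def\<close>)
    also have "G ` (F ` ?S) = ?S" by (simp add: image_comp comp_def)
    also have "ennreal (1 / (q + K)) * emeasure lebesgue (F ` ?S)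
        \<le> ennreal (1 / (q + K)) * (ennreal (p + K) * emeasure lebesgue ?S)"
      using 1 by (intro mult_left_mono) auto
    also have "\<dots> = ennreal ((p + K) / (q + K)) * emeasure lebesgue ?S"
      using pK qK by (simp add: mult.assoc[symmetric] ennreal_mult[symmetric])
    finally have le: "emeasure lebesgue ?S \<le> ennreal ((p + K) / (q + K)) * emeasure lebesgue ?S" .
    have Slm: "?S \<in> lmeasurable" using Sb
      by (metis bounded_cbox bounded_Int bounded_set_imp_lmeasurable sets_completionI_sets sets_lborel)
    have "measure lebesgue ?S \<le> ((p + K) / (q + K)) * measure lebesgue ?S"
      using le pK qK unfolding emeasure_eq_measure2[OF Slm]
      by (simp add: ennreal_mult[symmetric])
    moreover have "(p + K) / (q + K) < 1" using pK qK pq by simp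
    ultimately have "measure lebesgue ?S = 0"
      by (smt (verit) measure_nonneg mult_le_cancel_right1 mult_less_cancel_right2)
    then show ?thesis using Slm by (simp add: negligible_iff_measure)
  qed simp
  then show ?thesis unfolding S_def[symmetric] by (subst negligible_on_intervals) auto
qed

section \<open>Rademacher's theorem\<close>

lemma abs_diff_quot_le:
  fixes f :: "'a::real_normed_vector \<Rightarrow> real"
  assumes "L-lipschitz_on UNIV f"
  shows "\<bar>diff_quot f u x t\<bar> \<le> L * norm u"
proof (cases "t = 0")
  case False
  have "dist (f (x + t *\<^sub>R u)) (f x) \<le> L * dist (x + t *\<^sub>R u) x"
    using assms by (auto simp: lipschitz_on_def)
  then show ?thesis using False by (simp add: diff_quot_def dist_norm field_simps)
qed (use lipschitz_on_nonneg[OF assms] in \<open>simp add: diff_quot_def\<close>)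

text \<open>On every line parallel to \<open>u\<close> the set is null by the one-dimensional result. Averaging the
  translates of the set along \<open>u\<close> and exchanging the order of integration gives its measure,
  by translation invariance, so no choice of coordinates adapted to \<open>u\<close> is made.\<close>

lemma null_oscillation_set:
  fixes f :: "'a::euclidean_space \<Rightarrow> real"
  assumes lip: "L-lipschitz_on UNIV f" and pq: "p < q"
  shows "oscillation_set f u p q \<in> null_sets lborel"
proof -
  let ?N = "oscillation_set f u p q"
  have cont: "continuous_on UNIV f" using lip lipschitz_on_continuous_on by blast
  have N [measurable]: "?N \<in> sets borel" by (rule borel_oscillation_set[OF cont])
  have line: "AE t in lborel. x + t *\<^sub>R u \<notin> ?N" for x
  proof -
    let ?g = "\<lambda>t. f (x + t *\<^sub>R u)"
    have lipg: "(L * norm u)-lipschitz_on UNIV ?g"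
    proof (rule lipschitz_onI)
      fix s t :: real
      have "dist (?g s) (?g t) \<le> L * dist (x + s *\<^sub>R u) (x + t *\<^sub>R u)"
        by (rule lipschitz_onD[OF lip]) auto
      also have "dist (x + s *\<^sub>R u) (x + t *\<^sub>R u) = norm u * dist s t"
        by (simp add: dist_norm scaleR_diff_left[symmetric])
      finally show "dist (?g s) (?g t) \<le> L * norm u * dist s t" by (simp add: mult.assoc)
    qed (use lipschitz_on_nonneg[OF lip] in simp)
    have "diff_quot ?g 1 s t = diff_quot f u (x + s *\<^sub>R u) t" for s t
      by (simp add: diff_quot_def scaleR_add_left add.assoc)
    then have eq: "oscillation_set ?g 1 p q = {t. x + t *\<^sub>R u \<in> ?N}"
      by (simp add: oscillation_set_def)
    have "oscillation_set ?g 1 p q \<in> null_sets lebesgue"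
      using negligible_oscillation_set_real[OF lipg pq] by (simp add: negligible_iff_null_sets)
    moreover have "oscillation_set ?g 1 p q \<in> sets lborel"
      using borel_oscillation_set[OF lipschitz_on_continuous_on[OF lipg]] by simp
    ultimately have "oscillation_set ?g 1 p q \<in> null_sets lborel"
      by (simp add: null_sets_completion_iff)
    from AE_not_in[OF this] show ?thesis by (simp add: eq)
  qed
  have "emeasure lborel ?N = (\<integral>\<^sup>+ t. emeasure lborel ?N * indicator {0..1::real} t \<partial>lborel)"
    by (subst nn_integral_cmult) auto
  also have "\<dots> = (\<integral>\<^sup>+ t. (\<integral>\<^sup>+ x. indicator ?N (x + t *\<^sub>R u) * indicator {0..1} t \<partial>lborel) \<partial>lborel)"
  proof (rule nn_integral_cong)
    fix t :: real
    have "emeasure lborel ?N = (\<integral>\<^sup>+ x. indicator ?N x \<partial>distr lborel borel ((+) (t *\<^sub>R u)))"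
      by (simp add: lborel_distr_plus)
    also have "\<dots> = (\<integral>\<^sup>+ x. indicator ?N (x + t *\<^sub>R u) \<partial>lborel)"
      by (subst nn_integral_distr) (auto simp: add.commute)
    finally show "emeasure lborel ?N * indicator {0..1} t =
        (\<integral>\<^sup>+ x. indicator ?N (x + t *\<^sub>R u) * indicator {0..1} t \<partial>lborel)"
      by (simp add: nn_integral_multc)
  qed
  also have "\<dots> = (\<integral>\<^sup>+ x. (\<integral>\<^sup>+ t. indicator ?N (x + t *\<^sub>R u) * indicator {0..1} t \<partial>lborel) \<partial>lborel)"
    by (rule lborel_pair.Fubini') measurable
  also have "\<dots> = (\<integral>\<^sup>+ (x::'a). 0 \<partial>lborel)"
  proof (rule nn_integral_cong)
    fix x
    have "(\<integral>\<^sup>+ t. indicator ?N (x + t *\<^sub>R u) * indicator {0..1} t \<partial>lborel) = (\<integral>\<^sup>+ (t::real). 0 \<partial>lborel)"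
      by (rule nn_integral_cong_AE) (use line[of x] in \<open>auto elim!: eventually_mono simp: indicator_def\<close>)
    then show "(\<integral>\<^sup>+ t. indicator ?N (x + t *\<^sub>R u) * indicator {0..1} t \<partial>lborel) = 0" by simp
  qed
  finally show ?thesis by (simp add: null_sets_def)
qed

lemma convergent_or_oscillating:
  fixes g :: "real \<Rightarrow> real"
  assumes bd: "\<And>t. \<bar>g t\<bar> \<le> B"
    and no: "\<And>p q. p \<in> \<rat> \<Longrightarrow> q \<in> \<rat> \<Longrightarrow> p < q \<Longrightarrow>
      \<not> ((\<exists>\<^sub>F t in at 0. g t < p) \<and> (\<exists>\<^sub>F t in at 0. q < g t))"
  shows "\<exists>l. (g \<longlongrightarrow> l) (at 0)"
proof -
  let ?g = "\<lambda>t. ereal (g t)"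
  let ?i = "Liminf (at 0) ?g" and ?s = "Limsup (at 0) ?g"
  have "\<not> ?i < ?s"
  proof
    assume "?i < ?s"
    then obtain b where b: "?i < ereal (real_of_rat b)" "ereal (real_of_rat b) < ?s"
      using ereal_dense3 by blast
    obtain a where a: "?i < ereal (real_of_rat a)" "ereal (real_of_rat a) < ereal (real_of_rat b)"
      using ereal_dense3[OF b(1)] by blast
    have "\<exists>\<^sub>F t in at 0. g t < real_of_rat a"
    proof (rule ccontr)
      assume "\<not> ?thesis"
      then have "\<forall>\<^sub>F t in at 0. ereal (real_of_rat a) \<le> ?g t"
        by (simp add: not_frequently not_less)
      from Liminf_bounded[OF this] a(1) show False by simp
    qed
    moreover have "\<exists>\<^sub>F t in at 0. real_of_rat b < g t"
    proof (rule ccontr)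
      assume "\<not> ?thesis"
      then have "\<forall>\<^sub>F t in at 0. ?g t \<le> ereal (real_of_rat b)"
        by (simp add: not_frequently not_less)
      from Limsup_bounded[OF this] b(2) show False by simp
    qed
    ultimately show False using no[of "real_of_rat a" "real_of_rat b"] a(2) by auto
  qed
  then have "?i = ?s" using Liminf_le_Limsup[of "at (0::real)" ?g] by simp
  then have lim: "(?g \<longlongrightarrow> ?i) (at 0)"
    by (simp add: tendsto_iff_Liminf_eq_Limsup)
  have "ereal (- B) \<le> ?i"
    by (rule tendsto_lowerbound[OF lim]) (use bd in \<open>auto simp: abs_le_iff minus_le_iff\<close>)
  moreover have "?i \<le> ereal B"
    by (rule tendsto_upperbound[OF lim]) (use bd in \<open>auto simp: abs_le_iff\<close>)
  ultimately obtain l where "?i = ereal l" by (cases ?i) auto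
  then show ?thesis using lim by auto
qed

lemma AE_convergent_diff_quot:
  fixes f :: "'a::euclidean_space \<Rightarrow> real"
  assumes lip: "L-lipschitz_on UNIV f"
  shows "AE x in lborel. \<exists>l. (diff_quot f u x \<longlongrightarrow> l) (at 0)"
proof -
  let ?R = "{(p, q). p \<in> \<rat> \<and> q \<in> \<rat> \<and> p < (q::real)}"
  have "countable (\<rat> \<times> \<rat> :: (real \<times> real) set)" by (intro countable_SIGMA countable_rat)
  then have "countable ?R" by (rule countable_subset[rotated]) auto
  then have "AE x in lborel. \<forall>r\<in>?R. x \<notin> oscillation_set f u (fst r) (snd r)"
    by (subst AE_ball_countable) (auto intro!: AE_not_in null_oscillation_set[OF lip])
  then show ?thesis
  proof eventually_elim
    fix x assume "\<forall>r\<in>?R. x \<notin> oscillation_set f u (fst r) (snd r)"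
    then show "\<exists>l. (diff_quot f u x \<longlongrightarrow> l) (at 0)"
      by (intro convergent_or_oscillating[OF abs_diff_quot_le[OF lip]]) (force simp: oscillation_set_def)
  qed
qed

text \<open>The limit is taken along one sequence only, which makes measurability immediate; it is the
  directional derivative wherever that exists.\<close>

definition dir_deriv :: "('a::real_normed_vector \<Rightarrow> real) \<Rightarrow> 'a \<Rightarrow> 'a \<Rightarrow> real" where
  "dir_deriv f u x = lim (\<lambda>n. diff_quot f u x (inverse (real (Suc n))))"

lemma inverse_Suc_at_0: "filterlim (\<lambda>n. inverse (real (Suc n))) (at 0) sequentially"
  using LIMSEQ_inverse_real_of_nat by (simp add: filterlim_at)

lemma diff_quot_LIMSEQ:
  assumes "(diff_quot f u x \<longlongrightarrow> l) (at 0)"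
  shows "(\<lambda>n. diff_quot f u x (inverse (real (Suc n)))) \<longlonglongrightarrow> l"
  using filterlim_compose[OF assms inverse_Suc_at_0] .

lemma dir_deriv_eqI:
  assumes "(diff_quot f u x \<longlongrightarrow> l) (at 0)"
  shows "dir_deriv f u x = l"
  unfolding dir_deriv_def by (rule limI[OF diff_quot_LIMSEQ[OF assms]])

lemma diff_quot_tendsto_dir_deriv:
  assumes "\<exists>l. (diff_quot f u x \<longlongrightarrow> l) (at 0)"
  shows "(diff_quot f u x \<longlongrightarrow> dir_deriv f u x) (at 0)"
  using assms dir_deriv_eqI by metis

lemma borel_measurable_diff_quot [measurable]:
  fixes f :: "'a::euclidean_space \<Rightarrow> real"
  assumes [measurable]: "f \<in> borel_measurable borel"
  shows "(\<lambda>x. diff_quot f u x t) \<in> borel_measurable borel"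
  unfolding diff_quot_def by measurable

lemma borel_measurable_dir_deriv [measurable]:
  fixes f :: "'a::euclidean_space \<Rightarrow> real"
  assumes [measurable]: "f \<in> borel_measurable borel"
  shows "dir_deriv f u \<in> borel_measurable borel"
  unfolding dir_deriv_def[abs_def] by measurable

lemma AE_abs_dir_deriv_le:
  fixes f :: "'a::euclidean_space \<Rightarrow> real"
  assumes lip: "L-lipschitz_on UNIV f"
  shows "AE x in lborel. \<bar>dir_deriv f u x\<bar> \<le> L * norm u"
  using AE_convergent_diff_quot[OF lip]
proof eventually_elim
  fix x assume "\<exists>l. (diff_quot f u x \<longlongrightarrow> l) (at 0)"
  from tendsto_rabs[OF diff_quot_tendsto_dir_deriv[OF this]]
  show "\<bar>dir_deriv f u x\<bar> \<le> L * norm u"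
    by (rule tendsto_upperbound) (simp_all add: abs_diff_quot_le[OF lip])
qed

text \<open>Dominated convergence, for a domain of integration that may move with the increment: its indicator
  converges off the frontier. The moving domain is what the additivity of directional
  derivatives requires.\<close>

lemma integral_diff_quot_tendsto:
  fixes f :: "'a::euclidean_space \<Rightarrow> real"
  assumes lip: "L-lipschitz_on UNIV f"
    and B: "bounded B" "B \<in> sets borel" "negligible (frontier B)"
    and s: "s \<longlonglongrightarrow> 0" and h: "h \<longlonglongrightarrow> 0" "\<And>n. h n \<noteq> (0::real)"
  shows "(\<lambda>n. \<integral>x. indicator B (x - s n *\<^sub>R z) * diff_quot f w x (h n) \<partial>lborel)
      \<longlonglongrightarrow> (\<integral>x. indicator B x * dir_deriv f w x \<partial>lborel)"
    and "integrable lborel (\<lambda>x. indicator B x * dir_deriv f w x)"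
    and "\<And>n. integrable lborel (\<lambda>x. indicator B (x - s n *\<^sub>R z) * diff_quot f w x (h n))"
proof -
  have cont: "continuous_on UNIV f" using lip lipschitz_on_continuous_on by blast
  have f [measurable]: "f \<in> borel_measurable borel" using cont by (rule borel_measurable_continuous_onI)
  note B(2) [measurable]
  have L0: "L * norm w \<ge> 0" using lipschitz_on_nonneg[OF lip] by simp
  obtain R where R: "\<And>x. x \<in> B \<Longrightarrow> norm x \<le> R" using B(1) by (auto simp: bounded_iff)
  obtain S where S: "\<And>n. \<bar>s n\<bar> \<le> S" using convergent_imp_Bseq[of s] s
    unfolding Bseq_def convergent_def by auto
  define W where "W x = L * norm w * indicator (cball 0 (R + S * norm z)) x" for x :: 'a
  have iW: "integrable lborel W" unfolding W_def
    by (intro integrable_mult_right integrable_real_indicator)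
      (simp_all add: emeasure_bounded_finite[unfolded infinity_ennreal_def])
  have "frontier B \<in> null_sets lebesgue" using B(3) by (simp add: negligible_iff_null_sets)
  then have fr: "AE x in lborel. x \<notin> frontier B"
    by (intro AE_not_in) (simp add: null_sets_completion_iff frontier_closed borel_closed)
  have fh: "filterlim h (at 0) sequentially" using h by (simp add: filterlim_at)
  have lim: "AE x in lborel. (\<lambda>n. indicator B (x - s n *\<^sub>R z) * diff_quot f w x (h n))
      \<longlonglongrightarrow> indicator B x * dir_deriv f w x"
    using fr AE_convergent_diff_quot[OF lip, of w]
  proof eventually_elim
    fix x assume x: "x \<notin> frontier B" "\<exists>l. (diff_quot f w x \<longlongrightarrow> l) (at 0)"
    have "(\<lambda>n. x - s n *\<^sub>R z) \<longlonglongrightarrow> x - 0 *\<^sub>R z" by (intro tendsto_intros s)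
    then have lx: "(\<lambda>n. x - s n *\<^sub>R z) \<longlonglongrightarrow> x" by simp
    have "x \<in> interior B \<or> x \<in> - closure B" using x(1) by (auto simp: frontier_def)
    then have "\<forall>\<^sub>F n in sequentially. indicator B (x - s n *\<^sub>R z) = (indicator B x :: real)"
    proof
      assume xi: "x \<in> interior B"
      from topological_tendstoD[OF lx open_interior this] show ?thesis
        by eventually_elim (use xi interior_subset in \<open>auto simp: indicator_def\<close>)
    next
      assume xi: "x \<in> - closure B"
      have "open (- closure B)" by auto
      from topological_tendstoD[OF lx this xi] show ?thesis
        by eventually_elim (use xi closure_subset in \<open>auto simp: indicator_def\<close>)
    qed
    then have "(\<lambda>n. indicator B (x - s n *\<^sub>R z) :: real) \<longlonglongrightarrow> indicator B x"
      by (rule tendsto_eventually)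
    moreover have "(\<lambda>n. diff_quot f w x (h n)) \<longlonglongrightarrow> dir_deriv f w x"
      using filterlim_compose[OF diff_quot_tendsto_dir_deriv[OF x(2)] fh] .
    ultimately show "(\<lambda>n. indicator B (x - s n *\<^sub>R z) * diff_quot f w x (h n))
      \<longlonglongrightarrow> indicator B x * dir_deriv f w x" by (rule tendsto_mult)
  qed
  have bound: "norm (indicator B (x - s n *\<^sub>R z) * diff_quot f w x (h n)) \<le> W x" for n x
  proof (cases "x - s n *\<^sub>R z \<in> B")
    case True
    have "norm x \<le> norm (x - s n *\<^sub>R z) + norm (s n *\<^sub>R z)" by (metis diff_add_cancel norm_triangle_ineq)
    also have "\<dots> \<le> R + S * norm z" using R[OF True] S[of n] by (auto intro!: add_mono mult_right_mono)
    finally have "norm x \<le> R + S * norm z" .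
    then show ?thesis using abs_diff_quot_le[OF lip, of w x "h n"] True by (simp add: W_def)
  qed (use L0 in \<open>simp add: W_def indicator_def\<close>)
  have m1: "(\<lambda>x. indicator B x * dir_deriv f w x) \<in> borel_measurable lborel" by measurable
  have m2: "(\<lambda>x. indicator B (x - s n *\<^sub>R z) * diff_quot f w x (h n)) \<in> borel_measurable lborel" for n
    by measurable
  show "(\<lambda>n. \<integral>x. indicator B (x - s n *\<^sub>R z) * diff_quot f w x (h n) \<partial>lborel)
      \<longlonglongrightarrow> (\<integral>x. indicator B x * dir_deriv f w x \<partial>lborel)"
    by (rule integral_dominated_convergence[OF m1 m2 iW lim]) (use bound in auto)
  show "integrable lborel (\<lambda>x. indicator B x * dir_deriv f w x)"
    by (rule integrable_dominated_convergence[OF m1 m2 iW lim]) (use bound in auto)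
  show "integrable lborel (\<lambda>x. indicator B (x - s n *\<^sub>R z) * diff_quot f w x (h n))" for n
    by (rule integrable_dominated_convergence2[OF m1 m2 iW lim]) (use bound in auto)
qed

text \<open>Scaled and shifted by \<open>1\<close>, the function becomes the density of a measure that agrees with Lebesgue measure on
  boxes, hence equals it.\<close>

lemma AE_eq_0_of_box_integrals:
  fixes W :: "'a::euclidean_space \<Rightarrow> real"
  assumes [measurable]: "W \<in> borel_measurable borel" and bd: "AE x in lborel. \<bar>W x\<bar> \<le> C"
    and int: "\<And>l u. (\<integral>x. indicator (box l u) x * W x \<partial>lborel) = 0"
  shows "AE x in lborel. W x = 0"
proof -
  define K where "K = \<bar>C\<bar> + 1"
  have K: "K > 0" by (simp add: K_def)
  define V where "V x = 1 + W x / K" for x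
  have [measurable]: "V \<in> borel_measurable borel" unfolding V_def by measurable
  have V0: "AE x in lborel. 0 \<le> V x"
    using bd
  proof eventually_elim
    fix x assume "\<bar>W x\<bar> \<le> C"
    then have "- K \<le> W x" by (simp add: K_def)
    then show "0 \<le> V x" using K by (simp add: V_def field_simps)
  qed
  have "lborel = density lborel (\<lambda>x. ennreal (V x))"
  proof (rule lborel_eqI)
    fix l u :: 'a assume le: "\<And>b. b \<in> Basis \<Longrightarrow> l \<bullet> b \<le> u \<bullet> b"
    let ?B = "box l u"
    have fin: "integrable lborel (indicator ?B :: 'a \<Rightarrow> real)"
      by (intro integrable_real_indicator) (simp_all add: emeasure_bounded_finite[unfolded infinity_ennreal_def])
    have iW: "integrable lborel (\<lambda>x. indicator ?B x * W x)"
    proof (rule Bochner_Integration.integrable_bound[OF integrable_mult_right[OF fin, of C]])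
      show "AE x in lborel. norm (indicator ?B x * W x) \<le> norm (C * indicator ?B x)"
        using bd by eventually_elim (auto simp: indicator_def)
    qed measurable
    have "emeasure (density lborel (\<lambda>x. ennreal (V x))) ?B = (\<integral>\<^sup>+x. ennreal (V x) * indicator ?B x \<partial>lborel)"
      by (rule emeasure_density) auto
    also have "\<dots> = (\<integral>\<^sup>+x. ennreal (indicator ?B x + (indicator ?B x * W x) / K) \<partial>lborel)"
      by (rule nn_integral_cong) (auto simp: indicator_def V_def)
    also have "\<dots> = ennreal (\<integral>x. indicator ?B x + (indicator ?B x * W x) / K \<partial>lborel)"
    proof (rule nn_integral_eq_integral)
      show "integrable lborel (\<lambda>x. indicator ?B x + (indicator ?B x * W x) / K)"
        using fin iW by simp
      show "AE x in lborel. 0 \<le> indicator ?B x + (indicator ?B x * W x) / K"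
        using V0 by eventually_elim (auto simp: indicator_def V_def)
    qed
    also have "(\<integral>x. indicator ?B x + (indicator ?B x * W x) / K \<partial>lborel) = measure lborel ?B"
      using fin iW int[of l u] by simp
    also have "ennreal (measure lborel ?B) = (\<Prod>b\<in>Basis. (u - l) \<bullet> b)"
      using le by (simp add: measure_lborel_box_eq)
    finally show "emeasure (density lborel (\<lambda>x. ennreal (V x))) ?B = (\<Prod>b\<in>Basis. (u - l) \<bullet> b)" .
  qed simp
  then have "density lborel (\<lambda>x. ennreal (V x)) = density lborel (\<lambda>x. 1)"
    by (simp add: density_1)
  then have "AE x in lborel. ennreal (V x) = 1"
    by (intro sigma_finite_measure.density_unique[OF sigma_finite_lborel]) auto
  with V0 show ?thesis
    by eventually_elim (use K in \<open>auto simp: V_def field_simps\<close>)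
qed

lemma diff_quot_add:
  "diff_quot f (u + v) x t = diff_quot f v (x + t *\<^sub>R u) t + diff_quot f u x t"
  by (simp add: diff_quot_def scaleR_add_right add.assoc diff_divide_distrib)

text \<open>A difference quotient along \<open>u + v\<close> is one along \<open>u\<close> plus one along \<open>v\<close> at a shifted point. Pointwise
  the shift is an obstacle, but after integration over a box it only moves the box, and this
  effect disappears in the limit. So both sides have the same integral over every box.\<close>

lemma AE_dir_deriv_add:
  fixes f :: "'a::euclidean_space \<Rightarrow> real"
  assumes lip: "L-lipschitz_on UNIV f"
  shows "AE x in lborel. dir_deriv f (u + v) x = dir_deriv f u x + dir_deriv f v x"
proof -
  have cont: "continuous_on UNIV f" using lip lipschitz_on_continuous_on by blast
  have f [measurable]: "f \<in> borel_measurable borel" using cont by (rule borel_measurable_continuous_onI)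
  define W where "W x = dir_deriv f (u + v) x - dir_deriv f u x - dir_deriv f v x" for x
  have "AE x in lborel. W x = 0"
  proof (rule AE_eq_0_of_box_integrals)
    show "W \<in> borel_measurable borel" unfolding W_def[abs_def] by measurable
    show "AE x in lborel. \<bar>W x\<bar> \<le> L * norm (u + v) + L * norm u + L * norm v"
      using AE_abs_dir_deriv_le[OF lip, of "u + v"] AE_abs_dir_deriv_le[OF lip, of u]
        AE_abs_dir_deriv_le[OF lip, of v]
      by eventually_elim (unfold W_def, linarith)
    fix l r :: 'a
    let ?B = "box l r"
    let ?h = "\<lambda>n. inverse (real (Suc n))"
    have h: "?h \<longlonglongrightarrow> 0" "\<And>n. ?h n \<noteq> 0" using LIMSEQ_inverse_real_of_nat by auto
    have fr: "negligible (frontier ?B)" by (simp add: negligible_convex_frontier convex_box)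
    note lims = integral_diff_quot_tendsto[OF lip bounded_box _ fr _ h]
    have Bm: "?B \<in> sets borel" by simp
    have A: "(\<lambda>n. \<integral>x. indicator ?B x * diff_quot f w x (?h n) \<partial>lborel)
        \<longlonglongrightarrow> (\<integral>x. indicator ?B x * dir_deriv f w x \<partial>lborel)"
      and iD: "integrable lborel (\<lambda>x. indicator ?B x * dir_deriv f w x)"
      and iA: "integrable lborel (\<lambda>x. indicator ?B x * diff_quot f w x (?h n))" for w n
      using lims(1)[OF Bm tendsto_const, where z = 0 and w = w] lims(2)[OF Bm tendsto_const, where w = w]
        lims(3)[OF Bm tendsto_const, where z = 0 and w = w] by simp_all
    have S: "(\<lambda>n. \<integral>x. indicator ?B (x - ?h n *\<^sub>R u) * diff_quot f v x (?h n) \<partial>lborel)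
        \<longlonglongrightarrow> (\<integral>x. indicator ?B x * dir_deriv f v x \<partial>lborel)"
      using lims(1)[OF Bm h(1)] by simp
    have iS: "integrable lborel (\<lambda>x. indicator ?B (x - ?h n *\<^sub>R u) * diff_quot f v x (?h n))" for n
      using lims(3)[OF Bm h(1)] by simp
    have split: "(\<integral>x. indicator ?B x * diff_quot f (u + v) x (?h n) \<partial>lborel)
        = (\<integral>x. indicator ?B (x - ?h n *\<^sub>R u) * diff_quot f v x (?h n) \<partial>lborel)
          + (\<integral>x. indicator ?B x * diff_quot f u x (?h n) \<partial>lborel)" for n
    proof -
      let ?k = "\<lambda>x. indicator ?B (x - ?h n *\<^sub>R u) * diff_quot f v x (?h n)"
      have km: "?k \<in> borel_measurable borel" by measurable
      have "(\<integral>x. ?k x \<partial>lborel) = (\<integral>x. ?k x \<partial>distr lborel borel ((+) (?h n *\<^sub>R u)))"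
        by (simp add: lborel_distr_plus)
      also have "\<dots> = (\<integral>x. ?k (?h n *\<^sub>R u + x) \<partial>lborel)"
        by (rule integral_distr) (use km in auto)
      finally have 1: "(\<integral>x. ?k x \<partial>lborel) = (\<integral>x. ?k (?h n *\<^sub>R u + x) \<partial>lborel)" .
      have "integrable (distr lborel borel ((+) (?h n *\<^sub>R u))) ?k"
        using iS[of n] by (simp add: lborel_distr_plus)
      then have "integrable lborel (\<lambda>x. ?k (?h n *\<^sub>R u + x))"
        by (subst (asm) integrable_distr_eq) (use km in auto)
      then have "(\<integral>x. ?k x \<partial>lborel) + (\<integral>x. indicator ?B x * diff_quot f u x (?h n) \<partial>lborel)
          = (\<integral>x. ?k (?h n *\<^sub>R u + x) + indicator ?B x * diff_quot f u x (?h n) \<partial>lborel)"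
        unfolding 1 using iA[where w = u and n = n] by (intro Bochner_Integration.integral_add[symmetric])
      also have "\<dots> = (\<integral>x. indicator ?B x * diff_quot f (u + v) x (?h n) \<partial>lborel)"
        by (intro Bochner_Integration.integral_cong) (simp_all add: diff_quot_add algebra_simps)
      finally show ?thesis by simp
    qed
    have "(\<integral>x. indicator ?B x * dir_deriv f (u + v) x \<partial>lborel)
        = (\<integral>x. indicator ?B x * dir_deriv f v x \<partial>lborel) + (\<integral>x. indicator ?B x * dir_deriv f u x \<partial>lborel)"
      using LIMSEQ_unique[OF A[where w = "u + v", unfolded split] tendsto_add[OF S A[where w = u]]] .
    moreover have "(\<integral>x. indicator ?B x * W x \<partial>lborel) = (\<integral>x. indicator ?B x * dir_deriv f (u + v) x
        - indicator ?B x * dir_deriv f u x - indicator ?B x * dir_deriv f v x \<partial>lborel)"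
      by (simp add: W_def algebra_simps)
    ultimately show "(\<integral>x. indicator ?B x * W x \<partial>lborel) = 0"
      using iD by simp
  qed
  then show ?thesis by eventually_elim (simp add: W_def)
qed

lemma diff_quot_scaleR_tendsto:
  assumes "(diff_quot f u x \<longlongrightarrow> l) (at 0)"
  shows "(diff_quot f (c *\<^sub>R u) x \<longlongrightarrow> c * l) (at 0)"
proof (cases "c = 0")
  case True
  then show ?thesis by (simp add: diff_quot_def[abs_def])
next
  case False
  have "filterlim (\<lambda>t. t * c) (at 0) (at (0::real))"
    using False by (intro filterlim_atI) (auto intro!: tendsto_eq_intros simp: eventually_at_filter)
  from tendsto_mult_left[OF filterlim_compose[OF assms this], of c]
  show ?thesis using False by (simp add: diff_quot_def[abs_def] mult.commute)
qed

lemma AE_dir_deriv_sum: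
  fixes f :: "'a::euclidean_space \<Rightarrow> real"
  assumes lip: "L-lipschitz_on UNIV f" and "finite A"
  shows "AE x in lborel. dir_deriv f (\<Sum>b\<in>A. c b *\<^sub>R b) x = (\<Sum>b\<in>A. c b * dir_deriv f b x)"
  using \<open>finite A\<close>
proof induction
  case empty
  have "dir_deriv f 0 x = 0" for x
    by (rule dir_deriv_eqI) (simp add: diff_quot_def[abs_def])
  then show ?case by simp
next
  case (insert b A)
  have "AE x in lborel. dir_deriv f (c b *\<^sub>R b) x = c b * dir_deriv f b x"
    using AE_convergent_diff_quot[OF lip, of b]
    by eventually_elim (rule dir_deriv_eqI[OF diff_quot_scaleR_tendsto[OF diff_quot_tendsto_dir_deriv]])
  with insert.IH AE_dir_deriv_add[OF lip, of "c b *\<^sub>R b" "\<Sum>b\<in>A. c b *\<^sub>R b"]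
  show ?case by eventually_elim (simp add: insert.hyps)
qed

text \<open>By the Lipschitz condition, a finite net of directions on the unit sphere controls all directions
  uniformly.\<close>

lemma has_derivative_of_dense_directions:
  fixes f :: "'a::euclidean_space \<Rightarrow> real"
  assumes lip: "L-lipschitz_on UNIV f"
    and dense: "\<And>S. open S \<Longrightarrow> S \<noteq> {} \<Longrightarrow> \<exists>d\<in>Q. d \<in> S"
    and dir: "\<And>u. u \<in> Q \<Longrightarrow> (diff_quot f u x \<longlongrightarrow> u \<bullet> G) (at 0)"
  shows "(f has_derivative (\<lambda>v. v \<bullet> G)) (at x)"
  unfolding has_derivative_at_alt
proof (intro conjI allI impI bounded_linear_inner_left)
  fix e :: real assume e: "0 < e"
  define M where "M = L + norm G + 1"
  have L0: "L \<ge> 0" using lip lipschitz_on_nonneg by blast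
  then have M: "M > 0" by (simp add: M_def add_nonneg_pos)
  define r where "r = e / M"
  have r: "r > 0" using e M by (simp add: r_def)
  have "sphere 0 1 \<subseteq> (\<Union>u\<in>Q. ball u r)"
  proof
    fix w :: 'a
    obtain u where "u \<in> Q" "u \<in> ball w r" using dense[of "ball w r"] r by auto
    then show "w \<in> (\<Union>u\<in>Q. ball u r)" by (auto simp: dist_commute)
  qed
  then obtain Q0 where Q0: "Q0 \<subseteq> Q" "finite Q0" "sphere (0::'a) 1 \<subseteq> (\<Union>u\<in>Q0. ball u r)"
    by (rule compactE_image[OF compact_sphere open_ball])
  have "\<forall>u\<in>Q0. \<forall>\<^sub>F t in at 0. dist (diff_quot f u x t) (u \<bullet> G) < r"
    using Q0(1) dir r by (auto intro: tendstoD)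
  then have "\<forall>\<^sub>F t in at 0. \<forall>u\<in>Q0. dist (diff_quot f u x t) (u \<bullet> G) < r"
    using Q0(2) by (simp add: eventually_ball_finite)
  then obtain d where d: "d > 0"
    "\<And>t. t \<noteq> 0 \<Longrightarrow> \<bar>t\<bar> < d \<Longrightarrow> \<forall>u\<in>Q0. dist (diff_quot f u x t) (u \<bullet> G) < r"
    unfolding eventually_at by (auto simp: dist_real_def)
  show "\<exists>d>0. \<forall>y. norm (y - x) < d \<longrightarrow> norm (f y - f x - (y - x) \<bullet> G) \<le> e * norm (y - x)"
  proof (intro exI[of _ d] conjI allI impI d(1))
    fix y assume y: "norm (y - x) < d"
    show "norm (f y - f x - (y - x) \<bullet> G) \<le> e * norm (y - x)"
    proof (cases "y = x")
      case False
      define t where "t = norm (y - x)"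
      define w where "w = (y - x) /\<^sub>R t"
      have t: "t > 0" "t < d" using False y by (auto simp: t_def)
      have w: "w \<in> sphere 0 1" using t by (simp add: w_def t_def)
      then obtain u where u: "u \<in> Q0" "dist u w < r" using Q0(3) by auto
      have yw: "y = x + t *\<^sub>R w" using t by (simp add: w_def)
      have q: "\<bar>diff_quot f u x t - u \<bullet> G\<bar> < r" using d(2)[of t] t u(1) by (simp add: dist_real_def)
      have 1: "\<bar>f (x + t *\<^sub>R w) - f (x + t *\<^sub>R u)\<bar> \<le> t * (L * r)"
      proof -
        have "dist (f (x + t *\<^sub>R w)) (f (x + t *\<^sub>R u)) \<le> L * dist (x + t *\<^sub>R w) (x + t *\<^sub>R u)"
          by (rule lipschitz_onD[OF lip]) auto
        also have "dist (x + t *\<^sub>R w) (x + t *\<^sub>R u) = t * dist w u"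
          using t by (simp add: dist_norm scaleR_diff_right[symmetric])
        also have "L * (t * dist w u) \<le> L * (t * r)"
          using u(2) t L0 by (intro mult_left_mono) (auto simp: dist_commute)
        finally show ?thesis by (simp add: dist_real_def mult_ac)
      qed
      have 2: "\<bar>t * (diff_quot f u x t - u \<bullet> G)\<bar> \<le> t * r"
        using q t by (simp add: abs_mult)
      have 3: "\<bar>t * ((u - w) \<bullet> G)\<bar> \<le> t * (norm G * r)"
      proof -
        have "\<bar>(u - w) \<bullet> G\<bar> \<le> norm (u - w) * norm G" by (rule Cauchy_Schwarz_ineq2)
        also have "\<dots> \<le> r * norm G" using u(2) by (intro mult_right_mono) (auto simp: dist_norm)
        finally show ?thesis using t by (simp add: abs_mult mult_ac)
      qed
      have tq: "t * diff_quot f u x t = f (x + t *\<^sub>R u) - f x"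
        using t by (simp add: diff_quot_def)
      have "f y - f x - (y - x) \<bullet> G = (f (x + t *\<^sub>R w) - f (x + t *\<^sub>R u))
          + t * (diff_quot f u x t - u \<bullet> G) + t * ((u - w) \<bullet> G)"
        by (simp add: yw inner_diff_left right_diff_distrib tq)
      then have "\<bar>f y - f x - (y - x) \<bullet> G\<bar> \<le> t * (L * r) + t * r + t * (norm G * r)"
        using 1 2 3 by linarith
      also have "\<dots> = t * (M * r)" by (simp add: M_def algebra_simps)
      also have "M * r = e" using M by (simp add: r_def)
      finally show ?thesis by (simp add: t_def mult.commute)
    qed simp
  qed
qed

lemma Rademacher_real:
  fixes f :: "'a::euclidean_space \<Rightarrow> real"
  assumes lip: "L-lipschitz_on UNIV f"
  shows "AE x in lborel. f differentiable (at x)"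
proof -
  obtain Q :: "'a set" where Q: "countable Q" "\<And>S. open S \<Longrightarrow> S \<noteq> {} \<Longrightarrow> \<exists>d\<in>Q. d \<in> S"
    by (rule countable_dense_setE) (rule that)
  have "AE x in lborel. \<forall>u\<in>Q. \<exists>l. (diff_quot f u x \<longlongrightarrow> l) (at 0)"
    using AE_convergent_diff_quot[OF lip] by (subst AE_ball_countable[OF Q(1)]) auto
  moreover have "AE x in lborel. \<forall>u\<in>Q. dir_deriv f u x = (\<Sum>b\<in>Basis. (u \<bullet> b) * dir_deriv f b x)"
    using AE_dir_deriv_sum[OF lip finite_Basis, of "\<lambda>b. u \<bullet> b" for u]
    by (subst AE_ball_countable[OF Q(1)]) (simp add: euclidean_representation)
  ultimately show ?thesis
  proof eventually_elim
    fix x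
    assume 1: "\<forall>u\<in>Q. \<exists>l. (diff_quot f u x \<longlongrightarrow> l) (at 0)"
      and 2: "\<forall>u\<in>Q. dir_deriv f u x = (\<Sum>b\<in>Basis. (u \<bullet> b) * dir_deriv f b x)"
    let ?G = "\<Sum>b\<in>Basis. dir_deriv f b x *\<^sub>R b"
    have "(f has_derivative (\<lambda>v. v \<bullet> ?G)) (at x)"
    proof (rule has_derivative_of_dense_directions[OF lip Q(2)])
      fix u assume u: "u \<in> Q"
      have "u \<bullet> ?G = dir_deriv f u x" using 2 u by (simp add: inner_sum_right mult.commute)
      then show "(diff_quot f u x \<longlongrightarrow> u \<bullet> ?G) (at 0)"
        using diff_quot_tendsto_dir_deriv 1 u by metis
    qed
    then show "f differentiable (at x)" by (rule differentiableI)
  qed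
qed

theorem Rademacher:
  fixes G :: "'a::euclidean_space \<Rightarrow> 'b::euclidean_space"
  assumes lip: "L-lipschitz_on UNIV G"
  shows "AE x in lborel. G differentiable (at x)"
proof -
  have "AE x in lborel. \<forall>b\<in>Basis. (\<lambda>x. G x \<bullet> b) differentiable (at x)"
  proof (subst AE_ball_countable[OF countable_finite[OF finite_Basis]], intro ballI)
    fix b :: 'b assume b: "b \<in> Basis"
    have "L-lipschitz_on UNIV (\<lambda>x. G x \<bullet> b)"
    proof (rule lipschitz_onI)
      fix x y
      have "\<bar>(G x - G y) \<bullet> b\<bar> \<le> norm (G x - G y)" using Basis_le_norm[OF b] .
      also have "\<dots> \<le> L * dist x y" using lipschitz_onD[OF lip, of x y] by (simp add: dist_norm)
      finally show "dist (G x \<bullet> b) (G y \<bullet> b) \<le> L * dist x y" by (simp add: dist_real_def inner_diff_left)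
    qed (use lipschitz_on_nonneg[OF lip] in simp)
    then show "AE x in lborel. (\<lambda>x. G x \<bullet> b) differentiable (at x)" by (rule Rademacher_real)
  qed
  then show ?thesis
    by eventually_elim (simp add: differentiable_componentwise_within[of G])
qed

section \<open>Slopes and limits of derivatives\<close>

text \<open>The integral \<open>\<Phi>\<close> of \<open>f\<close> over a ball translated along \<open>u\<close> is differentiable, its derivative being the
  integral of the directional derivative. The mean value theorem for \<open>\<Phi>\<close> yields a ball
  on which the directional derivative is at least \<open>k\<close> on average, so it exceeds \<open>k'\<close> on a set of positive
  measure, which meets every set of full measure.\<close>

lemma exists_dir_deriv_above_mean_slope:
  fixes f :: "'a::euclidean_space \<Rightarrow> real"
  assumes lip: "L-lipschitz_on UNIV f" and ae: "AE x in lborel. P x"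
    and r: "r > 0" and s: "s > 0" and k: "k' < k"
    and slope: "\<And>x. x \<in> ball z r \<Longrightarrow> k * s \<le> f (x + s *\<^sub>R u) - f x"
  obtains y where "P y" "dist y z < r + s * norm u" "(diff_quot f u y \<longlongrightarrow> dir_deriv f u y) (at 0)"
    "k' < dir_deriv f u y"
proof -
  have cont: "continuous_on UNIV f" using lip lipschitz_on_continuous_on by blast
  have f [measurable]: "f \<in> borel_measurable borel" using cont by (rule borel_measurable_continuous_onI)
  have B [measurable]: "ball c r \<in> sets borel" for c :: 'a by simp
  let ?B = "\<lambda>\<tau>. ball (z + \<tau> *\<^sub>R u) r"
  define \<Phi> where "\<Phi> \<tau> = (\<integral>x. indicator (ball z r) x * f (x + \<tau> *\<^sub>R u) \<partial>lborel)" for \<tau>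
  define \<Phi>' where "\<Phi>' \<tau> = (\<integral>x. indicator (?B \<tau>) x * dir_deriv f u x \<partial>lborel)" for \<tau>
  have fin: "integrable lborel (indicator (ball c r) :: 'a \<Rightarrow> real)" for c
    by (rule integrable_real_indicator[OF _ emeasure_bounded_finite[OF bounded_ball]]) simp
  have iF: "integrable lborel (\<lambda>x. indicator (ball z r) x * f (x + \<tau> *\<^sub>R u))" for \<tau>
  proof -
    have "continuous_on (cball z r) (\<lambda>x. f (x + \<tau> *\<^sub>R u))"
      by (rule continuous_on_compose2[OF cont]) (auto intro!: continuous_intros)
    then have "bounded ((\<lambda>x. f (x + \<tau> *\<^sub>R u)) ` cball z r)"
      by (intro compact_imp_bounded compact_continuous_image compact_cball)
    then obtain M where M: "\<And>x. x \<in> cball z r \<Longrightarrow> \<bar>f (x + \<tau> *\<^sub>R u)\<bar> \<le> M"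
      by (auto simp: bounded_iff simp del: mem_cball)
    show ?thesis
    proof (rule Bochner_Integration.integrable_bound[OF integrable_mult_right[OF fin, of M]])
      show "AE x in lborel. norm (indicator (ball z r) x * f (x + \<tau> *\<^sub>R u)) \<le> norm (M * indicator (ball z r) x)"
      proof (intro AE_I2)
        fix x
        show "norm (indicator (ball z r) x * f (x + \<tau> *\<^sub>R u)) \<le> norm (M * indicator (ball z r) x)"
        proof (cases "x \<in> ball z r")
          case True
          then have "\<bar>f (x + \<tau> *\<^sub>R u)\<bar> \<le> M" using M ball_subset_cball by blast
          then show ?thesis using True by simp
        qed simp
      qed
    qed measurable
  qed
  have fr: "negligible (frontier (?B \<tau>))" for \<tau> by (rule negligible_convex_frontier[OF convex_ball])
  have iD: "integrable lborel (\<lambda>x. indicator (?B \<tau>) x * dir_deriv f u x)" for \<tau>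
    using integral_diff_quot_tendsto(2)[OF lip bounded_ball _ fr LIMSEQ_inverse_real_of_nat
      LIMSEQ_inverse_real_of_nat, where w = u] by simp
  have der: "DERIV \<Phi> \<tau> :> \<Phi>' \<tau>" for \<tau>
    unfolding DERIV_def tendsto_at_iff_sequentially
  proof (intro allI impI)
    fix h :: "nat \<Rightarrow> real" assume "\<forall>i. h i \<in> UNIV - {0}" "h \<longlonglongrightarrow> 0"
    then have h: "h \<longlonglongrightarrow> 0" "\<And>n. h n \<noteq> 0" by auto
    have "(\<lambda>n. \<integral>x. indicator (?B \<tau>) x * diff_quot f u x (h n) \<partial>lborel) \<longlonglongrightarrow> \<Phi>' \<tau>"
      unfolding \<Phi>'_def
      using integral_diff_quot_tendsto(1)[OF lip bounded_ball _ fr tendsto_const h, where z = 0] by simp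
    moreover have "(\<integral>x. indicator (?B \<tau>) x * diff_quot f u x (h n) \<partial>lborel)
        = (\<Phi> (\<tau> + h n) - \<Phi> \<tau>) / h n" for n
    proof -
      let ?k = "\<lambda>x. indicator (?B \<tau>) x * diff_quot f u x (h n)"
      have "(\<integral>x. ?k x \<partial>lborel) = (\<integral>x. ?k x \<partial>distr lborel borel ((+) (\<tau> *\<^sub>R u)))"
        by (simp add: lborel_distr_plus)
      also have "\<dots> = (\<integral>x. ?k (\<tau> *\<^sub>R u + x) \<partial>lborel)"
        by (rule integral_distr) auto
      also have "\<dots> = (\<integral>x. (indicator (ball z r) x * f (x + (\<tau> + h n) *\<^sub>R u)
          - indicator (ball z r) x * f (x + \<tau> *\<^sub>R u)) / h n \<partial>lborel)"
      proof (rule Bochner_Integration.integral_cong[OF refl])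
        fix x
        have "\<tau> *\<^sub>R u + x \<in> ?B \<tau> \<longleftrightarrow> x \<in> ball z r" by (simp add: dist_norm algebra_simps)
        then have "indicator (?B \<tau>) (\<tau> *\<^sub>R u + x) = (indicator (ball z r) x :: real)"
          by (simp add: indicator_def)
        then show "?k (\<tau> *\<^sub>R u + x) = (indicator (ball z r) x * f (x + (\<tau> + h n) *\<^sub>R u)
          - indicator (ball z r) x * f (x + \<tau> *\<^sub>R u)) / h n"
          by (simp add: diff_quot_def scaleR_add_left add_ac right_diff_distrib)
      qed
      also have "\<dots> = (\<Phi> (\<tau> + h n) - \<Phi> \<tau>) / h n"
        unfolding \<Phi>_def using iF by simp
      finally show ?thesis .
    qed
    ultimately show "((\<lambda>t. (\<Phi> (\<tau> + t) - \<Phi> \<tau>) / t) \<circ> h) \<longlonglongrightarrow> \<Phi>' \<tau>" by (simp add: comp_def)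
  qed
  obtain \<xi> where \<xi>: "0 < \<xi>" "\<xi> < s" "\<Phi> s - \<Phi> 0 = (s - 0) * \<Phi>' \<xi>"
    using MVT2[OF s, of \<Phi> \<Phi>'] der by blast
  let ?m = "measure lborel (ball z r)"
  have m: "measure lborel (?B \<xi>) = ?m" "?m > 0"
    using content_ball[of r "z + \<xi> *\<^sub>R u"] content_ball[of r z] content_ball_pos[OF r, of z] r
    by (simp_all add: less_imp_le)
  have "k * s * ?m = (\<integral>x. k * s * indicator (ball z r) x \<partial>lborel)" by simp
  also have "\<dots> \<le> (\<integral>x. indicator (ball z r) x * f (x + s *\<^sub>R u) - indicator (ball z r) x * f (x + 0 *\<^sub>R u) \<partial>lborel)"
  proof (rule integral_mono)
    show "k * s * indicator (ball z r) x
        \<le> indicator (ball z r) x * f (x + s *\<^sub>R u) - indicator (ball z r) x * f (x + 0 *\<^sub>R u)" for x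
      using slope[of x] by (cases "x \<in> ball z r") (simp_all del: mem_ball)
  qed (intro integrable_mult_right fin Bochner_Integration.integrable_diff iF)+
  also have "\<dots> = \<Phi> s - \<Phi> 0"
    unfolding \<Phi>_def by (rule Bochner_Integration.integral_diff[OF iF iF])
  finally have "s * (k * ?m) \<le> s * \<Phi>' \<xi>" using \<xi>(3) by (simp add: mult_ac)
  then have big: "k * ?m \<le> \<Phi>' \<xi>" using s by simp
  have "\<not> (AE y in lborel. y \<in> ?B \<xi> \<longrightarrow> dir_deriv f u y \<le> k')"
  proof
    assume "AE y in lborel. y \<in> ?B \<xi> \<longrightarrow> dir_deriv f u y \<le> k'"
    then have "\<Phi>' \<xi> \<le> (\<integral>x. k' * indicator (?B \<xi>) x \<partial>lborel)"
      unfolding \<Phi>'_def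
    proof (intro integral_mono_AE iD integrable_mult_right fin, eventually_elim)
      fix y assume "y \<in> ?B \<xi> \<longrightarrow> dir_deriv f u y \<le> k'"
      then show "indicator (?B \<xi>) y * dir_deriv f u y \<le> k' * indicator (?B \<xi>) y"
        by (cases "y \<in> ?B \<xi>") (simp_all del: mem_ball)
    qed
    then have "\<Phi>' \<xi> \<le> k' * ?m" using m by simp
    also have "\<dots> < k * ?m" using m k by simp
    finally show False using big by simp
  qed
  moreover have "AE y in lborel. P y \<and> (diff_quot f u y \<longlongrightarrow> dir_deriv f u y) (at 0)"
    using ae AE_convergent_diff_quot[OF lip, of u] by eventually_elim (auto intro: diff_quot_tendsto_dir_deriv)
  ultimately have "\<exists>y. P y \<and> (diff_quot f u y \<longlongrightarrow> dir_deriv f u y) (at 0) \<and> y \<in> ?B \<xi> \<and> k' < dir_deriv f u y"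
  proof (rule_tac ccontr)
    assume no: "\<nexists>y. P y \<and> (diff_quot f u y \<longlongrightarrow> dir_deriv f u y) (at 0) \<and> y \<in> ?B \<xi> \<and> k' < dir_deriv f u y"
    assume "AE y in lborel. P y \<and> (diff_quot f u y \<longlongrightarrow> dir_deriv f u y) (at 0)"
    then have "AE y in lborel. y \<in> ?B \<xi> \<longrightarrow> dir_deriv f u y \<le> k'"
      by eventually_elim (use no not_less in blast)
    moreover assume "\<not> (AE y in lborel. y \<in> ?B \<xi> \<longrightarrow> dir_deriv f u y \<le> k')"
    ultimately show False by contradiction
  qed
  then obtain y where y: "P y" "(diff_quot f u y \<longlongrightarrow> dir_deriv f u y) (at 0)" "y \<in> ?B \<xi>" "k' < dir_deriv f u y"
    by blast
  have "dist y z \<le> dist y (z + \<xi> *\<^sub>R u) + dist (z + \<xi> *\<^sub>R u) z" by (rule dist_triangle)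
  also have "dist (z + \<xi> *\<^sub>R u) z = \<xi> * norm u" using \<xi> by (simp add: dist_norm)
  also have "dist y (z + \<xi> *\<^sub>R u) + \<xi> * norm u < r + \<xi> * norm u" using y(3) by (simp add: dist_commute)
  also have "\<dots> \<le> r + s * norm u" using \<xi> by (simp add: mult_right_mono)
  finally show ?thesis using that y by blast
qed

lemma diff_quot_inner_tendsto:
  fixes G :: "'a::real_normed_vector \<Rightarrow> 'b::real_inner"
  assumes "(G has_derivative J) (at y)"
  shows "(diff_quot (\<lambda>x. w \<bullet> G x) u y \<longlongrightarrow> w \<bullet> J u) (at 0)"
proof -
  have lin: "linear J" using assms has_derivative_linear by blast
  have "((\<lambda>t::real. y + t *\<^sub>R u) has_derivative (\<lambda>t. t *\<^sub>R u)) (at 0)"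
    by (auto intro!: derivative_eq_intros)
  moreover have "(G has_derivative J) (at (y + 0 *\<^sub>R u))" using assms by simp
  ultimately have "((\<lambda>t. G (y + t *\<^sub>R u)) has_derivative (\<lambda>t. J (t *\<^sub>R u))) (at 0)"
    by (rule has_derivative_compose)
  then have "((\<lambda>t. w \<bullet> G (y + t *\<^sub>R u)) has_derivative (\<lambda>t. w \<bullet> J (t *\<^sub>R u))) (at 0)"
    by (rule has_derivative_inner_right)
  also have "(\<lambda>t. w \<bullet> J (t *\<^sub>R u)) = (*) (w \<bullet> J u)"
    using lin by (auto simp: linear_scale mult.commute)
  finally have "DERIV (\<lambda>t. w \<bullet> G (y + t *\<^sub>R u)) 0 :> w \<bullet> J u"
    by (simp add: has_field_derivative_def)
  then show ?thesis by (simp add: DERIV_def diff_quot_def[abs_def])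
qed

lemma lipschitz_on_inner_left:
  fixes G :: "'a::metric_space \<Rightarrow> 'b::real_inner"
  assumes lip: "L-lipschitz_on UNIV G"
  shows "(norm w * L)-lipschitz_on UNIV (\<lambda>x. w \<bullet> G x)"
proof (rule lipschitz_onI)
  fix x y
  have "\<bar>w \<bullet> (G x - G y)\<bar> \<le> norm w * norm (G x - G y)" by (rule Cauchy_Schwarz_ineq2)
  also have "\<dots> \<le> norm w * (L * dist x y)"
    using lipschitz_onD[OF lip, of x y] by (intro mult_left_mono) (auto simp: dist_norm)
  finally show "dist (w \<bullet> G x) (w \<bullet> G y) \<le> norm w * L * dist x y"
    by (simp add: dist_real_def inner_diff_right mult.assoc)
qed (use lipschitz_on_nonneg[OF lip] in simp)

lemma abs_inner_derivative_le:
  fixes G :: "'a::real_normed_vector \<Rightarrow> 'b::real_inner"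
  assumes lip: "L-lipschitz_on UNIV G" and "(G has_derivative J) (at y)"
  shows "\<bar>w \<bullet> J u\<bar> \<le> norm w * L * norm u"
  using tendsto_rabs[OF diff_quot_inner_tendsto[OF assms(2)]]
  by (rule tendsto_upperbound) (simp_all add: abs_diff_quot_le[OF lipschitz_on_inner_left[OF lip]])

text \<open>The bridge from difference quotients at a point, where \<open>G\<close> need not be differentiable, to limits of
  derivatives. The slope condition at increment \<open>t\<close> persists for base points in a small ball, so the
  averaged mean value theorem applies there, with Rademacher's theorem providing total derivatives.\<close>

proposition derivatives_above_slope:
  fixes G :: "'a::euclidean_space \<Rightarrow> 'b::euclidean_space"
  assumes lip: "L-lipschitz_on UNIV G" and k: "k' < k"
    and fr: "\<exists>\<^sub>F t in at 0. k < diff_quot (\<lambda>x. w \<bullet> G x) u z t"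
  obtains Z J where "Z \<longlonglongrightarrow> z" "\<And>n. (G has_derivative J n) (at (Z n))" "\<And>n. k' < w \<bullet> J n u"
proof -
  let ?f = "\<lambda>x. w \<bullet> G x"
  note lipf = lipschitz_on_inner_left[OF lip, of w]
  have contf: "continuous_on UNIV ?f" using lipf lipschitz_on_continuous_on by blast
  let ?e = "\<lambda>n. inverse (real (Suc n))"
  have "\<exists>y J. dist y z < ?e n * (1 + 2 * norm u) \<and> (G has_derivative J) (at y) \<and> k' < w \<bullet> J u" for n
  proof -
    have e: "?e n > 0" by simp
    obtain t where t: "t \<noteq> 0" "\<bar>t\<bar> < ?e n" "k < diff_quot ?f u z t"
      using frequently_at_0_realD[OF fr e] by metis
    \<comment> \<open>For a negative increment the segment is traversed from its other end.\<close>
    define c where "c = (if t > 0 then z else z + t *\<^sub>R u)"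
    let ?s = "\<bar>t\<bar>"
    have c: "k * ?s < ?f (c + ?s *\<^sub>R u) - ?f c"
      using t(1,3) by (cases "t > 0") (auto simp: c_def diff_quot_def field_simps)
    have "continuous_on UNIV (\<lambda>x. ?f (x + ?s *\<^sub>R u))"
      by (rule continuous_on_compose2[OF contf]) (auto intro!: continuous_intros)
    then have "continuous_on UNIV (\<lambda>x. ?f (x + ?s *\<^sub>R u) - ?f x)"
      by (intro continuous_on_diff contf)
    then have "open ((\<lambda>x. ?f (x + ?s *\<^sub>R u) - ?f x) -` {k * ?s<..})"
      by (rule open_vimage[OF open_greaterThan])
    then obtain r0 where r0: "r0 > 0" "ball c r0 \<subseteq> (\<lambda>x. ?f (x + ?s *\<^sub>R u) - ?f x) -` {k * ?s<..}"
      using c by (auto elim: openE)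
    define r where "r = min r0 (?e n)"
    have r: "r > 0" using r0 e by (simp add: r_def)
    have sl: "k * ?s \<le> ?f (x + ?s *\<^sub>R u) - ?f x" if "x \<in> ball c r" for x
    proof -
      have "x \<in> ball c r0" using that by (simp add: r_def)
      then show ?thesis using r0(2) by auto
    qed
    obtain y where y: "G differentiable (at y)" "dist y c < r + ?s * norm u"
      "(diff_quot ?f u y \<longlongrightarrow> dir_deriv ?f u y) (at 0)" "k' < dir_deriv ?f u y"
      using exists_dir_deriv_above_mean_slope[OF lipf Rademacher[OF lip] r _ k sl] t(1) by auto
    obtain J where J: "(G has_derivative J) (at y)" using y(1) by (auto simp: differentiable_def)
    have "dir_deriv ?f u y = w \<bullet> J u" by (rule dir_deriv_eqI[OF diff_quot_inner_tendsto[OF J]])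
    moreover have "dist y z < ?e n * (1 + 2 * norm u)"
    proof -
      have "dist c z \<le> ?s * norm u" by (simp add: c_def dist_norm)
      then have "dist y z < r + 2 * (?s * norm u)" using y(2) dist_triangle[of y z c] by linarith
      also have "\<dots> \<le> ?e n + 2 * (?e n * norm u)"
        using t(2) by (intro add_mono mult_left_mono mult_right_mono) (auto simp: r_def)
      finally show ?thesis by (simp add: algebra_simps)
    qed
    ultimately show ?thesis using J y(4) by auto
  qed
  then obtain Z J where ZJ: "\<And>n. dist (Z n) z < ?e n * (1 + 2 * norm u)"
    "\<And>n. (G has_derivative J n) (at (Z n))" "\<And>n. k' < w \<bullet> J n u"
    by metis
  have "(\<lambda>n. ?e n * (1 + 2 * norm u)) \<longlonglongrightarrow> 0"
    by (rule tendsto_mult_left_zero[OF LIMSEQ_inverse_real_of_nat])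
  then have "(\<lambda>n. dist (Z n) z) \<longlonglongrightarrow> 0"
  proof (rule Lim_null_comparison[rotated])
    show "\<forall>\<^sub>F n in sequentially. norm (dist (Z n) z) \<le> ?e n * (1 + 2 * norm u)"
      using less_imp_le[OF ZJ(1)] by (intro always_eventually allI) (simp only: real_norm_def abs_of_nonneg[OF zero_le_dist])
  qed
  then have "Z \<longlonglongrightarrow> z" by (rule tendsto_dist_iff[THEN iffD2])
  then show ?thesis using that ZJ by blast
qed

lemma gradient_eqI:
  assumes "GDERIV f z :> D"
  shows "gradient f z = D"
  unfolding gradient_def
proof (rule the_equality[of "\<lambda>D. GDERIV f z :> D", OF assms])
  fix E assume "GDERIV f z :> E"
  with assms have "(\<lambda>h. h \<bullet> E) = (\<lambda>h. h \<bullet> D)"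
    unfolding gderiv_def using has_derivative_unique by blast
  then show "E = D" by (metis inner_commute vector_eq_rdot)
qed

lemma clarke_subdiff_local:
  assumes U: "open U" "z \<in> U" and eq: "\<And>x. x \<in> U \<Longrightarrow> f x = f' x"
  shows "clarke_subdiff f z \<subseteq> clarke_subdiff f' z"
  unfolding clarke_subdiff_def
proof (rule hull_mono, clarify)
  fix \<xi> Z D assume Z: "Z \<longlonglongrightarrow> z" "D \<longlonglongrightarrow> \<xi>" and G: "\<forall>k. GDERIV f (Z k) :> D k"
  have "\<forall>\<^sub>F k in sequentially. Z k \<in> U" using topological_tendstoD[OF Z(1) U] .
  then obtain N where N: "\<And>k. k \<ge> N \<Longrightarrow> Z k \<in> U" by (auto simp: eventually_sequentially)
  have "GDERIV f' (Z (k + N)) :> D (k + N)" for k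
    using G has_derivative_transform_within_open[OF _ U(1) N[of "k + N"] eq]
    unfolding gderiv_def by auto
  then show "\<exists>Z D. Z \<longlonglongrightarrow> z \<and> D \<longlonglongrightarrow> \<xi> \<and> (\<forall>k. GDERIV f' (Z k) :> D k)"
    using LIMSEQ_ignore_initial_segment[OF Z(1), of N] LIMSEQ_ignore_initial_segment[OF Z(2), of N]
    by blast
qed

text \<open>Otherwise derivatives at points tending to \<open>z\<close> stay above the bound, and by compactness
  a subsequence of them converges to an element of the subdifferential. A factor \<open>s\<close> of either sign covers upper
  and lower bounds.\<close>

lemma eventually_slope_le_clarke:
  fixes f :: "real \<Rightarrow> real"
  assumes lip: "L-lipschitz_on UNIV f" and bd: "\<And>\<xi>. \<xi> \<in> clarke_subdiff f z \<Longrightarrow> s * \<xi> \<le> K"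
    and e: "e > 0"
  shows "\<forall>\<^sub>F t in at 0. s * diff_quot f 1 z t \<le> K + e"
proof (rule ccontr)
  assume "\<not> ?thesis"
  then have fr: "\<exists>\<^sub>F t in at 0. K + e < diff_quot (\<lambda>x. s \<bullet> f x) 1 z t"
    by (simp add: not_eventually not_le diff_quot_def right_diff_distrib)
  obtain Z J where ZJ: "Z \<longlonglongrightarrow> z" "\<And>n. (f has_derivative J n) (at (Z n))" "\<And>n. K + e / 2 < s \<bullet> J n 1"
    using derivatives_above_slope[OF lip _ fr, of "K + e / 2"] e by auto
  have J: "J n = (*) (J n 1)" for n
    using has_derivative_linear[OF ZJ(2)[of n]] by (metis real_linearD mult.right_neutral)
  have G: "GDERIV f (Z n) :> J n 1" for n
    using ZJ(2)[of n] by (subst (asm) J) (simp add: has_field_derivative_def)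
  have "\<bar>J n 1\<bar> \<le> L" for n
    using abs_inner_derivative_le[OF lip ZJ(2)[of n], of 1 1] by simp
  then have "bounded (range (\<lambda>n. J n 1))" by (auto simp: bounded_iff)
  then obtain \<xi> r where r: "strict_mono r" "((\<lambda>n. J n 1) \<circ> r) \<longlonglongrightarrow> \<xi>"
    using bounded_imp_convergent_subsequence by metis
  have "(Z \<circ> r) \<longlonglongrightarrow> z" using LIMSEQ_subseq_LIMSEQ[OF ZJ(1) r(1)] .
  then have "\<xi> \<in> clarke_subdiff f z"
    unfolding clarke_subdiff_def using r(2) G by (intro hull_inc) (auto simp: comp_def)
  then have "s * \<xi> \<le> K" by (rule bd)
  moreover have "K + e / 2 \<le> s * \<xi>"
    by (rule tendsto_lowerbound[OF tendsto_mult_left[OF r(2)]])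
      (use ZJ(3) in \<open>auto intro!: always_eventually simp: less_imp_le\<close>)
  ultimately show False using e by simp
qed

text \<open>The set whose convex hull is Clarke's generalized Jacobian.\<close>

definition limiting_jacobians :: "(real^'n \<Rightarrow> real^'n) \<Rightarrow> real^'n \<Rightarrow> (real^'n^'n) set" where
  "limiting_jacobians G z = {H. \<exists>Z J. Z \<longlonglongrightarrow> z \<and> J \<longlonglongrightarrow> H \<and>
     (\<forall>k. (G has_derivative (\<lambda>v. J k *v v)) (at (Z k)))}"

lemma eventually_slope_le_jacobian:
  fixes G :: "real^'n \<Rightarrow> real^'n"
  assumes lip: "L-lipschitz_on UNIV G"
    and bd: "\<And>H. H \<in> limiting_jacobians G z \<Longrightarrow> s * H $ i $ i \<le> K" and e: "e > 0"
  shows "\<forall>\<^sub>F t in at 0. s * diff_quot (\<lambda>x. G x $ i) (axis i 1) z t \<le> K + e"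
proof (rule ccontr)
  let ?w = "s *\<^sub>R axis i 1 :: real^'n"
  assume "\<not> ?thesis"
  then have fr: "\<exists>\<^sub>F t in at 0. K + e < diff_quot (\<lambda>x. ?w \<bullet> G x) (axis i 1) z t"
    by (simp add: not_eventually not_le diff_quot_def right_diff_distrib inner_axis')
  obtain Z J where ZJ: "Z \<longlonglongrightarrow> z" "\<And>n. (G has_derivative J n) (at (Z n))"
    "\<And>n. K + e / 2 < ?w \<bullet> J n (axis i 1)"
    using derivatives_above_slope[OF lip _ fr, of "K + e / 2"] e by auto
  define A where "A n = matrix (J n)" for n
  have J: "J n = (\<lambda>v. A n *v v)" for n
    using has_derivative_linear[OF ZJ(2)[of n]] by (simp add: A_def fun_eq_iff matrix_vector_mul)
  have entry: "A n $ p $ q = J n (axis q 1) $ p" for n p q by (simp add: A_def matrix_def)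
  have L0: "L \<ge> 0" using lip lipschitz_on_nonneg by blast
  have ent: "\<bar>A n $ p $ q\<bar> \<le> L" for n p q
    using abs_inner_derivative_le[OF lip ZJ(2)[of n], of "axis p 1" "axis q 1"]
    by (simp add: entry inner_axis')
  have "norm (A n) \<le> (\<Sum>p\<in>(UNIV::'n set). \<Sum>q\<in>(UNIV::'n set). L)" for n
  proof -
    have "norm (A n) \<le> (\<Sum>p\<in>UNIV. norm (A n $ p))"
      unfolding norm_vec_def by (rule L2_set_le_sum) simp
    also have "\<dots> \<le> (\<Sum>p\<in>UNIV. \<Sum>q\<in>UNIV. \<bar>A n $ p $ q\<bar>)" by (intro sum_mono norm_le_l1_cart)
    also have "\<dots> \<le> (\<Sum>p\<in>(UNIV::'n set). \<Sum>q\<in>(UNIV::'n set). L)" by (intro sum_mono ent)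
    finally show ?thesis .
  qed
  then have "bounded (range A)" by (auto simp: bounded_iff)
  then obtain H r where r: "strict_mono r" "(A \<circ> r) \<longlonglongrightarrow> H"
    using bounded_imp_convergent_subsequence by metis
  have "(Z \<circ> r) \<longlonglongrightarrow> z" using LIMSEQ_subseq_LIMSEQ[OF ZJ(1) r(1)] .
  moreover have "\<forall>k. (G has_derivative (\<lambda>v. (A \<circ> r) k *v v)) (at ((Z \<circ> r) k))"
    using ZJ(2) J by simp
  ultimately have "H \<in> limiting_jacobians G z"
    unfolding limiting_jacobians_def using r(2) by blast
  then have "s * H $ i $ i \<le> K" by (rule bd)
  moreover have "(\<lambda>n. s * (A \<circ> r) n $ i $ i) \<longlonglongrightarrow> s * H $ i $ i"
    by (intro tendsto_intros r(2))
  then have "K + e / 2 \<le> s * H $ i $ i"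
    by (rule tendsto_lowerbound)
      (use ZJ(3) in \<open>auto intro!: always_eventually simp: less_imp_le entry inner_axis'\<close>)
  ultimately show False using e by simp
qed

text \<open>A bound \<open>K\<close> on the absolute values of generalized derivatives bounds slopes of both signs. Adding the
  two bounds gives \<open>0 \<le> K\<close> without exhibiting a generalized derivative.\<close>

lemma nonneg_of_eventually_abs_le:
  fixes g :: "real \<Rightarrow> real"
  assumes "\<And>s e. s \<in> {-1, 1} \<Longrightarrow> e > 0 \<Longrightarrow> \<forall>\<^sub>F t in at 0. s * g t \<le> K + e"
  shows "0 \<le> K"
proof (rule field_le_epsilon)
  fix e :: real assume e: "0 < e"
  have "\<forall>\<^sub>F t in at 0. 1 * g t \<le> K + e" "\<forall>\<^sub>F t in at 0. -1 * g t \<le> K + e"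
    using assms e by blast+
  then have "\<forall>\<^sub>F t in at (0::real). 0 \<le> K + e" by eventually_elim linarith
  then show "0 \<le> K + e" by simp
qed

section \<open>The relaxed step function\<close>

locale relaxation_kernel =
  fixes \<rho> :: "real \<Rightarrow> real" and \<alpha> \<rho>_bar \<mu> :: real
  assumes alpha: "\<alpha> > 0" and density: "density_on \<alpha> \<rho>" and mu_pos: "\<mu> > 0"
    and rho_lip: "\<exists>L. L-lipschitz_on {0<..} \<rho>"
    and rho_bar_pos: "\<rho>_bar > 0" and rho_bar: "\<And>s. s \<in> {0<..<\<alpha>} \<Longrightarrow> \<rho> s \<le> \<rho>_bar"
begin

definition cdf :: "real \<Rightarrow> real" where "cdf s = integral {..s} \<rho>"

lemma relax_eq_cdf: "relax \<rho> t \<mu> = cdf (t / \<mu>)"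
  by (simp add: relax_def cdf_def)

lemma rho_nonneg: "0 \<le> \<rho> s" and rho_outside: "s \<notin> {0..\<alpha>} \<Longrightarrow> \<rho> s = 0"
  and rho_integral: "(\<rho> has_integral 1) UNIV"
  using density by (auto simp: density_on_def)

lemma rho_cont_pos: "continuous_on {0<..} \<rho>"
  using rho_lip lipschitz_on_continuous_on by blast

lemma rho_isCont: "s \<noteq> 0 \<Longrightarrow> isCont \<rho> s"
proof (cases "s > 0")
  case True
  then show ?thesis using rho_cont_pos continuous_on_interior[of "{0<..}" \<rho> s]
    by (simp add: interior_open)
next
  case False
  assume "s \<noteq> 0"
  with False have "s < 0" by simp
  have "continuous_on {..<0} \<rho> \<longleftrightarrow> continuous_on {..<0} (\<lambda>_::real. 0 :: real)"
    by (rule continuous_on_cong) (auto intro: rho_outside)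
  then have "continuous_on {..<0} \<rho>" by simp
  then show ?thesis using \<open>s < 0\<close> continuous_on_interior[of "{..<0}" \<rho> s]
    by (simp add: interior_open)
qed

text \<open>Continuity forces the density to vanish at the right end of its support.\<close>

lemma rho_ge_alpha: "\<alpha> \<le> s \<Longrightarrow> \<rho> s = 0"
proof (cases "s = \<alpha>")
  case True
  have "(\<rho> \<longlongrightarrow> \<rho> \<alpha>) (at_right \<alpha>)"
    using rho_isCont[of \<alpha>] alpha by (simp add: isCont_def filterlim_at_split)
  moreover have "\<forall>\<^sub>F s in at_right \<alpha>. \<rho> s = 0"
    unfolding eventually_at_filter by (intro always_eventually allI impI rho_outside) simp
  then have "(\<rho> \<longlongrightarrow> 0) (at_right \<alpha>)" by (rule tendsto_eventually)
  ultimately show ?thesis using tendsto_unique[OF trivial_limit_at_right_real] True by blast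
qed (auto intro: rho_outside)

lemma rho_le_bar: "s \<noteq> 0 \<Longrightarrow> \<rho> s \<le> \<rho>_bar"
proof (cases "s \<in> {0<..<\<alpha>}")
  case False
  assume "s \<noteq> 0"
  with False have "\<rho> s = 0" using rho_ge_alpha[of s] rho_outside[of s] by (cases "s < 0") auto
  then show ?thesis using rho_bar_pos by simp
qed (rule rho_bar)

lemma rho_integrable: "S \<in> sets lebesgue \<Longrightarrow> \<rho> integrable_on S"
proof -
  assume S: "S \<in> sets lebesgue"
  have "\<rho> absolutely_integrable_on UNIV"
    using rho_integral rho_nonneg by (intro nonnegative_absolutely_integrable_1) auto
  then have "\<rho> absolutely_integrable_on S"
    by (rule set_integrable_subset) (use S in auto)
  then show ?thesis by (rule set_lebesgue_integral_eq_integral(1))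
qed

lemma cdf_mono: "s \<le> t \<Longrightarrow> cdf s \<le> cdf t"
  unfolding cdf_def by (intro integral_subset_le rho_integrable) (auto intro: rho_nonneg)

lemma cdf_le_1: "cdf s \<le> 1"
proof -
  have "cdf s \<le> integral UNIV \<rho>"
    unfolding cdf_def by (intro integral_subset_le rho_integrable) (auto intro: rho_nonneg)
  then show ?thesis using rho_integral by (simp add: integral_unique)
qed

lemma cdf_nonpos: "s \<le> 0 \<Longrightarrow> cdf s = 0"
proof -
  assume "s \<le> 0"
  have "(\<rho> has_integral 0) {..s}"
    by (rule has_integral_spike_eq[of "{0}" "{..s}" \<rho> "\<lambda>_. 0", THEN iffD1])
      (use \<open>s \<le> 0\<close> rho_outside in auto)
  then show ?thesis by (simp add: cdf_def integral_unique)
qed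

lemma cdf_ge_alpha: "\<alpha> \<le> s \<Longrightarrow> cdf s = 1"
proof -
  assume "\<alpha> \<le> s"
  then have "(\<lambda>x. if x \<in> {..s} then \<rho> x else 0) = \<rho>" using rho_outside by (auto simp: fun_eq_iff)
  then have "integral {..s} \<rho> = integral UNIV \<rho>" by (metis integral_restrict_UNIV)
  then show ?thesis using rho_integral by (simp add: cdf_def integral_unique)
qed

lemma cdf_split: "a \<le> b \<Longrightarrow> cdf b = cdf a + integral {a..b} \<rho>"
proof -
  assume "a \<le> b"
  then have eq: "{..b} = {..a} \<union> {a..b}" and int: "{..a} \<inter> {a..b} = {a}" by auto
  show ?thesis unfolding cdf_def eq
    by (rule integral_Un) (simp_all only: int negligible_sing rho_integrable lmeasurable_iff_integrable
      sets_completionI_sets sets_lborel borel_closed closed_atMost closed_atLeastAtMost)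
qed

lemma cdf_lipschitz: "\<rho>_bar-lipschitz_on UNIV cdf"
proof -
  have up: "cdf b - cdf a \<le> \<rho>_bar * (b - a)" if "a \<le> b" for a b
  proof -
    have "integral {a..b} \<rho> = integral {a..b} (\<lambda>x. if x = 0 then 0 else \<rho> x)"
      by (rule integral_spike[of "{0}"]) auto
    also have "\<dots> \<le> integral {a..b} (\<lambda>x. \<rho>_bar)"
    proof (rule integral_le)
      show "(\<lambda>x. if x = 0 then 0 else \<rho> x) integrable_on {a..b}"
        by (rule integrable_spike[of \<rho> _ "{0}"]) (auto intro: rho_integrable)
    qed (use rho_le_bar rho_bar_pos in auto)
    finally show ?thesis using cdf_split[OF that] that by (simp add: mult.commute)
  qed
  show ?thesis
  proof (rule lipschitz_onI)
    fix x y
    show "dist (cdf x) (cdf y) \<le> \<rho>_bar * dist x y"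
      using up[of x y] up[of y x] cdf_mono[of x y] cdf_mono[of y x]
      by (cases "x \<le> y") (auto simp: dist_real_def)
  qed (use rho_bar_pos in simp)
qed

lemma cdf_deriv: "s \<noteq> 0 \<Longrightarrow> DERIV cdf s :> \<rho> s"
proof (cases "s > 0")
  case True
  let ?a = "s / 2" and ?b = "s + 1"
  have "continuous_on {?a..?b} \<rho>"
    by (rule continuous_on_subset[OF rho_cont_pos]) (use True in auto)
  then have "((\<lambda>x. integral {?a..x} \<rho>) has_real_derivative \<rho> s) (at s within {?a..?b})"
    by (rule integral_has_real_derivative) (use True in auto)
  then have "((\<lambda>x. cdf ?a + integral {?a..x} \<rho>) has_real_derivative 0 + \<rho> s) (at s within {?a..?b})"
    by (intro DERIV_add DERIV_const)
  moreover have "at s within {?a..?b} = at s"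
    by (rule at_within_interior) (use True in simp)
  ultimately have der: "((\<lambda>x. cdf ?a + integral {?a..x} \<rho>) has_real_derivative \<rho> s) (at s)"
    by (simp only: add_0_left)
  have eq: "cdf ?a + integral {?a..x} \<rho> = cdf x" if "x \<in> {?a<..}" for x
    using cdf_split[of ?a x] that by simp
  show ?thesis
    by (rule has_field_derivative_transform_within_open[OF der open_greaterThan[of "s / 2"] _ eq]) (use True in auto)
next
  case False
  assume "s \<noteq> 0"
  with False have s: "s < 0" by simp
  have "DERIV cdf s :> 0"
    by (rule has_field_derivative_transform_within_open[OF DERIV_const[of 0] open_lessThan[of 0]])
      (use s cdf_nonpos in auto)
  then show ?thesis using s rho_outside[of s] by simp
qed

lemma relax_deriv: "t \<noteq> 0 \<Longrightarrow> DERIV (\<lambda>t. relax \<rho> t \<mu>) t :> \<rho> (t / \<mu>) / \<mu>"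
proof -
  assume "t \<noteq> 0"
  then have "DERIV cdf (t / \<mu>) :> \<rho> (t / \<mu>)" using mu_pos by (intro cdf_deriv) simp
  moreover have "DERIV (\<lambda>t. t / \<mu>) t :> 1 / \<mu>" using mu_pos by (auto intro!: derivative_eq_intros)
  ultimately have "DERIV (\<lambda>t. cdf (t / \<mu>)) t :> \<rho> (t / \<mu>) * (1 / \<mu>)" by (rule DERIV_chain2)
  then show ?thesis by (simp add: relax_eq_cdf)
qed

lemma clarke_relax: 
  assumes t: "t \<noteq> 0"
  shows "clarke_subdiff (\<lambda>t. relax \<rho> t \<mu>) t \<subseteq> {\<rho> (t / \<mu>) / \<mu>}"
proof -
  let ?S = "{\<xi>. \<exists>Z D. Z \<longlonglongrightarrow> t \<and> D \<longlonglongrightarrow> \<xi> \<and> (\<forall>k. GDERIV (\<lambda>t. relax \<rho> t \<mu>) (Z k) :> D k)}"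
  have "?S \<subseteq> {\<rho> (t / \<mu>) / \<mu>}"
  proof clarify
    fix \<xi> Z D
    assume Z: "Z \<longlonglongrightarrow> t" "D \<longlonglongrightarrow> \<xi>" and G: "\<forall>k. GDERIV (\<lambda>t. relax \<rho> t \<mu>) (Z k) :> D k"
    have "\<forall>\<^sub>F k in sequentially. Z k \<noteq> 0" using tendsto_imp_eventually_ne[OF Z(1) t] .
    then have ev: "\<forall>\<^sub>F k in sequentially. \<rho> (Z k / \<mu>) / \<mu> = D k"
    proof eventually_elim
      fix k assume "Z k \<noteq> 0"
      moreover have "DERIV (\<lambda>t. relax \<rho> t \<mu>) (Z k) :> D k" using G by (simp only: gderiv_deriv)
      ultimately show "\<rho> (Z k / \<mu>) / \<mu> = D k" using DERIV_unique[OF relax_deriv] by blast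
    qed
    have "isCont \<rho> (t / \<mu>)" using t mu_pos by (intro rho_isCont) simp
    then have "(\<lambda>k. \<rho> (Z k / \<mu>) / \<mu>) \<longlonglongrightarrow> \<rho> (t / \<mu>) / \<mu>"
      using mu_pos Z(1)
      by (intro tendsto_divide[OF isCont_tendsto_compose[of "t / \<mu>" \<rho>] tendsto_const] tendsto_divide[OF _ tendsto_const]) simp_all
    then have "D \<longlonglongrightarrow> \<rho> (t / \<mu>) / \<mu>" using ev by (rule Lim_transform_eventually)
    then show "\<xi> = \<rho> (t / \<mu>) / \<mu>" using Z(2) LIMSEQ_unique by blast
  qed
  then show ?thesis unfolding clarke_subdiff_def
    by (intro hull_minimal convex_singleton)
qed

text \<open>The density may jump at \<open>0\<close>, so the subdifferential there need not be a singleton; monotonicity of the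
  relaxation still determines the sign.\<close>

lemma clarke_relax_nonneg: 
  assumes "a \<in> clarke_subdiff (\<lambda>t. relax \<rho> t \<mu>) t"
  shows "0 \<le> a"
proof -
  have mono: "mono (\<lambda>t. relax \<rho> t \<mu>)"
    unfolding relax_eq_cdf using mu_pos by (intro monoI cdf_mono divide_right_mono) auto
  let ?S = "{\<xi>. \<exists>Z D. Z \<longlonglongrightarrow> t \<and> D \<longlonglongrightarrow> \<xi> \<and> (\<forall>k. GDERIV (\<lambda>t. relax \<rho> t \<mu>) (Z k) :> D k)}"
  have "?S \<subseteq> {0..}"
  proof clarify
    fix \<xi> Z D
    assume Z: "D \<longlonglongrightarrow> \<xi>" and G: "\<forall>k. GDERIV (\<lambda>t. relax \<rho> t \<mu>) (Z k) :> D k"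
    have "0 \<le> D k" for k
    proof (rule mono_on_imp_deriv_nonneg[of UNIV])
      show "DERIV (\<lambda>t. relax \<rho> t \<mu>) (Z k) :> D k" using G by (simp only: gderiv_deriv)
    qed (use mono in simp_all)
    then show "0 \<le> \<xi>" using LIMSEQ_le_const[OF Z] by auto
  qed
  then have "clarke_subdiff (\<lambda>t. relax \<rho> t \<mu>) t \<subseteq> {0..}"
    unfolding clarke_subdiff_def by (intro hull_minimal convex_real_interval)
  then show ?thesis using assms by auto
qed

lemma relax_le_pos_pow0: "relax \<rho> t \<mu> \<le> pos_pow0 t"
  using cdf_le_1[of "t / \<mu>"] cdf_nonpos[of "t / \<mu>"] mu_pos
  by (auto simp: relax_eq_cdf pos_pow0_def divide_le_0_iff)

lemma relax_eq_pos_pow0: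
  assumes "t \<notin> {0<..<\<alpha> * \<mu>}"
  shows "relax \<rho> t \<mu> = pos_pow0 t"
proof (cases "t > 0")
  case True
  then have "\<alpha> \<le> t / \<mu>" using assms mu_pos by (simp add: field_simps)
  then show ?thesis using True cdf_ge_alpha by (simp add: relax_eq_cdf pos_pow0_def)
qed (use mu_pos in \<open>simp add: relax_eq_cdf pos_pow0_def cdf_nonpos divide_le_0_iff\<close>)

lemma continuous_relax: "continuous_on S (\<lambda>t. relax \<rho> t \<mu>)"
  unfolding relax_eq_cdf
  by (rule continuous_on_compose2[OF lipschitz_on_continuous_on[OF cdf_lipschitz]])
    (use mu_pos in \<open>auto intro!: continuous_intros\<close>)

text \<open>The density is Lipschitz on the positive half-line only. Freezing it below \<open>s / 2\<close> makes it globally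
  Lipschitz without changing its subdifferential at \<open>s\<close>.\<close>

lemma eventually_slope_le_clarke_rho:
  assumes s: "s > 0" and bd: "\<And>a. a \<in> clarke_subdiff \<rho> s \<Longrightarrow> a \<le> K" and e: "e > 0"
  shows "\<forall>\<^sub>F t in at 0. diff_quot \<rho> 1 s t \<le> K + e"
proof -
  obtain L where L: "L-lipschitz_on {0<..} \<rho>" using rho_lip by blast
  define \<rho>' where "\<rho>' x = \<rho> (max x (s / 2))" for x
  have lip: "L-lipschitz_on UNIV \<rho>'"
  proof (rule lipschitz_onI)
    fix x y :: real
    have "dist (\<rho>' x) (\<rho>' y) \<le> L * dist (max x (s / 2)) (max y (s / 2))"
      unfolding \<rho>'_def using s by (intro lipschitz_onD[OF L]) auto
    also have "\<dots> \<le> L * dist x y"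
      using lipschitz_on_nonneg[OF L] by (intro mult_left_mono) (auto simp: dist_real_def max_def)
    finally show "dist (\<rho>' x) (\<rho>' y) \<le> L * dist x y" .
  qed (use lipschitz_on_nonneg[OF L] in simp)
  have eq: "\<rho>' x = \<rho> x" if "x \<in> {s / 2<..}" for x using that by (simp add: \<rho>'_def max_def)
  have sub: "clarke_subdiff \<rho>' s \<subseteq> clarke_subdiff \<rho> s"
    by (rule clarke_subdiff_local[of "{s / 2<..}"]) (use s eq in auto)
  have "\<forall>\<^sub>F t in at 0. 1 * diff_quot \<rho>' 1 s t \<le> K + e"
    by (rule eventually_slope_le_clarke[OF lip _ e]) (use sub bd in auto)
  moreover have "\<forall>\<^sub>F t in at 0. \<bar>t\<bar> < s / 2"
    unfolding eventually_at using s by (intro exI[of _ "s / 2"]) (simp add: dist_real_def)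
  ultimately show ?thesis
  proof eventually_elim
    fix t assume "1 * diff_quot \<rho>' 1 s t \<le> K + e" "\<bar>t\<bar> < s / 2"
    moreover have "\<rho>' (s + t) = \<rho> (s + t)" "\<rho>' s = \<rho> s" using calculation(2) s by (auto intro!: eq)
    ultimately show "diff_quot \<rho> 1 s t \<le> K + e" by (simp add: diff_quot_def)
  qed
qed

end

section \<open>Penalised convex functions on a box\<close>

definition penalised ::
  "(real^'n \<Rightarrow> real) \<Rightarrow> ('n + 'n \<Rightarrow> real \<Rightarrow> real) \<Rightarrow> real \<Rightarrow> (real \<Rightarrow> real) \<Rightarrow> real^'n \<Rightarrow> real" where
  "penalised \<phi> w lam p x = \<phi> x + lam * (\<Sum>i\<in>UNIV. p (w (Inl i) (x $ i)) + p (w (Inr i) (x $ i)))"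

lemma lipschitz_cont_diff_realD:
  fixes f :: "real \<Rightarrow> real"
  assumes "lipschitz_cont_diff f"
  shows "DERIV f t :> deriv f t" and "\<exists>L. L-lipschitz_on UNIV (deriv f)"
proof -
  obtain D where D: "\<And>z. GDERIV f z :> D z" using assms unfolding lipschitz_cont_diff_def by metis
  have "gradient f = D" using gradient_eqI[OF D] by blast
  moreover have d: "deriv f = D" using D by (intro ext DERIV_imp_deriv) (simp only: gderiv_deriv)
  ultimately show "\<exists>L. L-lipschitz_on UNIV (deriv f)"
    using assms by (simp add: lipschitz_cont_diff_def lipschitz_continuous_def)
  show "DERIV f t :> deriv f t" using D by (simp only: d gderiv_deriv)
qed

lemma not_local_min_of_negative_slope:
  fixes f f' :: "real \<Rightarrow> real"
  assumes der: "\<forall>\<^sub>F t in nhds 0. DERIV f t :> f' t" and neg: "\<forall>\<^sub>F t in at 0. f' t / t < 0"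
    and min: "\<forall>\<^sub>F t in at 0. f 0 \<le> f t"
  shows False
proof -
  obtain d1 where d1: "d1 > 0" "\<And>t. \<bar>t\<bar> < d1 \<Longrightarrow> DERIV f t :> f' t"
    using der by (auto simp: eventually_nhds_metric dist_real_def)
  have "\<forall>\<^sub>F t in at 0. f' t / t < 0 \<and> f 0 \<le> f t" using neg min by eventually_elim simp
  then obtain d2 where d2: "d2 > 0" "\<And>t. t \<noteq> 0 \<Longrightarrow> \<bar>t\<bar> < d2 \<Longrightarrow> f' t / t < 0 \<and> f 0 \<le> f t"
    unfolding eventually_at by (auto simp: dist_real_def)
  define b where "b = min d1 d2 / 2"
  have b: "0 < b" "b < d1" "b < d2" using d1(1) d2(1) by (auto simp: b_def)
  have "DERIV f t :> f' t" if "0 \<le> t" "t \<le> b" for t using that b by (intro d1(2)) auto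
  from MVT2[OF b(1) this] obtain z where z: "0 < z" "z < b" "f b - f 0 = (b - 0) * f' z" by blast
  have "f' z < 0" using d2(2)[of z] z b by (simp add: divide_less_0_iff)
  then have "f b < f 0" using z(3) b(1) mult_pos_neg[of b "f' z"] by simp
  then show False using d2(2)[of b] b by simp
qed

lemma sum_coordinate_update:
  fixes x :: "real^'n" and P :: "'n \<Rightarrow> real \<Rightarrow> real"
  shows "(\<Sum>j\<in>UNIV. P j ((x + t *\<^sub>R axis i 1) $ j)) = (\<Sum>j\<in>UNIV. P j (x $ j)) - P i (x $ i) + P i (x $ i + t)"
proof -
  have "(\<Sum>j\<in>UNIV - {i}. P j ((x + t *\<^sub>R axis i 1) $ j)) = (\<Sum>j\<in>UNIV - {i}. P j (x $ j))"
    by (intro sum.cong) (auto simp: axis_def)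
  then show ?thesis
    by (simp add: sum.remove[of UNIV i] axis_def)
qed

text \<open>The box allows moves of both signs in an interior coordinate.\<close>

lemma normal_cone_interior_coordinate:
  fixes x l u :: "real^'n"
  assumes v: "v \<in> normal_cone (cbox l u) x" and i: "l $ i < x $ i" "x $ i < u $ i"
  shows "v $ i = 0"
proof -
  have x: "x \<in> cbox l u" and N: "\<And>z. z \<in> cbox l u \<Longrightarrow> v \<bullet> (z - x) \<le> 0"
    using v by (auto simp: normal_cone_def)
  define t where "t = min (x $ i - l $ i) (u $ i - x $ i)"
  have t: "t > 0" using i by (simp add: t_def)
  have "s * v $ i \<le> 0" if "\<bar>s\<bar> \<le> t" for s
  proof -
    have "x + s *\<^sub>R axis i 1 \<in> cbox l u"
      using x that by (auto simp: mem_box_cart axis_def t_def)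
    from N[OF this] show ?thesis by (simp add: inner_axis)
  qed
  from this[of t] this[of "- t"] t show ?thesis by (simp add: mult_le_0_iff zero_le_mult_iff)
qed

text \<open>The Hessian bound is imposed on limiting Jacobians of a given gradient field, so that a bound for
  \<open>c x\<close> transfers to its negative by a change of sign. The last two assumptions are fractions in the threshold for
  \<open>\<mu>\<close>, cleared of denominators; in the second one, clearing is legitimate because \<open>Lc2\<close> and \<open>Lw2\<close> are
  nonnegative.\<close>

locale penalised_box = relaxation_kernel \<rho> \<alpha> \<rho>_bar \<mu>
  for \<rho> :: "real \<Rightarrow> real" and \<alpha> \<rho>_bar \<mu> :: real +
  fixes \<phi> :: "real^'n \<Rightarrow> real" and D\<phi> :: "real^'n \<Rightarrow> real^'n"
    and w :: "'n + 'n \<Rightarrow> real \<Rightarrow> real" and lam :: real and l u :: "real^'n"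
    and \<tau> \<sigma> \<rho>_low \<rho>_check Lc1 Lc2 Lw2 :: real
  assumes grad: "\<And>x. GDERIV \<phi> x :> D\<phi> x" and grad_lip: "\<exists>L. L-lipschitz_on UNIV D\<phi>"
    and convex: "convex_on UNIV \<phi>"
    and w_smooth: "\<And>k. lipschitz_cont_diff (w k)"
    and lam: "lam > 0" and tau: "\<tau> > 0" and sigma: "\<sigma> > 0"
    and struct: "structural_condition \<tau> \<sigma> l u w"
    and cond_D: "density_condition \<alpha> \<rho> \<rho>_low \<rho>_check"
    and Lc1: "\<And>x i. x \<in> cbox l u \<Longrightarrow> \<bar>D\<phi> x $ i\<bar> \<le> Lc1"
    and Lc2: "\<And>x i H. x \<in> cbox l u \<Longrightarrow> H \<in> limiting_jacobians D\<phi> x \<Longrightarrow> \<bar>H $ i $ i\<bar> \<le> Lc2"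
    and Lw2: "\<And>i k t \<xi>. k \<in> {Inl i, Inr i} \<Longrightarrow> t \<in> {l $ i..u $ i} \<Longrightarrow>
      \<xi> \<in> gen_second_deriv (w k) t \<Longrightarrow> \<bar>\<xi>\<bar> \<le> Lw2"
    and mu_tau: "\<alpha> * \<mu> < \<tau>"
    and mu_first: "\<mu> * Lc1 < lam * \<sigma> * \<rho>_low"
    and mu_second: "0 \<le> Lc2 \<Longrightarrow> 0 \<le> Lw2 \<Longrightarrow>
      \<mu> * (\<tau> * Lc2 / \<alpha> + lam * \<rho>_bar * Lw2) < lam * \<rho>_check * \<sigma>\<^sup>2"
begin

abbreviation R :: "real \<Rightarrow> real" where "R t \<equiv> relax \<rho> t \<mu>"

lemma w_deriv: "DERIV (w k) t :> deriv (w k) t"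
  and w_deriv_lip: "\<exists>L. L-lipschitz_on UNIV (deriv (w k))"
  using lipschitz_cont_diff_realD[OF w_smooth] by auto

lemma w_isCont: "isCont (w k) t"
  using w_deriv by (rule DERIV_isCont)

lemma rho_low_pos: "\<rho>_low > 0" and rho_check_pos: "\<rho>_check > 0"
  using cond_D by (auto simp: density_condition_def)

lemma density_cases:
  assumes "s \<in> {0<..<\<alpha>}"
  obtains "\<rho>_low \<le> \<rho> s" | "\<And>a. a \<in> clarke_subdiff \<rho> s \<Longrightarrow> a \<le> - \<rho>_check"
proof -
  have "\<rho>_low \<le> \<rho> s \<or> (SUP a\<in>clarke_subdiff \<rho> s. ereal a) \<le> ereal (- \<rho>_check)"
    using cond_D assms by (auto simp: density_condition_def)
  then show ?thesis
  proof
    assume "(SUP a\<in>clarke_subdiff \<rho> s. ereal a) \<le> ereal (- \<rho>_check)"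
    then have "\<forall>a\<in>clarke_subdiff \<rho> s. ereal a \<le> ereal (- \<rho>_check)" by (simp only: SUP_le_iff)
    then show ?thesis using that(2) by simp
  qed (rule that(1))
qed

lemma active_structure:
  assumes "x \<in> cbox l u" "k \<in> {Inl i, Inr i}" "w k (x $ i) \<in> {0<..<\<tau>}"
  shows "l $ i < x $ i" "x $ i < u $ i" "\<sigma> \<le> \<bar>deriv (w k) (x $ i)\<bar>"
    and "\<And>k'. k' \<in> {Inl i, Inr i} \<Longrightarrow> k' \<noteq> k \<Longrightarrow> w k' (x $ i) \<notin> {0..\<tau>}"
proof -
  have A: "\<forall>(k, k') \<in> {(Inl i, Inr i), (Inr i, Inl i)}. w k (x $ i) \<in> {0<..<\<tau>} \<longrightarrow>
      x $ i \<in> interior {l $ i..u $ i} \<and> w k' (x $ i) \<notin> {0..\<tau>} \<and> \<sigma> \<le> \<bar>deriv (w k) (x $ i)\<bar>"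
    using struct assms(1) unfolding structural_condition_def by blast
  then have "x $ i \<in> interior {l $ i..u $ i}" "\<sigma> \<le> \<bar>deriv (w k) (x $ i)\<bar>"
    using assms(2,3) by auto
  then show "l $ i < x $ i" "x $ i < u $ i" "\<sigma> \<le> \<bar>deriv (w k) (x $ i)\<bar>"
    by (auto simp: interior_atLeastAtMost_real)
  show "w k' (x $ i) \<notin> {0..\<tau>}" if "k' \<in> {Inl i, Inr i}" "k' \<noteq> k" for k'
    using A assms(2,3) that by auto
qed

text \<open>The curvature threshold \<open>mu_second\<close> divided by \<open>\<mu>\<^sup>2\<close>, once \<open>\<mu> < \<tau> / \<alpha>\<close> is used to turn
  \<open>\<mu>\<^sup>2 Lc2\<close> into \<open>\<mu> \<tau> Lc2 / \<alpha>\<close>.\<close>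

lemma curvature_negative:
  assumes "0 \<le> Lc2" "0 \<le> Lw2" "\<sigma> \<le> \<bar>d\<bar>"
  shows "Lc2 + lam * (- \<rho>_check / \<mu>\<^sup>2 * d\<^sup>2 + \<rho>_bar / \<mu> * Lw2) < 0"
proof -
  have "\<mu> * \<alpha> \<le> \<tau>" using mu_tau by (simp add: mult.commute)
  then have "\<mu> \<le> \<tau> / \<alpha>" using alpha by (simp add: field_simps)
  then have "\<mu> * (\<mu> * Lc2) \<le> \<mu> * (\<tau> / \<alpha> * Lc2)"
    using assms(1) mu_pos by (intro mult_left_mono mult_right_mono) auto
  then have "\<mu>\<^sup>2 * Lc2 + lam * \<rho>_bar * Lw2 * \<mu> \<le> \<mu> * (\<tau> * Lc2 / \<alpha> + lam * \<rho>_bar * Lw2)"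
    by (simp add: power2_eq_square algebra_simps)
  also have "\<dots> < lam * \<rho>_check * \<sigma>\<^sup>2" using mu_second assms by blast
  also have "\<dots> \<le> lam * \<rho>_check * d\<^sup>2"
    using assms(3) sigma lam rho_check_pos
    by (intro mult_left_mono) (auto simp: power2_le_iff_abs_le abs_le_square_iff[symmetric])
  finally have "\<mu>\<^sup>2 * Lc2 + lam * \<rho>_bar * Lw2 * \<mu> - lam * \<rho>_check * d\<^sup>2 < 0" by simp
  moreover have "\<mu>\<^sup>2 * (Lc2 + lam * (- \<rho>_check / \<mu>\<^sup>2 * d\<^sup>2 + \<rho>_bar / \<mu> * Lw2))
      = \<mu>\<^sup>2 * Lc2 + lam * \<rho>_bar * Lw2 * \<mu> - lam * \<rho>_check * d\<^sup>2"
    using mu_pos by (simp add: field_simps power2_eq_square)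
  ultimately have "\<mu>\<^sup>2 * (Lc2 + lam * (- \<rho>_check / \<mu>\<^sup>2 * d\<^sup>2 + \<rho>_bar / \<mu> * Lw2)) < 0" by simp
  then show ?thesis using mu_pos by (simp add: mult_less_0_iff)
qed

text \<open>The penalty contributes at least \<open>lam \<rho>_low \<sigma> / \<mu>\<close> to the derivative, more than the smooth part can
  cancel.\<close>

lemma dense_not_stationary:
  assumes x: "x \<in> cbox l u" and rho: "\<rho>_low \<le> \<rho> s" and d: "\<sigma> \<le> \<bar>d\<bar>"
  shows "D\<phi> x $ i + lam * (\<rho> s / \<mu> * d) \<noteq> 0"
proof
  assume "D\<phi> x $ i + lam * (\<rho> s / \<mu> * d) = 0"
  then have "D\<phi> x $ i = - (lam * (\<rho> s / \<mu> * d))" by simp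
  then have "\<mu> * \<bar>D\<phi> x $ i\<bar> = lam * \<rho> s * \<bar>d\<bar>"
    using lam mu_pos rho_nonneg[of s] by (simp add: abs_mult)
  moreover have "lam * (\<sigma> * \<rho>_low) \<le> lam * (\<bar>d\<bar> * \<rho> s)"
    using lam sigma rho d rho_low_pos by (intro mult_left_mono mult_mono) auto
  moreover have "\<mu> * \<bar>D\<phi> x $ i\<bar> \<le> \<mu> * Lc1" using Lc1[OF x] mu_pos by simp
  ultimately show False using mu_first by (simp add: mult_ac)
qed

lemma Lc2_nonneg: "x \<in> cbox l u \<Longrightarrow> 0 \<le> Lc2"
  and eventually_hessian_slope: "x \<in> cbox l u \<Longrightarrow> e > 0 \<Longrightarrow>
    \<forall>\<^sub>F t in at 0. diff_quot (\<lambda>x. D\<phi> x $ i) (axis i 1) x t \<le> Lc2 + e"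
proof -
  obtain L where L: "L-lipschitz_on UNIV D\<phi>" using grad_lip by blast
  have ev: "\<forall>\<^sub>F t in at 0. s * diff_quot (\<lambda>x. D\<phi> x $ i) (axis i 1) x t \<le> Lc2 + e"
    if "x \<in> cbox l u" "s \<in> {-1, 1}" "e > 0" for x s e i
  proof (rule eventually_slope_le_jacobian[OF L _ that(3)])
    fix H assume "H \<in> limiting_jacobians D\<phi> x"
    then have "\<bar>H $ i $ i\<bar> \<le> Lc2" by (rule Lc2[OF that(1)])
    then show "s * H $ i $ i \<le> Lc2" using that(2) by auto
  qed
  show "x \<in> cbox l u \<Longrightarrow> 0 \<le> Lc2" by (rule nonneg_of_eventually_abs_le[OF ev])
  show "\<forall>\<^sub>F t in at 0. diff_quot (\<lambda>x. D\<phi> x $ i) (axis i 1) x t \<le> Lc2 + e"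
    if "x \<in> cbox l u" "e > 0" using ev[OF that(1) _ that(2), of 1] by simp
qed

lemma Lw2_nonneg: "k \<in> {Inl i, Inr i} \<Longrightarrow> t \<in> {l $ i..u $ i} \<Longrightarrow> 0 \<le> Lw2"
  and eventually_second_slope: "k \<in> {Inl i, Inr i} \<Longrightarrow> t \<in> {l $ i..u $ i} \<Longrightarrow> e > 0 \<Longrightarrow>
    \<forall>\<^sub>F h in at 0. diff_quot (deriv (w k)) 1 t h \<le> Lw2 + e"
proof -
  have ev: "\<forall>\<^sub>F h in at 0. s * diff_quot (deriv (w k)) 1 t h \<le> Lw2 + e"
    if "k \<in> {Inl i, Inr i}" "t \<in> {l $ i..u $ i}" "s \<in> {-1, 1}" "e > 0" for s e k i t
  proof -
    obtain L where L: "L-lipschitz_on UNIV (deriv (w k))" using w_deriv_lip by blast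
    show ?thesis
    proof (rule eventually_slope_le_clarke[OF L _ that(4)])
      fix \<xi> assume "\<xi> \<in> clarke_subdiff (deriv (w k)) t"
      then have "\<bar>\<xi>\<bar> \<le> Lw2" using Lw2[OF that(1,2)] by (simp add: gen_second_deriv_def)
      then show "s * \<xi> \<le> Lw2" using that(3) by auto
    qed
  qed
  show "k \<in> {Inl i, Inr i} \<Longrightarrow> t \<in> {l $ i..u $ i} \<Longrightarrow> 0 \<le> Lw2"
    by (rule nonneg_of_eventually_abs_le[OF ev])
  show "\<forall>\<^sub>F h in at 0. diff_quot (deriv (w k)) 1 t h \<le> Lw2 + e"
    if "k \<in> {Inl i, Inr i}" "t \<in> {l $ i..u $ i}" "e > 0" using ev[OF that(1,2) _ that(3), of 1] by simp
qed

text \<open>A chain and product rule for upper slopes, at a point where neither factor need be differentiable: the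
  increment of \<open>\<rho>(w / \<mu>) w'\<close> is split into an increment of \<open>\<rho>\<close> times \<open>w'\<close>, whose slope is at most
  \<open>- \<rho>_check\<close> times \<open>w'\<^sup>2 / \<mu>\<close>, and \<open>\<rho>\<close> times an increment of \<open>w'\<close>.\<close>

lemma eventually_relaxed_slope:
  assumes s: "s = w k t / \<mu>" "s > 0" and d: "d = deriv (w k) t" "d \<noteq> 0"
    and k: "k \<in> {Inl i, Inr i}" "t \<in> {l $ i..u $ i}"
    and dec: "\<And>a. a \<in> clarke_subdiff \<rho> s \<Longrightarrow> a \<le> - \<rho>_check" and e: "e > 0"
  shows "\<forall>\<^sub>F h in at 0. (\<rho> (w k (t + h) / \<mu>) / \<mu> * deriv (w k) (t + h) - \<rho> s / \<mu> * d) / h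
    \<le> - \<rho>_check / \<mu>\<^sup>2 * d\<^sup>2 + \<rho>_bar / \<mu> * Lw2 + e"
proof -
  define b where "b h = w k (t + h) / \<mu> - s" for h
  define g where "g h = deriv (w k) (t + h)" for h
  have Lw0: "0 \<le> Lw2" using Lw2_nonneg[OF k] .
  have wd: "((\<lambda>h. (w k (t + h) - w k t) / h) \<longlongrightarrow> d) (at 0)"
    using w_deriv[of k t] by (simp add: DERIV_def d)
  have bq: "((\<lambda>h. b h / h) \<longlongrightarrow> d / \<mu>) (at 0)"
  proof -
    have "((\<lambda>h. (w k (t + h) - w k t) / h / \<mu>) \<longlongrightarrow> d / \<mu>) (at 0)"
      by (rule tendsto_divide[OF wd tendsto_const]) (use mu_pos in simp)
    moreover have "(w k (t + h) - w k t) / h / \<mu> = b h / h" for h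
      by (simp add: b_def s diff_divide_distrib mult.commute)
    ultimately show ?thesis by simp
  qed
  have bne: "\<forall>\<^sub>F h in at 0. b h \<noteq> 0"
  proof -
    have "d / \<mu> \<noteq> 0" using d mu_pos by simp
    from tendsto_imp_eventually_ne[OF bq this] show ?thesis by eventually_elim auto
  qed
  have "isCont (w k) (t + 0)" by (rule w_isCont)
  then have "((\<lambda>h. w k (t + h)) \<longlongrightarrow> w k (t + 0)) (at 0)"
    by (rule isCont_tendsto_compose) (auto intro!: tendsto_eq_intros)
  then have "(b \<longlongrightarrow> w k (t + 0) / \<mu> - s) (at 0)"
    unfolding b_def[abs_def] using mu_pos by (intro tendsto_intros) auto
  then have b0: "filterlim b (at 0) (at 0)" using bne by (simp add: s filterlim_at)
  have contd: "isCont (deriv (w k)) z" for z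
  proof -
    obtain L where "L-lipschitz_on UNIV (deriv (w k))" using w_deriv_lip by blast
    then have "continuous_on UNIV (deriv (w k))" by (rule lipschitz_on_continuous_on)
    then show ?thesis by (simp add: continuous_on_eq_continuous_at)
  qed
  have gl: "(g \<longlongrightarrow> d) (at 0)"
  proof -
    have "((\<lambda>h. deriv (w k) (t + h)) \<longlongrightarrow> deriv (w k) (t + 0)) (at 0)"
      by (rule isCont_tendsto_compose[OF contd]) (auto intro!: tendsto_eq_intros)
    then show ?thesis by (simp add: g_def[abs_def] d)
  qed
  have m: "((\<lambda>h. b h / h * g h) \<longlongrightarrow> d / \<mu> * d) (at 0)" by (intro tendsto_mult bq gl)
  have dm: "d / \<mu> * d > 0" using d(2) mu_pos by (simp add: zero_less_mult_iff zero_less_divide_iff) linarith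
  then have mpos: "\<forall>\<^sub>F h in at 0. 0 < b h / h * g h" using m order_tendstoD(1) by blast
  \<comment> \<open>The tolerance \<open>\<epsilon>\<close> is spent once on the slope of the density and once on the slope of \<open>w'\<close>; this
     choice keeps the total below \<open>e / 2\<close>.\<close>
  define M where "M = d / \<mu> * d + \<rho>_bar + 1"
  have M: "M > 0" using dm rho_bar_pos by (simp add: M_def)
  define \<epsilon> where "\<epsilon> = e * \<mu> / M / 2"
  have eps: "\<epsilon> > 0" using e mu_pos M by (simp add: \<epsilon>_def)
  have r1: "\<forall>\<^sub>F h in at 0. diff_quot \<rho> 1 s (b h) \<le> - \<rho>_check + \<epsilon>"
    using b0 eventually_slope_le_clarke_rho[OF s(2) dec eps] unfolding filterlim_iff by blast
  have r2: "\<forall>\<^sub>F h in at 0. diff_quot (deriv (w k)) 1 t h \<le> Lw2 + \<epsilon>"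
    by (rule eventually_second_slope[OF k eps])
  let ?B = "\<lambda>h. (- \<rho>_check + \<epsilon>) / \<mu> * (b h / h * g h) + \<rho>_bar / \<mu> * (Lw2 + \<epsilon>)"
  have "(?B \<longlongrightarrow> (- \<rho>_check + \<epsilon>) / \<mu> * (d / \<mu> * d) + \<rho>_bar / \<mu> * (Lw2 + \<epsilon>)) (at 0)"
    by (intro tendsto_intros m)
  moreover have "(- \<rho>_check + \<epsilon>) / \<mu> * (d / \<mu> * d) + \<rho>_bar / \<mu> * (Lw2 + \<epsilon>)
      < - \<rho>_check / \<mu>\<^sup>2 * d\<^sup>2 + \<rho>_bar / \<mu> * Lw2 + e"
  proof -
    have "(- \<rho>_check + \<epsilon>) / \<mu> * (d / \<mu> * d) + \<rho>_bar / \<mu> * (Lw2 + \<epsilon>)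
      = - \<rho>_check / \<mu>\<^sup>2 * d\<^sup>2 + \<rho>_bar / \<mu> * Lw2 + \<epsilon> / \<mu> * (d / \<mu> * d + \<rho>_bar)"
      using mu_pos by (simp add: field_simps power2_eq_square)
    also have "\<epsilon> / \<mu> * (d / \<mu> * d + \<rho>_bar) \<le> \<epsilon> / \<mu> * M"
      using eps mu_pos by (intro mult_left_mono) (auto simp: M_def)
    also have "\<epsilon> / \<mu> * M = e / 2" using mu_pos M by (simp add: \<epsilon>_def)
    finally show ?thesis using e by simp
  qed
  ultimately have fin: "\<forall>\<^sub>F h in at 0. ?B h < - \<rho>_check / \<mu>\<^sup>2 * d\<^sup>2 + \<rho>_bar / \<mu> * Lw2 + e"
    using order_tendstoD(2) by blast
  have ne: "\<forall>\<^sub>F h in at (0::real). h \<noteq> 0" by (simp add: eventually_at_filter)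
  from bne r1 r2 mpos fin ne show ?thesis
  proof eventually_elim
    fix h assume h: "b h \<noteq> 0" "diff_quot \<rho> 1 s (b h) \<le> - \<rho>_check + \<epsilon>"
      "diff_quot (deriv (w k)) 1 t h \<le> Lw2 + \<epsilon>" "0 < b h / h * g h"
      "?B h < - \<rho>_check / \<mu>\<^sup>2 * d\<^sup>2 + \<rho>_bar / \<mu> * Lw2 + e" "h \<noteq> 0"
    have sb: "s + b h = w k (t + h) / \<mu>" by (simp add: b_def)
    have "\<rho> (w k (t + h) / \<mu>) / \<mu> * deriv (w k) (t + h) - \<rho> s / \<mu> * d
        = ((\<rho> (s + b h) - \<rho> s) * g h + \<rho> s * (g h - d)) / \<mu>"
      by (simp add: sb g_def diff_divide_distrib add_divide_distrib algebra_simps)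
    also have "\<rho> (s + b h) - \<rho> s = diff_quot \<rho> 1 s (b h) * b h"
      using h(1) by (simp add: diff_quot_def)
    also have "g h - d = diff_quot (deriv (w k)) 1 t h * h"
      using h(6) by (simp add: diff_quot_def g_def d)
    finally have "(\<rho> (w k (t + h) / \<mu>) / \<mu> * deriv (w k) (t + h) - \<rho> s / \<mu> * d) / h
        = diff_quot \<rho> 1 s (b h) / \<mu> * (b h / h * g h) + \<rho> s / \<mu> * diff_quot (deriv (w k)) 1 t h"
      using h(6) mu_pos by (simp add: field_simps)
    also have "\<dots> \<le> ?B h"
    proof (rule add_mono)
      show "diff_quot \<rho> 1 s (b h) / \<mu> * (b h / h * g h) \<le> (- \<rho>_check + \<epsilon>) / \<mu> * (b h / h * g h)"
        using h(2,4) mu_pos by (intro mult_right_mono divide_right_mono) auto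
      have "\<rho> s / \<mu> * diff_quot (deriv (w k)) 1 t h \<le> \<rho> s / \<mu> * (Lw2 + \<epsilon>)"
        using h(3) rho_nonneg[of s] mu_pos by (intro mult_left_mono) auto
      also have "\<dots> \<le> \<rho>_bar / \<mu> * (Lw2 + \<epsilon>)"
        using rho_le_bar[of s] s(2) mu_pos Lw0 eps by (intro mult_right_mono divide_right_mono) auto
      finally show "\<rho> s / \<mu> * diff_quot (deriv (w k)) 1 t h \<le> \<rho>_bar / \<mu> * (Lw2 + \<epsilon>)" .
    qed
    finally show "(\<rho> (w k (t + h) / \<mu>) / \<mu> * deriv (w k) (t + h) - \<rho> s / \<mu> * d) / h
      \<le> - \<rho>_check / \<mu>\<^sup>2 * d\<^sup>2 + \<rho>_bar / \<mu> * Lw2 + e" using h(5) by linarith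
  qed
qed

end

context penalised_box
begin

lemma DERIV_along_axis: "DERIV (\<lambda>t. \<phi> (x + t *\<^sub>R axis i 1)) t :> D\<phi> (x + t *\<^sub>R axis i 1) $ i"
proof -
  have "((\<lambda>t. x + t *\<^sub>R axis i 1) has_derivative (\<lambda>s. s *\<^sub>R axis i 1)) (at t)"
    by (auto intro!: derivative_eq_intros)
  from has_derivative_compose[OF this grad[unfolded gderiv_def]]
  have "((\<lambda>t. \<phi> (x + t *\<^sub>R axis i 1)) has_derivative
      (\<lambda>s. (s *\<^sub>R axis i 1) \<bullet> D\<phi> (x + t *\<^sub>R axis i 1))) (at t)" .
  moreover have "(\<lambda>s. (s *\<^sub>R axis i 1) \<bullet> D\<phi> (x + t *\<^sub>R axis i 1)) = (*) (D\<phi> (x + t *\<^sub>R axis i 1) $ i)"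
    by (simp add: fun_eq_iff inner_axis' mult.commute)
  ultimately show ?thesis by (simp add: has_field_derivative_def)
qed

lemma eventually_relax_const:
  assumes "w k t \<notin> {0..\<tau>}"
  shows "\<forall>\<^sub>F h in nhds 0. R (w k (t + h)) = R (w k t)"
proof -
  have "isCont (w k) (t + 0)" by (rule w_isCont)
  then have lim: "((\<lambda>h. w k (t + h)) \<longlongrightarrow> w k (t + 0)) (nhds 0)"
    by (intro isCont_tendsto_compose[of "t + 0" "w k"]) (auto intro!: tendsto_eq_intros filterlim_ident)
  from assms consider "w k t < 0" | "\<tau> < w k t" by fastforce
  then show ?thesis
  proof cases
    case 1
    then have "\<forall>\<^sub>F h in nhds 0. w k (t + h) < 0" using order_tendstoD(2)[OF lim, of 0] by simp
    then show ?thesis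
      by eventually_elim (use 1 in \<open>simp add: relax_eq_pos_pow0 pos_pow0_def\<close>)
  next
    case 2
    then have "\<forall>\<^sub>F h in nhds 0. \<tau> < w k (t + h)" using order_tendstoD(1)[OF lim, of \<tau>] by simp
    then show ?thesis
      by eventually_elim (use 2 mu_tau tau in \<open>simp add: relax_eq_pos_pow0 pos_pow0_def\<close>)
  qed
qed

definition no_gap :: "real^'n \<Rightarrow> bool" where
  "no_gap x \<longleftrightarrow> (\<forall>i. \<forall>k\<in>{Inl i, Inr i}. w k (x $ i) \<notin> {0<..<\<alpha> * \<mu>})"

text \<open>Moving only the coordinate in the gap, the relaxed function becomes \<open>f\<close> plus a constant near the point.
  Minimality makes \<open>f' 0\<close> vanish; then either the density is too large for that, or the slope of
  \<open>f'\<close> at \<open>0\<close> is negative.\<close>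

lemma no_gap_of_local_min:
  assumes x: "x \<in> cbox l u" and delta: "\<delta> > 0"
    and min: "\<And>y. y \<in> cbox l u \<inter> cball x \<delta> \<Longrightarrow> penalised \<phi> w lam R x \<le> penalised \<phi> w lam R y"
  shows "no_gap x"
  unfolding no_gap_def
proof (intro allI ballI notI)
  fix i k assume k: "k \<in> {Inl i, Inr i}" and gap: "w k (x $ i) \<in> {0<..<\<alpha> * \<mu>}"
  define t0 where "t0 = x $ i"
  define s where "s = w k t0 / \<mu>"
  define d where "d = deriv (w k) t0"
  have s: "s \<in> {0<..<\<alpha>}" using gap mu_pos by (auto simp: s_def t0_def field_simps)
  have act: "w k (x $ i) \<in> {0<..<\<tau>}" using gap mu_tau by auto
  note struct = active_structure[OF x k act]
  have t0: "t0 \<in> {l $ i..u $ i}" using struct by (simp add: t0_def)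
  have d: "\<sigma> \<le> \<bar>d\<bar>" using struct by (simp add: d_def t0_def)
  then have d0: "d \<noteq> 0" using sigma by auto
  obtain k' where k': "k' \<in> {Inl i, Inr i}" "k' \<noteq> k" "{k, k'} = {Inl i, Inr i}"
    using k by fastforce
  have w': "w k' (x $ i) \<notin> {0..\<tau>}" using struct(4) k' by blast
  let ?y = "\<lambda>t. x + t *\<^sub>R axis i 1"
  define f where "f t = \<phi> (?y t) + lam * R (w k (t0 + t))" for t
  define f' where "f' t = D\<phi> (?y t) $ i + lam * (\<rho> (w k (t0 + t) / \<mu>) / \<mu> * deriv (w k) (t0 + t))" for t
  have lim: "((\<lambda>h. w k (t0 + h)) \<longlongrightarrow> w k (t0 + 0)) (nhds 0)"
    by (intro isCont_tendsto_compose[OF w_isCont]) (auto intro!: tendsto_eq_intros filterlim_ident)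
  have "w k t0 > 0" using gap by (simp add: t0_def)
  then have pos: "\<forall>\<^sub>F t in nhds 0. 0 < w k (t0 + t)" using order_tendstoD(1)[OF lim, of 0] by simp
  have der: "\<forall>\<^sub>F t in nhds 0. DERIV f t :> f' t"
    using pos
  proof eventually_elim
    fix t assume "0 < w k (t0 + t)"
    then have "DERIV R (w k (t0 + t)) :> \<rho> (w k (t0 + t) / \<mu>) / \<mu>" by (intro relax_deriv) simp
    moreover have "DERIV (\<lambda>t. w k (t0 + t)) t :> deriv (w k) (t0 + t)"
      using w_deriv[of k "t0 + t"] DERIV_shift[of "w k" "deriv (w k) (t0 + t)" t t0] by (simp add: add.commute)
    ultimately have "DERIV (\<lambda>t. R (w k (t0 + t))) t :> \<rho> (w k (t0 + t) / \<mu>) / \<mu> * deriv (w k) (t0 + t)"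
      by (rule DERIV_chain2)
    then show "DERIV f t :> f' t"
      unfolding f_def[abs_def] f'_def by (intro DERIV_add DERIV_along_axis DERIV_cmult)
  qed
  have fmin: "\<forall>\<^sub>F t in nhds 0. f 0 \<le> f t"
  proof -
    define r where "r = Min {x $ i - l $ i, u $ i - x $ i, \<delta>}"
    have r: "r > 0" using struct delta by (simp add: r_def)
    have "\<forall>\<^sub>F t in nhds 0. \<bar>t\<bar> < r"
      unfolding eventually_nhds_metric using r by (intro exI[of _ r]) (simp add: dist_real_def)
    with eventually_relax_const[OF w'] show ?thesis
    proof eventually_elim
      fix t assume c: "R (w k' (x $ i + t)) = R (w k' (x $ i))" and t: "\<bar>t\<bar> < r"
      have "?y t \<in> cbox l u" using x t by (auto simp: mem_box_cart axis_def r_def)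
      moreover have "?y t \<in> cball x \<delta>" using t by (simp add: dist_norm r_def)
      ultimately have le: "penalised \<phi> w lam R x \<le> penalised \<phi> w lam R (?y t)" using min by blast
      let ?P = "\<lambda>j s. R (w (Inl j) s) + R (w (Inr j) s)"
      have P: "?P i s = R (w k s) + R (w k' s)" for s
        using k'(2,3) by (auto simp: doubleton_eq_iff)
      have sum: "(\<Sum>j\<in>UNIV. ?P j (?y t $ j)) = (\<Sum>j\<in>UNIV. ?P j (x $ j)) - R (w k (x $ i)) + R (w k (x $ i + t))"
        unfolding sum_coordinate_update[of ?P x t i] P c by simp
      then have "penalised \<phi> w lam R (?y t) - penalised \<phi> w lam R x = f t - f 0"
        unfolding penalised_def sum by (simp add: f_def t0_def algebra_simps)
      with le show "f 0 \<le> f t" by simp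
    qed
  qed
  have f'0: "f' 0 = 0"
  proof -
    have "DERIV f 0 :> f' 0" using der by (rule eventually_nhds_x_imp_x)
    moreover obtain e where "e > 0" "\<forall>t. \<bar>0 - t\<bar> < e \<longrightarrow> f 0 \<le> f t"
      using fmin by (auto simp: eventually_nhds_metric dist_real_def)
    ultimately show ?thesis using DERIV_local_min by blast
  qed
  have f'0_eq: "f' 0 = D\<phi> x $ i + lam * (\<rho> s / \<mu> * d)" by (simp add: f'_def s_def d_def)
  from density_cases[OF s] show False
  proof cases
    case 1
    show False using dense_not_stationary[OF x 1 d, of i] f'0 f'0_eq by simp
  next
    case 2
    have Lc0: "0 \<le> Lc2" by (rule Lc2_nonneg[OF x])
    have Lw0: "0 \<le> Lw2" by (rule Lw2_nonneg[OF k t0])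
    define \<Lambda> where "\<Lambda> = Lc2 + lam * (- \<rho>_check / \<mu>\<^sup>2 * d\<^sup>2 + \<rho>_bar / \<mu> * Lw2)"
    have neg: "\<Lambda> < 0" unfolding \<Lambda>_def by (rule curvature_negative[OF Lc0 Lw0 d])
    \<comment> \<open>The errors of the two slope estimates add up to \<open>e (1 + lam)\<close>, half of the available margin.\<close>
    define e where "e = - \<Lambda> / (2 * (1 + lam))"
    have e: "e > 0" unfolding e_def using neg lam by (intro divide_pos_pos) auto
    have "\<forall>\<^sub>F t in at 0. f' t / t < 0"
    proof -
      have q: "\<forall>\<^sub>F t in at 0. (\<rho> (w k (t0 + t) / \<mu>) / \<mu> * deriv (w k) (t0 + t) - \<rho> s / \<mu> * d) / t
          \<le> - \<rho>_check / \<mu>\<^sup>2 * d\<^sup>2 + \<rho>_bar / \<mu> * Lw2 + e"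
        by (rule eventually_relaxed_slope[OF s_def _ d_def d0 k t0 2 e]) (use s in auto)
      from eventually_hessian_slope[OF x e, of i] q show ?thesis
      proof eventually_elim
        fix t
        assume h: "diff_quot (\<lambda>x. D\<phi> x $ i) (axis i 1) x t \<le> Lc2 + e"
          and q: "(\<rho> (w k (t0 + t) / \<mu>) / \<mu> * deriv (w k) (t0 + t) - \<rho> s / \<mu> * d) / t
          \<le> - \<rho>_check / \<mu>\<^sup>2 * d\<^sup>2 + \<rho>_bar / \<mu> * Lw2 + e"
        let ?Q = "(\<rho> (w k (t0 + t) / \<mu>) / \<mu> * deriv (w k) (t0 + t) - \<rho> s / \<mu> * d) / t"
        have "f' t / t = (f' t - f' 0) / t" by (simp add: f'0)
        also have "\<dots> = diff_quot (\<lambda>x. D\<phi> x $ i) (axis i 1) x t + lam * ?Q"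
          unfolding f'0_eq by (simp add: f'_def diff_quot_def add_divide_distrib diff_divide_distrib algebra_simps)
        also have "\<dots> \<le> (Lc2 + e) + lam * (- \<rho>_check / \<mu>\<^sup>2 * d\<^sup>2 + \<rho>_bar / \<mu> * Lw2 + e)"
          using h q lam by (intro add_mono mult_left_mono) auto
        also have "\<dots> = \<Lambda> + e * (1 + lam)" by (simp add: \<Lambda>_def algebra_simps)
        also have "\<dots> = \<Lambda> / 2" using lam by (simp add: e_def field_simps)
        also have "\<dots> < 0" using neg by simp
        finally show "f' t / t < 0" .
      qed
    qed
    moreover have "\<forall>\<^sub>F t in at 0. f 0 \<le> f t" using fmin by (simp add: eventually_at_filter eventually_mono)
    ultimately show False using not_local_min_of_negative_slope[OF der] by blast
  qed
qed

lemma penalised_eq_of_no_gap: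
  assumes "no_gap x"
  shows "penalised \<phi> w lam R x = penalised \<phi> w lam pos_pow0 x"
  using assms unfolding penalised_def no_gap_def by (simp add: relax_eq_pos_pow0)

lemma penalised_relax_le: "penalised \<phi> w lam R x \<le> penalised \<phi> w lam pos_pow0 x"
  unfolding penalised_def
  using lam by (intro add_left_mono mult_left_mono sum_mono add_mono relax_le_pos_pow0) auto

lemma continuous_penalised: "continuous_on S (penalised \<phi> w lam R)"
proof -
  have "isCont \<phi> x" for x using grad[of x] unfolding gderiv_def by (rule has_derivative_continuous)
  then have "continuous_on S \<phi>" by (intro continuous_at_imp_continuous_on) auto
  moreover have "continuous_on S (\<lambda>x. R (w k (x $ i)))" for k i
  proof -
    have "continuous_on UNIV (w k)" using w_isCont by (intro continuous_at_imp_continuous_on) auto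
    then have "continuous_on S (\<lambda>x. w k (x $ i))"
      by (rule continuous_on_compose2) (auto intro!: continuous_intros)
    then show ?thesis by (rule continuous_on_compose2[OF continuous_relax]) auto
  qed
  ultimately show ?thesis
    unfolding penalised_def[abs_def] by (intro continuous_intros) auto
qed

text \<open>From the original to the relaxed problem the minimiser is not known to be off the gap beforehand. It is
  compared with a minimiser of the relaxed function, which exists by compactness and is off the gap.\<close>

lemma minimiser_iff:
  "(\<forall>y\<in>cbox l u. penalised \<phi> w lam pos_pow0 x \<le> penalised \<phi> w lam pos_pow0 y) \<longleftrightarrow>
   (\<forall>y\<in>cbox l u. penalised \<phi> w lam R x \<le> penalised \<phi> w lam R y)" if x: "x \<in> cbox l u"
proof -
  have gap: "no_gap z" if "z \<in> cbox l u" "\<forall>y\<in>cbox l u. penalised \<phi> w lam R z \<le> penalised \<phi> w lam R y" for z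
    by (rule no_gap_of_local_min[OF that(1), of 1]) (use that(2) in auto)
  show ?thesis
  proof
    assume R: "\<forall>y\<in>cbox l u. penalised \<phi> w lam R x \<le> penalised \<phi> w lam R y"
    then show "\<forall>y\<in>cbox l u. penalised \<phi> w lam pos_pow0 x \<le> penalised \<phi> w lam pos_pow0 y"
      using penalised_eq_of_no_gap[OF gap[OF x R]] penalised_relax_le order_trans by metis
  next
    assume O: "\<forall>y\<in>cbox l u. penalised \<phi> w lam pos_pow0 x \<le> penalised \<phi> w lam pos_pow0 y"
    obtain z where z: "z \<in> cbox l u" "\<forall>y\<in>cbox l u. penalised \<phi> w lam R z \<le> penalised \<phi> w lam R y"
      using continuous_attains_inf[OF compact_cbox _ continuous_penalised] x by blast
    have "penalised \<phi> w lam R x \<le> penalised \<phi> w lam pos_pow0 x" by (rule penalised_relax_le)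
    also have "\<dots> \<le> penalised \<phi> w lam pos_pow0 z" using O z(1) by blast
    also have "\<dots> = penalised \<phi> w lam R z" using penalised_eq_of_no_gap[OF gap[OF z]] by simp
    finally show "\<forall>y\<in>cbox l u. penalised \<phi> w lam R x \<le> penalised \<phi> w lam R y" using z(2) by force
  qed
qed

text \<open>The inclusion \<open>0 \<in> \<partial> + N\<close> with the chosen subgradients \<open>a\<close> and normal vector \<open>v\<close> made explicit.\<close>

definition stationary :: "real^'n \<Rightarrow> bool" where
  "stationary x \<longleftrightarrow> x \<in> cbox l u \<and> (\<exists>a v. (\<forall>i. \<forall>k\<in>{Inl i, Inr i}. a k \<in> clarke_subdiff R (w k (x $ i))) \<and>
     v \<in> normal_cone (cbox l u) x \<and>
     D\<phi> x + lam *\<^sub>R (\<Sum>i\<in>UNIV. (a (Inl i) * deriv (w (Inl i)) (x $ i)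
       + a (Inr i) * deriv (w (Inr i)) (x $ i)) *\<^sub>R axis i 1) + v = 0)"

lemma stationaryE:
  assumes "stationary x"
  obtains a v where "x \<in> cbox l u" "\<And>i k. k \<in> {Inl i, Inr i} \<Longrightarrow> a k \<in> clarke_subdiff R (w k (x $ i))"
    "v \<in> normal_cone (cbox l u) x"
    "\<And>i. D\<phi> x $ i + lam * (a (Inl i) * deriv (w (Inl i)) (x $ i) + a (Inr i) * deriv (w (Inr i)) (x $ i)) + v $ i = 0"
proof -
  obtain a v where A: "x \<in> cbox l u" "\<forall>i. \<forall>k\<in>{Inl i, Inr i}. a k \<in> clarke_subdiff R (w k (x $ i))"
     "v \<in> normal_cone (cbox l u) x"
     "D\<phi> x + lam *\<^sub>R (\<Sum>i\<in>UNIV. (a (Inl i) * deriv (w (Inl i)) (x $ i)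
       + a (Inr i) * deriv (w (Inr i)) (x $ i)) *\<^sub>R axis i 1) + v = 0"
    using assms unfolding stationary_def by blast
  have "(\<Sum>i\<in>UNIV. c i *\<^sub>R axis i 1 :: real^'n) $ j = c j" for c :: "'n \<Rightarrow> real" and j
    by (simp add: axis_def if_distrib cong: if_cong)
  then have "D\<phi> x $ i + lam * (a (Inl i) * deriv (w (Inl i)) (x $ i) + a (Inr i) * deriv (w (Inr i)) (x $ i)) + v $ i = 0" for i
    using arg_cong[OF A(4), of "\<lambda>z. z $ i"] by simp
  then show ?thesis using that A by blast
qed

text \<open>The same dichotomy as for local minima, with the second order condition in place of the slope
  estimate. The function inert at this coordinate has subgradient \<open>0\<close>, and an interior coordinate has normal
  component \<open>0\<close>, so the first order condition is an equation for one term.\<close>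

lemma no_gap_of_stationary:
  assumes st: "stationary x"
    and second: "\<And>i k. k \<in> {Inl i, Inr i} \<Longrightarrow> w k (x $ i) \<in> {0<..<\<tau>} \<Longrightarrow>
      \<exists>\<eta> \<omega>. \<bar>\<eta>\<bar> \<le> Lc2 \<and> \<omega> \<in> rel_second_deriv \<rho> \<mu> (w k) (x $ i) \<and> 0 \<le> \<eta> + lam * \<omega>"
  shows "no_gap x"
  unfolding no_gap_def
proof (intro allI ballI notI)
  fix i k assume k: "k \<in> {Inl i, Inr i}" and gap: "w k (x $ i) \<in> {0<..<\<alpha> * \<mu>}"
  obtain a v where A: "x \<in> cbox l u" "\<And>i k. k \<in> {Inl i, Inr i} \<Longrightarrow> a k \<in> clarke_subdiff R (w k (x $ i))"
    "v \<in> normal_cone (cbox l u) x"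
    "\<And>i. D\<phi> x $ i + lam * (a (Inl i) * deriv (w (Inl i)) (x $ i) + a (Inr i) * deriv (w (Inr i)) (x $ i)) + v $ i = 0"
    using stationaryE[OF st] by metis
  define s where "s = w k (x $ i) / \<mu>"
  define d where "d = deriv (w k) (x $ i)"
  have s: "s \<in> {0<..<\<alpha>}" using gap mu_pos by (auto simp: s_def field_simps)
  have act: "w k (x $ i) \<in> {0<..<\<tau>}" using gap mu_tau by auto
  note struct = active_structure[OF A(1) k act]
  have d: "\<sigma> \<le> \<bar>d\<bar>" using struct by (simp add: d_def)
  obtain k' where k': "k' \<in> {Inl i, Inr i}" "k' \<noteq> k" "{k, k'} = {Inl i, Inr i}"
    using k by fastforce
  have w': "w k' (x $ i) \<notin> {0..\<tau>}" using struct(4) k' by blast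
  have "a k \<in> {\<rho> s / \<mu>}" using A(2)[OF k] clarke_relax[of "w k (x $ i)"] gap by (auto simp: s_def)
  moreover have "a k' = 0"
  proof -
    have "w k' (x $ i) / \<mu> < 0 \<or> \<alpha> \<le> w k' (x $ i) / \<mu>" and ne: "w k' (x $ i) \<noteq> 0"
      using w' mu_tau tau mu_pos by (auto simp: field_simps)
    then have "\<rho> (w k' (x $ i) / \<mu>) = 0" using rho_outside rho_ge_alpha by auto
    then show ?thesis using A(2)[OF k'(1)] clarke_relax[OF ne] by auto
  qed
  moreover have "v $ i = 0" by (rule normal_cone_interior_coordinate[OF A(3) struct(1,2)])
  moreover have "a (Inl i) * deriv (w (Inl i)) (x $ i) + a (Inr i) * deriv (w (Inr i)) (x $ i)
      = a k * deriv (w k) (x $ i) + a k' * deriv (w k') (x $ i)"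
    using k'(2,3) by (auto simp: doubleton_eq_iff)
  ultimately have first: "D\<phi> x $ i + lam * (\<rho> s / \<mu> * d) = 0" using A(4)[of i] by (simp add: d_def)
  from density_cases[OF s] show False
  proof cases
    case 1
    then show False using dense_not_stationary[OF A(1) 1 d, of i] first by simp
  next
    case 2
    obtain \<eta> b \<xi> where e: "\<bar>\<eta>\<bar> \<le> Lc2" "b \<in> clarke_subdiff \<rho> s" "\<xi> \<in> gen_second_deriv (w k) (x $ i)"
      "0 \<le> \<eta> + lam * (b / \<mu>\<^sup>2 * d\<^sup>2 + \<rho> s / \<mu> * \<xi>)"
      using second[OF k act] unfolding rel_second_deriv_def s_def d_def by blast
    have xi: "\<bar>\<xi>\<bar> \<le> Lw2" by (rule Lw2[OF k _ e(3)]) (use struct in simp)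
    have "b / \<mu>\<^sup>2 * d\<^sup>2 \<le> - \<rho>_check / \<mu>\<^sup>2 * d\<^sup>2" using 2[OF e(2)] by (intro mult_right_mono divide_right_mono) auto
    moreover have "\<rho> s / \<mu> * \<xi> \<le> \<rho>_bar / \<mu> * Lw2"
    proof -
      have "\<rho> s / \<mu> * \<xi> \<le> \<rho> s / \<mu> * Lw2" using rho_nonneg[of s] mu_pos xi by (intro mult_left_mono) auto
      also have "\<dots> \<le> \<rho>_bar / \<mu> * Lw2"
        using rho_le_bar[of s] s mu_pos xi by (intro mult_right_mono divide_right_mono) auto
      finally show ?thesis .
    qed
    ultimately have "lam * (b / \<mu>\<^sup>2 * d\<^sup>2 + \<rho> s / \<mu> * \<xi>) \<le> lam * (- \<rho>_check / \<mu>\<^sup>2 * d\<^sup>2 + \<rho>_bar / \<mu> * Lw2)"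
      using lam by (intro mult_left_mono add_mono) auto
    moreover have "Lc2 + lam * (- \<rho>_check / \<mu>\<^sup>2 * d\<^sup>2 + \<rho>_bar / \<mu> * Lw2) < 0"
      by (rule curvature_negative[OF _ _ d]) (use e(1) xi in auto)
    ultimately show False using e(1,4) by linarith
  qed
qed

end

lemma convex_on_gradient_le:
  fixes f :: "'a::euclidean_space \<Rightarrow> real"
  assumes conv: "convex_on UNIV f" and grad: "GDERIV f x :> D"
  shows "f x + D \<bullet> (y - x) \<le> f y"
proof -
  let ?g = "\<lambda>t::real. f (x + t *\<^sub>R (y - x))"
  have convg: "convex_on UNIV ?g"
  proof (rule convex_onI)
    fix t a b :: real assume t: "0 < t" "t < 1"
    have "x + ((1 - t) *\<^sub>R a + t *\<^sub>R b) *\<^sub>R (y - x)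
        = (1 - t) *\<^sub>R (x + a *\<^sub>R (y - x)) + t *\<^sub>R (x + b *\<^sub>R (y - x))"
      by (simp add: algebra_simps)
    then show "?g ((1 - t) *\<^sub>R a + t *\<^sub>R b) \<le> (1 - t) * ?g a + t * ?g b"
      using convex_onD[OF conv, of t] t by simp
  qed simp
  have "((\<lambda>t::real. x + t *\<^sub>R (y - x)) has_derivative (\<lambda>s. s *\<^sub>R (y - x))) (at 0)"
    by (auto intro!: derivative_eq_intros)
  moreover have "(f has_derivative (\<lambda>h. h \<bullet> D)) (at (x + 0 *\<^sub>R (y - x)))"
    using grad by (simp add: gderiv_def)
  ultimately have "(?g has_derivative (\<lambda>s. (s *\<^sub>R (y - x)) \<bullet> D)) (at 0)"
    by (rule has_derivative_compose)
  moreover have "(\<lambda>s. (s *\<^sub>R (y - x)) \<bullet> D) = (*) (D \<bullet> (y - x))"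
    by (simp add: fun_eq_iff inner_commute mult.commute)
  ultimately have "DERIV ?g 0 :> D \<bullet> (y - x)" by (simp add: has_field_derivative_def)
  then have "?g 1 - ?g 0 \<ge> D \<bullet> (y - x) * (1 - 0)"
    by (intro convex_on_imp_above_tangent[OF convg]) auto
  then show ?thesis by simp
qed

context penalised_box
begin

text \<open>Off the gap, subgradients of the relaxed steps can be nonzero only where the argument is \<open>0\<close>, and there they
  are nonnegative. If no such step switches on, then convexity of \<open>w k\<close> gives \<open>w' (y\<^sub>i - x\<^sub>i) \<le> 0\<close>, so that these
  terms push \<open>\<nabla>\<phi> \<bullet> (y - x)\<close> in the right direction.\<close>

lemma local_min_of_stationary_convex:
  assumes st: "stationary x" and gap: "no_gap x" and conv: "\<And>k. convex_on UNIV (w k)"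
  shows "\<exists>\<delta>>0. \<forall>y\<in>cbox l u \<inter> cball x \<delta>. penalised \<phi> w lam pos_pow0 x \<le> penalised \<phi> w lam pos_pow0 y"
proof -
  obtain a v where A: "x \<in> cbox l u" "\<And>i k. k \<in> {Inl i, Inr i} \<Longrightarrow> a k \<in> clarke_subdiff R (w k (x $ i))"
    "v \<in> normal_cone (cbox l u) x"
    "\<And>i. D\<phi> x $ i + lam * (a (Inl i) * deriv (w (Inl i)) (x $ i) + a (Inr i) * deriv (w (Inr i)) (x $ i)) + v $ i = 0"
    using stationaryE[OF st] by metis
  have a0: "a k = 0" if k: "k \<in> {Inl i, Inr i}" and ne: "w k (x $ i) \<noteq> 0" for i k
  proof -
    have "w k (x $ i) \<notin> {0<..<\<alpha> * \<mu>}" using gap k unfolding no_gap_def by blast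
    then have "w k (x $ i) / \<mu> < 0 \<or> \<alpha> \<le> w k (x $ i) / \<mu>" using ne mu_pos by (auto simp: field_simps)
    then have "\<rho> (w k (x $ i) / \<mu>) = 0" using rho_outside rho_ge_alpha by auto
    then show ?thesis using A(2)[OF k] clarke_relax[OF ne] by auto
  qed
  have apos: "0 \<le> a k" if "k \<in> {Inl i, Inr i}" for i k
    using clarke_relax_nonneg A(2)[OF that] by blast
  have lim: "((\<lambda>y. w k (y $ i)) \<longlongrightarrow> w k (x $ i)) (nhds x)" for k i
    by (intro isCont_tendsto_compose[OF w_isCont] tendsto_vec_nth filterlim_ident)
  have near: "\<forall>\<^sub>F y in nhds x. 0 < w k (x $ i) \<longrightarrow> 0 < w k (y $ i)" for k i
  proof (cases "0 < w k (x $ i)")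
    case True
    from order_tendstoD(1)[OF lim this] show ?thesis by eventually_elim simp
  qed simp
  have "isCont \<phi> x" using grad[of x] unfolding gderiv_def by (rule has_derivative_continuous)
  then have "(\<phi> \<longlongrightarrow> \<phi> x) (nhds x)" by (simp add: isCont_def tendsto_at_iff_tendsto_nhds)
  then have "\<forall>\<^sub>F y in nhds x. \<phi> x - lam < \<phi> y" using lam by (intro order_tendstoD(1)) auto
  moreover have "\<forall>\<^sub>F y in nhds x. \<forall>i. 0 < w (Inl i) (x $ i) \<longrightarrow> 0 < w (Inl i) (y $ i)"
    "\<forall>\<^sub>F y in nhds x. \<forall>i. 0 < w (Inr i) (x $ i) \<longrightarrow> 0 < w (Inr i) (y $ i)"
    by (intro eventually_all_finite near)+
  ultimately have "\<forall>\<^sub>F y in nhds x. \<phi> x - lam < \<phi> y \<and>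
      (\<forall>i. \<forall>k\<in>{Inl i, Inr i}. 0 < w k (x $ i) \<longrightarrow> 0 < w k (y $ i))"
    by eventually_elim simp
  then obtain e where e: "e > 0" "\<And>y. dist y x < e \<Longrightarrow> \<phi> x - lam < \<phi> y \<and>
      (\<forall>i. \<forall>k\<in>{Inl i, Inr i}. 0 < w k (x $ i) \<longrightarrow> 0 < w k (y $ i))"
    unfolding eventually_nhds_metric by blast
  have "penalised \<phi> w lam pos_pow0 x \<le> penalised \<phi> w lam pos_pow0 y"
    if y: "y \<in> cbox l u \<inter> cball x (e / 2)" for y
  proof -
    have "dist y x < e" using y e(1) by (simp add: dist_commute)
    note ey = e(2)[OF this]
    define P where "P z i = pos_pow0 (w (Inl i) (z $ i)) + pos_pow0 (w (Inr i) (z $ i))" for z :: "real^'n" and i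
    have le: "pos_pow0 (w k (x $ i)) \<le> pos_pow0 (w k (y $ i))" if "k \<in> {Inl i, Inr i}" for k i
      using ey that by (auto simp: pos_pow0_def)
    have leP: "P x i \<le> P y i" for i unfolding P_def by (intro add_mono le) auto
    show ?thesis
    proof (cases "\<forall>i. \<forall>k\<in>{Inl i, Inr i}. w k (x $ i) = 0 \<longrightarrow> w k (y $ i) \<le> 0")
      case True
      have drift: "0 \<le> - (a k * deriv (w k) (x $ i) * (y $ i - x $ i))" if k: "k \<in> {Inl i, Inr i}" for k i
      proof (cases "w k (x $ i) = 0")
        case z: True
        have "w k (y $ i) - w k (x $ i) \<ge> deriv (w k) (x $ i) * (y $ i - x $ i)"
          by (intro convex_on_imp_above_tangent[OF conv]) (auto intro: w_deriv)
        then have "deriv (w k) (x $ i) * (y $ i - x $ i) \<le> 0" using z True k by fastforce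
        then show ?thesis using mult_nonneg_nonpos[OF apos[OF k]] by (simp add: mult.assoc)
      qed (simp add: a0[OF k])
      have "v \<bullet> (y - x) \<le> 0" using A(3) y by (simp add: normal_cone_def)
      moreover have "D\<phi> x \<bullet> (y - x) + v \<bullet> (y - x) = (\<Sum>i\<in>UNIV. lam *
          (- (a (Inl i) * deriv (w (Inl i)) (x $ i) * (y $ i - x $ i))
           + - (a (Inr i) * deriv (w (Inr i)) (x $ i) * (y $ i - x $ i))))"
      proof -
        have "D\<phi> x \<bullet> (y - x) + v \<bullet> (y - x) = (\<Sum>i\<in>UNIV. (D\<phi> x $ i + v $ i) * (y $ i - x $ i))"
          by (simp add: inner_vec_def sum.distrib[symmetric] distrib_right)
        also have "\<dots> = (\<Sum>i\<in>UNIV. lam * (- (a (Inl i) * deriv (w (Inl i)) (x $ i) * (y $ i - x $ i))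
           + - (a (Inr i) * deriv (w (Inr i)) (x $ i) * (y $ i - x $ i))))"
        proof (rule sum.cong[OF refl])
          fix i
          have eq: "D\<phi> x $ i + v $ i = - (lam * (a (Inl i) * deriv (w (Inl i)) (x $ i)
            + a (Inr i) * deriv (w (Inr i)) (x $ i)))"
            using A(4)[of i] by linarith
          show "(D\<phi> x $ i + v $ i) * (y $ i - x $ i)
              = lam * (- (a (Inl i) * deriv (w (Inl i)) (x $ i) * (y $ i - x $ i))
                + - (a (Inr i) * deriv (w (Inr i)) (x $ i) * (y $ i - x $ i)))"
            unfolding eq by (simp add: algebra_simps)
        qed
        finally show ?thesis .
      qed
      moreover have "0 \<le> (\<Sum>i\<in>UNIV. lam *
          (- (a (Inl i) * deriv (w (Inl i)) (x $ i) * (y $ i - x $ i))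
           + - (a (Inr i) * deriv (w (Inr i)) (x $ i) * (y $ i - x $ i))))"
        using lam by (intro sum_nonneg mult_nonneg_nonneg add_nonneg_nonneg drift) auto
      ultimately have "0 \<le> D\<phi> x \<bullet> (y - x)" by linarith
      then have "\<phi> x \<le> \<phi> y" using convex_on_gradient_le[OF convex grad, of x y] by linarith
      moreover have "lam * (\<Sum>i\<in>UNIV. P x i) \<le> lam * (\<Sum>i\<in>UNIV. P y i)"
        using lam by (intro mult_left_mono sum_mono leP) auto
      ultimately show ?thesis by (simp add: penalised_def P_def)
    next
      case False
      then obtain i k where k: "k \<in> {Inl i, Inr i}" "w k (x $ i) = 0" "0 < w k (y $ i)"
        by (auto simp: not_le)
      have "P x i + 1 \<le> P y i"
        using k le[of "Inl i" i] le[of "Inr i" i] by (auto simp: P_def pos_pow0_def split: if_splits)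
      moreover have "(\<Sum>j\<in>UNIV - {i}. P x j) \<le> (\<Sum>j\<in>UNIV - {i}. P y j)" by (intro sum_mono leP)
      ultimately have "(\<Sum>j\<in>UNIV. P x j) + 1 \<le> (\<Sum>j\<in>UNIV. P y j)"
        by (simp add: sum.remove[of UNIV i])
      then have "lam * ((\<Sum>j\<in>UNIV. P x j) + 1) \<le> lam * (\<Sum>j\<in>UNIV. P y j)"
        using lam by (intro mult_left_mono) auto
      then show ?thesis using ey by (simp add: penalised_def P_def distrib_left)
    qed
  qed
  then show ?thesis using e(1) by (intro exI[of _ "e / 2"]) auto
qed

end

section \<open>Saddle points\<close>

lemma lipschitz_cont_diff_gradient:
  assumes "lipschitz_cont_diff f"
  shows "GDERIV f z :> gradient f z" and "\<exists>L. L-lipschitz_on UNIV (gradient f)"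
proof -
  obtain D where D: "\<And>z. GDERIV f z :> D z" using assms unfolding lipschitz_cont_diff_def by metis
  then show "GDERIV f z :> gradient f z" using gradient_eqI[OF D] by simp
  show "\<exists>L. L-lipschitz_on UNIV (gradient f)"
    using assms by (simp add: lipschitz_cont_diff_def lipschitz_continuous_def)
qed

lemma lipschitz_cont_diff_slices:
  fixes c :: "'a::euclidean_space \<Rightarrow> 'b::euclidean_space \<Rightarrow> real"
  assumes "lipschitz_cont_diff (\<lambda>(x, y). c x y)"
  shows "lipschitz_cont_diff (\<lambda>x. c x y)" and "lipschitz_cont_diff (\<lambda>y. c x y)"
proof -
  let ?C = "\<lambda>(x, y). c x y"
  let ?D = "gradient ?C"
  have G: "(?C has_derivative (\<lambda>h. h \<bullet> ?D z)) (at z)" for z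
    using lipschitz_cont_diff_gradient(1)[OF assms] by (simp add: gderiv_def)
  obtain L where L: "L-lipschitz_on UNIV ?D" using lipschitz_cont_diff_gradient(2)[OF assms] by blast
  have Gx: "GDERIV (\<lambda>x. c x y) x :> fst (?D (x, y))" for x y
  proof -
    have "((\<lambda>x. (x, y)) has_derivative (\<lambda>h. (h, 0))) (at x)" by (auto intro!: derivative_eq_intros)
    from has_derivative_compose[OF this G] show ?thesis
      by (simp add: gderiv_def inner_prod_def)
  qed
  have Gy: "GDERIV (\<lambda>y. c x y) y :> snd (?D (x, y))" for x y
  proof -
    have "((\<lambda>y. (x, y)) has_derivative (\<lambda>h. (0, h))) (at y)" by (auto intro!: derivative_eq_intros)
    from has_derivative_compose[OF this G] show ?thesis
      by (simp add: gderiv_def inner_prod_def)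
  qed
  have gx: "gradient (\<lambda>x. c x y) = (\<lambda>x. fst (?D (x, y)))"
    using gradient_eqI[OF Gx] by blast
  have gy: "gradient (\<lambda>y. c x y) = (\<lambda>y. snd (?D (x, y)))"
    using gradient_eqI[OF Gy] by blast
  have "L-lipschitz_on UNIV (\<lambda>x. fst (?D (x, y)))"
  proof (rule lipschitz_onI)
    fix x x'
    have "dist (fst (?D (x, y))) (fst (?D (x', y))) \<le> dist (?D (x, y)) (?D (x', y))" by (rule dist_fst_le)
    also have "\<dots> \<le> L * dist (x, y) (x', y)" by (rule lipschitz_onD[OF L]) auto
    finally show "dist (fst (?D (x, y))) (fst (?D (x', y))) \<le> L * dist x x'" by (simp add: dist_Pair_Pair)
  qed (rule lipschitz_on_nonneg[OF L])
  then show "lipschitz_cont_diff (\<lambda>x. c x y)"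
    unfolding lipschitz_cont_diff_def lipschitz_continuous_def gx using Gx by blast
  have "L-lipschitz_on UNIV (\<lambda>y. snd (?D (x, y)))"
  proof (rule lipschitz_onI)
    fix y y'
    have "dist (snd (?D (x, y))) (snd (?D (x, y'))) \<le> dist (?D (x, y)) (?D (x, y'))" by (rule dist_snd_le)
    also have "\<dots> \<le> L * dist (x, y) (x, y')" by (rule lipschitz_onD[OF L]) auto
    finally show "dist (snd (?D (x, y))) (snd (?D (x, y'))) \<le> L * dist y y'" by (simp add: dist_Pair_Pair)
  qed (rule lipschitz_on_nonneg[OF L])
  then show "lipschitz_cont_diff (\<lambda>y. c x y)"
    unfolding lipschitz_cont_diff_def lipschitz_continuous_def gy using Gy by blast
qed

lemma limiting_jacobians_subset_gen_hessian: "limiting_jacobians (gradient F) z \<subseteq> gen_hessian F z"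
  unfolding limiting_jacobians_def gen_hessian_def by (rule hull_subset)

lemma limiting_jacobians_minus:
  assumes "H \<in> limiting_jacobians (\<lambda>y. - G y) z"
  shows "- H \<in> limiting_jacobians G z"
proof -
  obtain Z J where ZJ: "Z \<longlonglongrightarrow> z" "J \<longlonglongrightarrow> H"
    "\<And>k. ((\<lambda>y. - G y) has_derivative (\<lambda>v. J k *v v)) (at (Z k))"
    using assms unfolding limiting_jacobians_def by blast
  have "(G has_derivative (\<lambda>v. (- J k) *v v)) (at (Z k))" for k
  proof -
    have "(\<lambda>v. - (J k *v v)) = (\<lambda>v. (- J k) *v v)"
      by (simp add: fun_eq_iff vec_eq_iff matrix_vector_mult_def sum_negf)
    then show ?thesis using has_derivative_minus[OF ZJ(3)[of k]] by simp
  qed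
  then show ?thesis
    unfolding limiting_jacobians_def using ZJ(1) tendsto_minus[OF ZJ(2)] by blast
qed

lemma mu_bar2_bounds:
  assumes mu: "ereal \<mu> < mu_bar2 lam1 lam2 \<tau> \<sigma> \<alpha> \<rho>_low \<rho>_check \<rho>_bar Lc1 Lc2 Lg2 Lh2"
    and pos: "lam1 > 0" "lam2 > 0" "\<tau> > 0" "\<sigma> > 0" "\<alpha> > 0" "\<rho>_low > 0" "\<rho>_check > 0" "\<rho>_bar > 0" "Lc1 > 0" "\<mu> > 0"
  shows "\<alpha> * \<mu> < \<tau>"
    and "\<mu> * Lc1 < lam1 * \<sigma> * \<rho>_low" "\<mu> * Lc1 < lam2 * \<sigma> * \<rho>_low"
    and "0 \<le> Lc2 \<Longrightarrow> 0 \<le> Lg2 \<Longrightarrow> \<mu> * (\<tau> * Lc2 / \<alpha> + lam1 * \<rho>_bar * Lg2) < lam1 * \<rho>_check * \<sigma>\<^sup>2"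
    and "0 \<le> Lc2 \<Longrightarrow> 0 \<le> Lh2 \<Longrightarrow> \<mu> * (\<tau> * Lc2 / \<alpha> + lam2 * \<rho>_bar * Lh2) < lam2 * \<rho>_check * \<sigma>\<^sup>2"
proof -
  have frac: "\<mu> * D < N" if "ereal \<mu> < ereal N / ereal D" "0 \<le> D" "0 < N" for N D
  proof (cases "D = 0")
    case False
    then show ?thesis using that by (simp add: field_simps)
  qed (use that in simp)
  \<comment> \<open>A zero denominator makes the fraction infinite, but then the product form is trivial.\<close>
  have b: "ereal \<mu> < ereal (\<tau> / \<alpha>)"
    "ereal \<mu> < ereal (min lam1 lam2 * \<sigma> * \<rho>_low) / ereal Lc1"
    "ereal \<mu> < ereal (lam1 * \<rho>_check * \<sigma>\<^sup>2) / ereal (\<tau> * Lc2 / \<alpha> + lam1 * \<rho>_bar * Lg2)"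
    "ereal \<mu> < ereal (lam2 * \<rho>_check * \<sigma>\<^sup>2) / ereal (\<tau> * Lc2 / \<alpha> + lam2 * \<rho>_bar * Lh2)"
    using mu unfolding mu_bar2_def
    by (simp_all only: Min_gr_iff finite.intros insert_not_empty not_False_eq_True ball_simps simp_thms)
  show "\<alpha> * \<mu> < \<tau>" using b(1) pos by (simp add: field_simps)
  have m: "\<mu> * Lc1 < min lam1 lam2 * \<sigma> * \<rho>_low"
    by (rule frac[OF b(2)]) (use pos in \<open>simp_all add: min_def\<close>)
  have "min lam1 lam2 * \<sigma> * \<rho>_low \<le> lam1 * \<sigma> * \<rho>_low" "min lam1 lam2 * \<sigma> * \<rho>_low \<le> lam2 * \<sigma> * \<rho>_low"
    using pos by (intro mult_right_mono; simp)+
  with m show "\<mu> * Lc1 < lam1 * \<sigma> * \<rho>_low" "\<mu> * Lc1 < lam2 * \<sigma> * \<rho>_low" by linarith+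
  show "\<mu> * (\<tau> * Lc2 / \<alpha> + lam1 * \<rho>_bar * Lg2) < lam1 * \<rho>_check * \<sigma>\<^sup>2" if "0 \<le> Lc2" "0 \<le> Lg2"
    by (rule frac[OF b(3)]) (use pos that in simp_all)
  show "\<mu> * (\<tau> * Lc2 / \<alpha> + lam2 * \<rho>_bar * Lh2) < lam2 * \<rho>_check * \<sigma>\<^sup>2" if "0 \<le> Lc2" "0 \<le> Lh2"
    by (rule frac[OF b(4)]) (use pos that in simp_all)
qed

theorem theorem5p3:
  fixes c :: "real^'n \<Rightarrow> real^'m \<Rightarrow> real"
    and g :: "'n + 'n \<Rightarrow> real \<Rightarrow> real" and h :: "'m + 'm \<Rightarrow> real \<Rightarrow> real"
    and u_lo u_up :: "real^'n" and v_lo v_up :: "real^'m"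
    and X :: "(real^'n) set" and Y :: "(real^'m) set"
    and lam1 lam2 \<tau> \<sigma> \<alpha> \<mu> \<rho>_low \<rho>_check \<rho>_bar Lc1 Lc2 Lg2 Lh2 :: real
    and \<rho> :: "real \<Rightarrow> real"
  assumes c_convex: "\<And>y. convex_on UNIV (\<lambda>x. c x y)"
    and c_concave: "\<And>x. concave_on UNIV (\<lambda>y. c x y)"
    and c_lipschitz: "lipschitz_continuous (\<lambda>(x, y). c x y)"
    and c_smooth: "lipschitz_cont_diff (\<lambda>(x, y). c x y)"
    and g_smooth: "\<And>k. lipschitz_cont_diff (g k)"
    and h_smooth: "\<And>k. lipschitz_cont_diff (h k)"
    and lambda: "lam1 > 0" "lam2 > 0"
    and u_less: "\<And>i. u_lo $ i < u_up $ i" and v_less: "\<And>j. v_lo $ j < v_up $ j"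
    and box_X: "X = cbox u_lo u_up" and box_Y: "Y = cbox v_lo v_up"
    and tau_sigma: "\<tau> > 0" "\<sigma> > 0"
    and cond_A_x: "structural_condition \<tau> \<sigma> u_lo u_up g"
    and cond_A_y: "structural_condition \<tau> \<sigma> v_lo v_up h"
    and alpha: "\<alpha> > 0" and density: "density_on \<alpha> \<rho>"
    and cond_D: "density_condition \<alpha> \<rho> \<rho>_low \<rho>_check"
    and rho_bar: "\<rho>_bar > 0" "\<And>s. s \<in> {0<..<\<alpha>} \<Longrightarrow> \<rho> s \<le> \<rho>_bar"
    and Lc1: "Lc1 > 0"
      "\<And>x y. x \<in> X \<Longrightarrow> y \<in> Y \<Longrightarrow> infnorm (gradient (\<lambda>x'. c x' y) x) \<le> Lc1"
      "\<And>x y. x \<in> X \<Longrightarrow> y \<in> Y \<Longrightarrow> infnorm (gradient (\<lambda>y'. c x y') y) \<le> Lc1"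
    and Lc2:
      "\<And>x y H i. x \<in> X \<Longrightarrow> y \<in> Y \<Longrightarrow> H \<in> gen_hessian (\<lambda>x'. c x' y) x \<Longrightarrow> \<bar>H $ i $ i\<bar> \<le> Lc2"
      "\<And>x y M j. x \<in> X \<Longrightarrow> y \<in> Y \<Longrightarrow> M \<in> gen_hessian (\<lambda>y'. c x y') y \<Longrightarrow> \<bar>M $ j $ j\<bar> \<le> Lc2"
    and Lg2: "\<And>i k t \<xi>. k \<in> {Inl i, Inr i} \<Longrightarrow> t \<in> {u_lo $ i .. u_up $ i} \<Longrightarrow>
        \<xi> \<in> gen_second_deriv (g k) t \<Longrightarrow> \<bar>\<xi>\<bar> \<le> Lg2"
    and Lh2: "\<And>j k t \<eta>. k \<in> {Inl j, Inr j} \<Longrightarrow> t \<in> {v_lo $ j .. v_up $ j} \<Longrightarrow>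
        \<eta> \<in> gen_second_deriv (h k) t \<Longrightarrow> \<bar>\<eta>\<bar> \<le> Lh2"
    and mu: "0 < \<mu>"
      "ereal \<mu> < mu_bar2 lam1 lam2 \<tau> \<sigma> \<alpha> \<rho>_low \<rho>_check \<rho>_bar Lc1 Lc2 Lg2 Lh2"
  shows
    "(\<forall>xs ys. weak_second_order_stationary X Y c g h lam1 lam2 \<rho> \<tau> \<mu> xs ys \<longrightarrow>
        (\<forall>i. \<forall>k\<in>{Inl i, Inr i}. g k (xs $ i) \<notin> {0<..<\<alpha> * \<mu>}) \<and>
        (\<forall>j. \<forall>k\<in>{Inl j, Inr j}. h k (ys $ j) \<notin> {0<..<\<alpha> * \<mu>})) \<and>
     (\<forall>xs ys. saddle_point X Y (objective c g h lam1 lam2) xs ys \<longleftrightarrow>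
        saddle_point X Y (relaxed_objective c g h lam1 lam2 \<rho> \<mu>) xs ys) \<and>
     (\<forall>xs ys. local_saddle_point X Y (relaxed_objective c g h lam1 lam2 \<rho> \<mu>) xs ys \<longrightarrow>
        strong_local_saddle_point (\<alpha> * \<mu>) X Y c g h lam1 lam2 xs ys) \<and>
     ((\<forall>k. convex_on UNIV (g k)) \<and> (\<forall>k. convex_on UNIV (h k)) \<longrightarrow>
        (\<forall>xs ys. weak_second_order_stationary X Y c g h lam1 lam2 \<rho> \<tau> \<mu> xs ys \<longrightarrow>
           strong_local_saddle_point (\<alpha> * \<mu>) X Y c g h lam1 lam2 xs ys))"
proof -
  let ?f = "objective c g h lam1 lam2" and ?fR = "relaxed_objective c g h lam1 lam2 \<rho> \<mu>"
  let ?R = "\<lambda>t. relax \<rho> t \<mu>"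
  let ?A = "\<lambda>p y. penalised (\<lambda>x. c x y) g lam1 p"
  let ?B = "\<lambda>p x. penalised (\<lambda>y. - c x y) h lam2 p"
  have rho_pos: "\<rho>_low > 0" "\<rho>_check > 0" and rho_lip: "\<exists>L. L-lipschitz_on {0<..} \<rho>"
    using cond_D by (auto simp: density_condition_def)
  note bounds = mu_bar2_bounds[OF mu(2) lambda tau_sigma alpha rho_pos rho_bar(1) Lc1(1) mu(1)]
  have slice_x: "lipschitz_cont_diff (\<lambda>x. c x y)" and slice_y: "lipschitz_cont_diff (\<lambda>y. c x y)" for x y
    using lipschitz_cont_diff_slices[OF c_smooth] by blast+
  have kernel: "relaxation_kernel \<rho> \<alpha> \<rho>_bar \<mu>"
    by unfold_locales (use alpha density mu(1) rho_lip rho_bar in auto)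
  have PX: "penalised_box \<rho> \<alpha> \<rho>_bar \<mu> (\<lambda>x. c x y) (gradient (\<lambda>x. c x y)) g lam1 u_lo u_up
      \<tau> \<sigma> \<rho>_low \<rho>_check Lc1 Lc2 Lg2" if y: "y \<in> Y" for y
  proof (intro penalised_box.intro kernel penalised_box_axioms.intro)
    show "\<bar>gradient (\<lambda>x. c x y) x $ i\<bar> \<le> Lc1" if "x \<in> cbox u_lo u_up" for x i
      using component_le_infnorm_cart[of "gradient (\<lambda>x. c x y) x" i] Lc1(2)[of x y] that y box_X by simp
    show "\<bar>H $ i $ i\<bar> \<le> Lc2"
      if "x \<in> cbox u_lo u_up" "H \<in> limiting_jacobians (gradient (\<lambda>x. c x y)) x" for x i H
      using Lc2(1)[of x y H i] that y box_X limiting_jacobians_subset_gen_hessian by blast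
  qed (use slice_x lipschitz_cont_diff_gradient c_convex g_smooth lambda tau_sigma cond_A_x cond_D Lg2 bounds
        in blast)+
  have PY: "penalised_box \<rho> \<alpha> \<rho>_bar \<mu> (\<lambda>y. - c x y) (\<lambda>y. - gradient (\<lambda>y. c x y) y) h lam2 v_lo v_up
      \<tau> \<sigma> \<rho>_low \<rho>_check Lc1 Lc2 Lh2" if x: "x \<in> X" for x
  proof (intro penalised_box.intro kernel penalised_box_axioms.intro)
    show "GDERIV (\<lambda>y. - c x y) y :> - gradient (\<lambda>y. c x y) y" for y
      by (rule GDERIV_minus[OF lipschitz_cont_diff_gradient(1)[OF slice_y]])
    show "\<exists>L. L-lipschitz_on UNIV (\<lambda>y. - gradient (\<lambda>y. c x y) y)"
      using lipschitz_cont_diff_gradient(2)[OF slice_y[of x]] by (simp add: lipschitz_on_minus_iff)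
    show "convex_on UNIV (\<lambda>y. - c x y)" using c_concave[of x] by (simp add: concave_on_def)
    show "\<bar>(- gradient (\<lambda>y. c x y) y) $ j\<bar> \<le> Lc1" if "y \<in> cbox v_lo v_up" for y j
      using component_le_infnorm_cart[of "gradient (\<lambda>y. c x y) y" j] Lc1(3)[of x y] that x box_Y by simp
    show "\<bar>M $ j $ j\<bar> \<le> Lc2"
      if "y \<in> cbox v_lo v_up" "M \<in> limiting_jacobians (\<lambda>y. - gradient (\<lambda>y. c x y) y) y" for y j M
    proof -
      have "- M \<in> gen_hessian (\<lambda>y. c x y) y"
        using limiting_jacobians_minus[OF that(2)] limiting_jacobians_subset_gen_hessian by blast
      then show ?thesis using Lc2(2)[of x y "- M" j] that(1) x box_Y by simp
    qed
  qed (use h_smooth lambda tau_sigma cond_A_y cond_D Lh2 bounds in blast)+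
  \<comment> \<open>The terms that depend on the fixed variable only cancel.\<close>
  have f_x: "?f x ys \<le> ?f x' ys \<longleftrightarrow> ?A pos_pow0 ys x \<le> ?A pos_pow0 ys x'"
    and f_y: "?f xs y' \<le> ?f xs y \<longleftrightarrow> ?B pos_pow0 xs y \<le> ?B pos_pow0 xs y'"
    and fR_x: "?fR x ys \<le> ?fR x' ys \<longleftrightarrow> ?A ?R ys x \<le> ?A ?R ys x'"
    and fR_y: "?fR xs y' \<le> ?fR xs y \<longleftrightarrow> ?B ?R xs y \<le> ?B ?R xs y'" for x x' xs y y' ys
    by (auto simp: objective_def relaxed_objective_def penalised_def)
  have saddle: "saddle_point X Y F xs ys \<longleftrightarrow> xs \<in> X \<and> ys \<in> Y \<and>
      (\<forall>x\<in>X. F xs ys \<le> F x ys) \<and> (\<forall>y\<in>Y. F xs y \<le> F xs ys)" for F xs ys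
    unfolding saddle_point_def by blast
  have local_saddleI: "local_saddle_point X Y ?f xs ys"
    if xs: "xs \<in> X" and ys: "ys \<in> Y"
      and mx: "\<exists>\<delta>>0. \<forall>x\<in>X \<inter> cball xs \<delta>. ?A pos_pow0 ys xs \<le> ?A pos_pow0 ys x"
      and my: "\<exists>\<delta>>0. \<forall>y\<in>Y \<inter> cball ys \<delta>. ?B pos_pow0 xs ys \<le> ?B pos_pow0 xs y" for xs ys
  proof -
    obtain d e where d: "d > 0" "\<And>x. x \<in> X \<inter> cball xs d \<Longrightarrow> ?A pos_pow0 ys xs \<le> ?A pos_pow0 ys x"
      and e: "e > 0" "\<And>y. y \<in> Y \<inter> cball ys e \<Longrightarrow> ?B pos_pow0 xs ys \<le> ?B pos_pow0 xs y"
      using mx my by blast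
    have "?f xs y \<le> ?f xs ys \<and> ?f xs ys \<le> ?f x ys"
      if "x \<in> X \<inter> cball xs (min d e)" "y \<in> Y \<inter> cball ys (min d e)" for x y
      unfolding f_x f_y using that by (intro conjI d(2) e(2)) auto
    then show ?thesis
      unfolding local_saddle_point_def using xs ys d(1) e(1) by (intro conjI exI[of _ "min d e"]) auto
  qed
  have strongI: "strong_local_saddle_point (\<alpha> * \<mu>) X Y c g h lam1 lam2 xs ys"
    if "local_saddle_point X Y ?f xs ys"
      "\<forall>i. \<forall>k\<in>{Inl i, Inr i}. g k (xs $ i) \<notin> {0<..<\<alpha> * \<mu>}"
      "\<forall>j. \<forall>k\<in>{Inl j, Inr j}. h k (ys $ j) \<notin> {0<..<\<alpha> * \<mu>}" for xs ys
    using that unfolding strong_local_saddle_point_def by blast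
  have stat: "penalised_box.stationary \<rho> \<mu> (gradient (\<lambda>x. c x ys)) g lam1 u_lo u_up xs"
      "penalised_box.stationary \<rho> \<mu> (\<lambda>y. - gradient (\<lambda>y. c xs y) y) h lam2 v_lo v_up ys"
      "penalised_box.no_gap \<alpha> \<mu> g xs" "penalised_box.no_gap \<alpha> \<mu> h ys"
    if wk: "weak_second_order_stationary X Y c g h lam1 lam2 \<rho> \<tau> \<mu> xs ys" for xs ys
  proof -
    note wk' = wk[unfolded weak_second_order_stationary_def]
    note xs = wk'[THEN conjunct1] and ys = wk'[THEN conjunct2, THEN conjunct1]
      and sx = wk'[THEN conjunct2, THEN conjunct2, THEN conjunct1]
      and sy = wk'[THEN conjunct2, THEN conjunct2, THEN conjunct2, THEN conjunct1]
      and second_x = wk'[THEN conjunct2, THEN conjunct2, THEN conjunct2, THEN conjunct2, THEN conjunct1]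
      and second_y = wk'[THEN conjunct2, THEN conjunct2, THEN conjunct2, THEN conjunct2, THEN conjunct2]
    interpret PX: penalised_box \<rho> \<alpha> \<rho>_bar \<mu> "\<lambda>x. c x ys" "gradient (\<lambda>x. c x ys)" g lam1 u_lo u_up
      \<tau> \<sigma> \<rho>_low \<rho>_check Lc1 Lc2 Lg2 by (rule PX[OF ys])
    interpret PY: penalised_box \<rho> \<alpha> \<rho>_bar \<mu> "\<lambda>y. - c xs y" "\<lambda>y. - gradient (\<lambda>y. c xs y) y" h lam2 v_lo v_up
      \<tau> \<sigma> \<rho>_low \<rho>_check Lc1 Lc2 Lh2 by (rule PY[OF xs])
    obtain p v where pv: "p \<in> rel_subdiff_x c g lam1 \<rho> \<mu> xs ys" "v \<in> normal_cone X xs" "0 = p + v"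
      using sx by (rule set_plus_elim)
    obtain a where a: "\<forall>i. \<forall>k\<in>{Inl i, Inr i}. a k \<in> clarke_subdiff ?R (g k (xs $ i))"
      "p = gradient (\<lambda>x'. c x' ys) xs + lam1 *\<^sub>R (\<Sum>i\<in>UNIV. (a (Inl i) * deriv (g (Inl i)) (xs $ i)
        + a (Inr i) * deriv (g (Inr i)) (xs $ i)) *\<^sub>R axis i 1)"
      using pv(1) unfolding rel_subdiff_x_def by blast
    show stx: "PX.stationary xs"
      unfolding PX.stationary_def
      using xs[unfolded box_X] a(1) pv(2)[unfolded box_X] pv(3)[symmetric, unfolded a(2)]
      by (intro conjI exI[of _ a] exI[of _ v])
    obtain q v' where qv: "q \<in> uminus ` rel_subdiff_y c h lam2 \<rho> \<mu> xs ys" "v' \<in> normal_cone Y ys" "0 = q + v'"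
      using sy by (rule set_plus_elim)
    obtain b where b: "\<forall>j. \<forall>k\<in>{Inl j, Inr j}. b k \<in> clarke_subdiff ?R (h k (ys $ j))"
      "q = - (gradient (\<lambda>y'. c xs y') ys - lam2 *\<^sub>R (\<Sum>j\<in>UNIV. (b (Inl j) * deriv (h (Inl j)) (ys $ j)
        + b (Inr j) * deriv (h (Inr j)) (ys $ j)) *\<^sub>R axis j 1))"
      using qv(1) unfolding rel_subdiff_y_def by blast
    have zero: "- gradient (\<lambda>y'. c xs y') ys + lam2 *\<^sub>R (\<Sum>j\<in>UNIV. (b (Inl j) * deriv (h (Inl j)) (ys $ j)
        + b (Inr j) * deriv (h (Inr j)) (ys $ j)) *\<^sub>R axis j 1) + v' = 0"
      using qv(3) b(2) by simp
    show sty: "PY.stationary ys"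
      unfolding PY.stationary_def using ys[unfolded box_Y] b(1) qv(2)[unfolded box_Y] zero
      by (intro conjI exI[of _ b] exI[of _ v'])
    show "PX.no_gap xs"
    proof (rule PX.no_gap_of_stationary[OF stx])
      fix i k assume k: "k \<in> {Inl i, Inr i}" "g k (xs $ i) \<in> {0<..<\<tau>}"
      then have i: "i \<in> active_pos \<tau> g xs" by (auto simp: active_pos_def)
      obtain z where z: "z \<in> (\<lambda>H. H $ i $ i) ` gen_hessian (\<lambda>x'. c x' ys) xs
          + (*) lam1 ` rel_second_deriv \<rho> \<mu> (g k) (xs $ i)" "z \<ge> 0"
        using second_x[THEN bspec, OF i, THEN conjunct2, THEN bspec, OF k(1), THEN mp, OF k(2)] by (elim bexE)
      obtain \<eta> o' where o: "\<eta> \<in> (\<lambda>H. H $ i $ i) ` gen_hessian (\<lambda>x'. c x' ys) xs"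
        "o' \<in> (*) lam1 ` rel_second_deriv \<rho> \<mu> (g k) (xs $ i)" "z = \<eta> + o'"
        using z(1) by (rule set_plus_elim)
      have "\<bar>\<eta>\<bar> \<le> Lc2" using o(1) Lc2(1)[OF xs ys] by blast
      then show "\<exists>\<eta> \<omega>. \<bar>\<eta>\<bar> \<le> Lc2 \<and> \<omega> \<in> rel_second_deriv \<rho> \<mu> (g k) (xs $ i) \<and> 0 \<le> \<eta> + lam1 * \<omega>"
        using o(2,3) z(2) by blast
    qed
    show "PY.no_gap ys"
    proof (rule PY.no_gap_of_stationary[OF sty])
      fix j k assume k: "k \<in> {Inl j, Inr j}" "h k (ys $ j) \<in> {0<..<\<tau>}"
      then have j: "j \<in> active_pos \<tau> h ys" by (auto simp: active_pos_def)
      obtain z where z: "z \<in> (\<lambda>M. - (M $ j $ j)) ` gen_hessian (\<lambda>y'. c xs y') ys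
          + (*) lam2 ` rel_second_deriv \<rho> \<mu> (h k) (ys $ j)" "z \<ge> 0"
        using second_y[THEN bspec, OF j, THEN conjunct2, THEN bspec, OF k(1), THEN mp, OF k(2)] by (elim bexE)
      obtain \<eta> o' where o: "\<eta> \<in> (\<lambda>M. - (M $ j $ j)) ` gen_hessian (\<lambda>y'. c xs y') ys"
        "o' \<in> (*) lam2 ` rel_second_deriv \<rho> \<mu> (h k) (ys $ j)" "z = \<eta> + o'"
        using z(1) by (rule set_plus_elim)
      have "\<bar>\<eta>\<bar> \<le> Lc2" using o(1) Lc2(2)[OF xs ys] by auto
      then show "\<exists>\<eta> \<omega>. \<bar>\<eta>\<bar> \<le> Lc2 \<and> \<omega> \<in> rel_second_deriv \<rho> \<mu> (h k) (ys $ j) \<and> 0 \<le> \<eta> + lam2 * \<omega>"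
        using o(2,3) z(2) by blast
    qed
  qed
  have gaps: "(\<forall>i. \<forall>k\<in>{Inl i, Inr i}. g k (xs $ i) \<notin> {0<..<\<alpha> * \<mu>}) \<and>
        (\<forall>j. \<forall>k\<in>{Inl j, Inr j}. h k (ys $ j) \<notin> {0<..<\<alpha> * \<mu>})"
    if wk: "weak_second_order_stationary X Y c g h lam1 lam2 \<rho> \<tau> \<mu> xs ys" for xs ys
  proof -
    have "xs \<in> X" "ys \<in> Y" using wk unfolding weak_second_order_stationary_def by blast+
    then show ?thesis
      using stat(3,4)[OF wk] penalised_box.no_gap_def[OF PX] penalised_box.no_gap_def[OF PY] by blast
  qed
  have saddle_iff: "saddle_point X Y ?f xs ys \<longleftrightarrow> saddle_point X Y ?fR xs ys" for xs ys
  proof (cases "xs \<in> X \<and> ys \<in> Y")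
    case True
    then show ?thesis
      unfolding saddle f_x f_y fR_x fR_y
      using penalised_box.minimiser_iff[OF PX, of ys xs] penalised_box.minimiser_iff[OF PY, of xs ys]
      unfolding box_X box_Y by blast
  qed (auto simp: saddle)
  have strong_of_local: "strong_local_saddle_point (\<alpha> * \<mu>) X Y c g h lam1 lam2 xs ys"
    if loc: "local_saddle_point X Y ?fR xs ys" for xs ys
  proof -
    obtain \<delta> where xs: "xs \<in> X" and ys: "ys \<in> Y" and dpos: "\<delta> > 0"
      and sad: "\<And>x y. x \<in> X \<inter> cball xs \<delta> \<Longrightarrow> y \<in> Y \<inter> cball ys \<delta> \<Longrightarrow>
        ?fR xs y \<le> ?fR xs ys \<and> ?fR xs ys \<le> ?fR x ys"
      using loc unfolding local_saddle_point_def by blast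
    interpret PX: penalised_box \<rho> \<alpha> \<rho>_bar \<mu> "\<lambda>x. c x ys" "gradient (\<lambda>x. c x ys)" g lam1 u_lo u_up
      \<tau> \<sigma> \<rho>_low \<rho>_check Lc1 Lc2 Lg2 by (rule PX[OF ys])
    interpret PY: penalised_box \<rho> \<alpha> \<rho>_bar \<mu> "\<lambda>y. - c xs y" "\<lambda>y. - gradient (\<lambda>y. c xs y) y" h lam2 v_lo v_up
      \<tau> \<sigma> \<rho>_low \<rho>_check Lc1 Lc2 Lh2 by (rule PY[OF xs])
    have self: "xs \<in> X \<inter> cball xs \<delta>" "ys \<in> Y \<inter> cball ys \<delta>" using xs ys dpos by auto
    have mx: "?A ?R ys xs \<le> ?A ?R ys x" if "x \<in> X \<inter> cball xs \<delta>" for x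
      using sad[OF that self(2)] fR_x by blast
    have my: "?B ?R xs ys \<le> ?B ?R xs y" if "y \<in> Y \<inter> cball ys \<delta>" for y
      using sad[OF self(1) that] fR_y by blast
    have gx: "PX.no_gap xs"
      by (rule PX.no_gap_of_local_min[OF _ dpos]) (use xs mx in \<open>simp_all add: box_X\<close>)
    have gy: "PY.no_gap ys"
      by (rule PY.no_gap_of_local_min[OF _ dpos]) (use ys my in \<open>simp_all add: box_Y\<close>)
    have "?A pos_pow0 ys xs \<le> ?A pos_pow0 ys x" if "x \<in> X \<inter> cball xs \<delta>" for x
      using mx[OF that] PX.penalised_eq_of_no_gap[OF gx] PX.penalised_relax_le[of x] by linarith
    moreover have "?B pos_pow0 xs ys \<le> ?B pos_pow0 xs y" if "y \<in> Y \<inter> cball ys \<delta>" for y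
      using my[OF that] PY.penalised_eq_of_no_gap[OF gy] PY.penalised_relax_le[of y] by linarith
    ultimately have "local_saddle_point X Y ?f xs ys" using dpos by (intro local_saddleI xs ys) blast+
    then show ?thesis using gx gy unfolding PX.no_gap_def PY.no_gap_def by (rule strongI)
  qed
  have strong_of_convex: "strong_local_saddle_point (\<alpha> * \<mu>) X Y c g h lam1 lam2 xs ys"
    if gh: "\<And>k. convex_on UNIV (g k)" "\<And>k. convex_on UNIV (h k)"
      and wk: "weak_second_order_stationary X Y c g h lam1 lam2 \<rho> \<tau> \<mu> xs ys" for xs ys
  proof -
    have xs: "xs \<in> X" and ys: "ys \<in> Y" using wk unfolding weak_second_order_stationary_def by blast+
    have "local_saddle_point X Y ?f xs ys"
    proof (rule local_saddleI[OF xs ys])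
      show "\<exists>\<delta>>0. \<forall>x\<in>X \<inter> cball xs \<delta>. ?A pos_pow0 ys xs \<le> ?A pos_pow0 ys x"
        using penalised_box.local_min_of_stationary_convex[OF PX[OF ys] stat(1)[OF wk] stat(3)[OF wk] gh(1)]
        unfolding box_X .
      show "\<exists>\<delta>>0. \<forall>y\<in>Y \<inter> cball ys \<delta>. ?B pos_pow0 xs ys \<le> ?B pos_pow0 xs y"
        using penalised_box.local_min_of_stationary_convex[OF PY[OF xs] stat(2)[OF wk] stat(4)[OF wk] gh(2)]
        unfolding box_Y .
    qed
    then show ?thesis using gaps[OF wk] by (intro strongI) blast+
  qed
  show ?thesis using gaps saddle_iff strong_of_local strong_of_convex by blast
qed

end
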